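(* For a positive Borel measure $\mu$ on $\mathbb{R}_+ = (0,\infty)$, consider the measure $\rho$ on $\mathbb{R}_+$ defined by $d\rho(\lambda) := \frac{d\mu(\lambda)}{1+\lambda^2}$. Then the following are equivalent: (a) There exists an $\alpha\in\mathbb{R}$ with $$\int_{\mathbb{R}_+}|f(i\lambda)|^2\,d\mu(\lambda)\leq\alpha\|f\|^2\quad\text{for } f\in H^2(\mathbb{C}_+),$$ i.e., $\mu$ is the Carleson measure of a positive Hankel operator on $H^2(\mathbb{C}_+)$. (b) $\rho((0,x)) = O(x)$ and $\rho((x^{-1},\infty)) = O(x)$ for $x\to 0+$. If these conditions are satisfied, then $\rho(\mathbb{R}_+)<\infty$ and there exist $\beta,\gamma>0$ such that $$\rho((0,\varepsilon])\leq\beta\varepsilon\quad\text{and}\quad\rho([t,\infty))\leq\frac{\gamma}{t}\quad\text{for every }\varepsilon,t\in\mathbb{R}_+.$$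
   Context: $\mathbb{C}_+ = \{z\in\mathbb{C}:\operatorname{Im}z>0\}$. $H^2(\mathbb{C}_+)$ is the Hardy space of the upper half plane, identified via non-tangential boundary values with a closed subspace of $L^2(\mathbb{R})$, and $\|\cdot\|$ is its norm; scalar products are antilinear in the first argument. A Hankel operator on $H^2(\mathbb{C}_+)$ is a bounded operator of the form $P_+hRP_+^*$ with $h\in L^\infty(\mathbb{R})$, where $P_+:L^2(\mathbb{R})\to H^2(\mathbb{C}_+)$ is the orthogonal projection, $(Rf)(x) = f(-x)$, and $hR$ is $R$ followed by multiplication by $h$. A positive Borel measure $\mu$ on $\mathbb{R}_+$ is the Carleson measure of a positive Hankel operator $H$ on $H^2(\mathbb{C}_+)$ if $\langle f,Hg\rangle = \int_{\mathbb{R}_+}\overline{f(i\lambda)}g(i\lambda)\,d\mu(\lambda)$ for all $f,g\in H^2(\mathbb{C}_+)$.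
   Formalization: The positive Borel measure μ is additionally assumed finite on compact subsets of (0,∞); without this (b) does not imply (a), e.g. for μ = ∞·δ_1. *)

theory Defs
  imports "HOL-Complex_Analysis.Complex_Analysis"
begin

text \<open>
  Elements of \<open>L\<^sup>2(\<real>)\<close> and \<open>L\<^sup>\<infinity>(\<real>)\<close> are represented by functions (identified up to
  null sets), elements of the Hardy space by functions on \<open>complex\<close> of which only the values
  on the upper half plane matter.  The Lebesgue (complete) measure is used, so that a
  function defined only almost everywhere by a limit is measurable.
\<close>

definition upper_half_plane :: "complex set" where
  "upper_half_plane = {z. Im z > 0}"

definition Linfty :: "(real \<Rightarrow> complex) set" where
  "Linfty = {h \<in> borel_measurable lebesgue. \<exists>C. AE x in lebesgue. norm (h x) \<le> C}"

definition L2_inner :: "(real \<Rightarrow> complex) \<Rightarrow> (real \<Rightarrow> complex) \<Rightarrow> complex" where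
  "L2_inner u v = (LINT x|lebesgue. cnj (u x) * v x)"

definition hardy2 :: "(complex \<Rightarrow> complex) set" where
  "hardy2 = {f. f holomorphic_on upper_half_plane \<and>
     (SUP y\<in>{0<..}. \<integral>\<^sup>+ x. ennreal ((norm (f (Complex x y)))\<^sup>2) \<partial>lborel) < \<infinity>}"

definition has_nontangential_limit :: "(complex \<Rightarrow> complex) \<Rightarrow> real \<Rightarrow> complex \<Rightarrow> bool" where
  "has_nontangential_limit f x l \<longleftrightarrow>
     (\<forall>a>0. (f \<longlongrightarrow> l) (at (complex_of_real x) within
               {z \<in> upper_half_plane. \<bar>Re z - x\<bar> < a * Im z}))"

text \<open>The value 0 at points without a non-tangential limit is immaterial: for
  \<open>f \<in> hardy2\<close> these points form a null set, by Fatou's theorem.\<close>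

definition boundary_value :: "(complex \<Rightarrow> complex) \<Rightarrow> real \<Rightarrow> complex" where
  "boundary_value f x =
     (if \<exists>l. has_nontangential_limit f x l then THE l. has_nontangential_limit f x l else 0)"

definition hardy_inner :: "(complex \<Rightarrow> complex) \<Rightarrow> (complex \<Rightarrow> complex) \<Rightarrow> complex" where
  "hardy_inner f g = L2_inner (boundary_value f) (boundary_value g)"

definition hardy_norm :: "(complex \<Rightarrow> complex) \<Rightarrow> real" where
  "hardy_norm f = sqrt (LINT x|lebesgue. (norm (boundary_value f x))\<^sup>2)"

text \<open>\<open>is_hardy_projection u p\<close> says \<open>p = P\<^sub>+ u\<close> for \<open>u\<close> in \<open>L\<^sup>2(\<real>)\<close>.  It is a relation because
  \<open>p\<close> is determined on the upper half plane only.\<close>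

definition is_hardy_projection :: "(real \<Rightarrow> complex) \<Rightarrow> (complex \<Rightarrow> complex) \<Rightarrow> bool" where
  "is_hardy_projection u p \<longleftrightarrow> p \<in> hardy2 \<and>
     (\<forall>q\<in>hardy2. L2_inner (boundary_value q) (\<lambda>x. u x - boundary_value p x) = 0)"

text \<open>\<open>H g = P\<^sub>+ (h \<cdot> R g)\<close> with \<open>(R g)(x) = g (-x)\<close>.  Linearity and boundedness of \<open>H\<close> on the
  Hardy space are automatic, as \<open>h\<close> is essentially bounded.\<close>

definition hankel_operator :: "((complex \<Rightarrow> complex) \<Rightarrow> (complex \<Rightarrow> complex)) \<Rightarrow> bool" where
  "hankel_operator H \<longleftrightarrow>
     (\<exists>h\<in>Linfty. \<forall>g\<in>hardy2. is_hardy_projection (\<lambda>x. h x * boundary_value g (- x)) (H g))"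

definition positive_hankel_operator :: "((complex \<Rightarrow> complex) \<Rightarrow> (complex \<Rightarrow> complex)) \<Rightarrow> bool" where
  "positive_hankel_operator H \<longleftrightarrow>
     hankel_operator H \<and> (\<forall>f\<in>hardy2. hardy_inner f (H f) \<in> \<real>\<^sub>\<ge>\<^sub>0)"

definition is_carleson_measure ::
    "real measure \<Rightarrow> ((complex \<Rightarrow> complex) \<Rightarrow> (complex \<Rightarrow> complex)) \<Rightarrow> bool" where
  "is_carleson_measure M H \<longleftrightarrow>
     (\<forall>f\<in>hardy2. \<forall>g\<in>hardy2.
        integrable M (\<lambda>t. cnj (f (\<i> * complex_of_real t)) * g (\<i> * complex_of_real t)) \<and>
        hardy_inner f (H g) =
          (LINT t|M. cnj (f (\<i> * complex_of_real t)) * g (\<i> * complex_of_real t)))"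

text \<open>A positive Borel measure on \<open>(0,\<infinity>)\<close>; as usual for Borel measures on locally compact
  spaces, compact subsets have finite measure.\<close>

definition positive_borel_measure_Rplus :: "real measure \<Rightarrow> bool" where
  "positive_borel_measure_Rplus M \<longleftrightarrow>
     sets M = sets (restrict_space borel {0<..}) \<and>
     (\<forall>K. compact K \<and> K \<subseteq> {0<..} \<longrightarrow> emeasure M K < \<infinity>)"

text \<open>\<open>\<phi>(x) = O(x)\<close> for \<open>x \<rightarrow> 0+\<close>, for functions with values in \<open>[0,\<infinity>]\<close>.  The library's
  Landau symbols need real values, and \<open>measure\<close> would turn \<open>\<infinity>\<close> into 0.\<close>

definition bigo_id_at_0 :: "(real \<Rightarrow> ennreal) \<Rightarrow> bool" where
  "bigo_id_at_0 \<phi> \<longleftrightarrow> (\<exists>C. \<forall>\<^sub>F x in at_right 0. \<phi> x \<le> ennreal (C * x))"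

end

theory Submission
  imports Defs "HOL-Real_Asymp.Real_Asymp"
begin

text \<open>
  Condition (b) is equivalent to the scale-invariant growth condition \<open>\<mu>((0,s]) \<le> C s\<close> for all \<open>s\<close>.
  Testing (a) on \<open>z \<mapsto> 1 / (z + \<i> x)\<close> gives (b).  Conversely, Cauchy's formula bounds \<open>|f(\<i> t)|\<close> by the
  integral of \<open>|f(s)|\<close> against the kernel \<open>1 / (|s| + t)\<close>, and under the growth condition this kernel is
  bounded between \<open>L\<^sup>2(ds)\<close> and \<open>L\<^sup>2(\<mu>)\<close> by the Schur test with power weights; this is (a).  The same kernel
  shows that \<open>(H g)(z) = \<i> / (2 \<pi>) \<integral> g(\<i> t) / (z + \<i> t) d\<mu>(t)\<close> lies in the Hardy space, and \<open>H\<close> is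
  the Hankel operator whose symbol is the \<open>\<mu>\<close>-integral of a Poisson kernel times a bounded analytic factor.

  Boundary values come from two facts: \<open>\<integral> cnj f(x + \<i> y) f(x + \<i> y') dx\<close> depends only on \<open>y + y'\<close>, so the
  restrictions of \<open>f\<close> to horizontal lines converge in \<open>L\<^sup>2\<close> as \<open>y \<rightarrow> 0\<close>; and the difference between \<open>f\<close> and
  its vertical translates is controlled on cones by the maximal function, which turns \<open>L\<^sup>2\<close> convergence
  into non-tangential convergence almost everywhere.
\<close>

section \<open>Integral inequalities\<close>

text \<open>\<open>hardy2\<close> controls \<open>f\<close> only on the horizontal lines inside the
  half plane, while norm, inner product and projection are expressed by non-tangential limits on the
  real line. Identities are therefore proved for the translates
  \<open>f (z + \<i> \<epsilon>)\<close>, which are holomorphic across the real line and bounded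
  near it, and then carried to the boundary function by \<open>L\<^sup>2\<close> convergence. Decay
  along lines is known only in the mean, so contours are moved by integrability over strips. The
  growth condition is the right form of (b) because \<rho> resembles \<mu> near 0 and
  \<open>t\<^sup>-\<^sup>2 d\<mu>\<close> near infinity, and local finiteness of \<mu> covers the
  scales in between. The kernel \<open>1 / (|s| + t)\<close> is homogeneous of degree -1 and not
  square integrable in both variables, so Cauchy-Schwarz alone fails; weights of exponent -1/2
  reproduce themselves under it. The obstacle for the symbol: already for Lebesgue measure the
  integral of \<open>t / (s\<^sup>2 + t\<^sup>2)\<close> diverges logarithmically at infinity. A
  symbol is not determined by its operator, which leaves room for the analytic factor.\<close>

lemma nn_integral_FTC_greaterThan:
  fixes f :: "real \<Rightarrow> real"
  assumes f_borel: "f \<in> borel_measurable borel"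
  assumes f: "\<And>x. a < x \<Longrightarrow> DERIV F x :> f x"
  assumes nonneg: "\<And>x. a < x \<Longrightarrow> 0 \<le> f x"
  assumes cont: "(F \<longlongrightarrow> F a) (at_right a)"
  assumes lim: "(F \<longlongrightarrow> T) at_top"
  shows "(\<integral>\<^sup>+x. ennreal (f x) * indicator {a<..} x \<partial>lborel) = ennreal (T - F a)"
proof -
  have nonneg': "0 \<le> f x" if "a + 1 / real (Suc n) \<le> x" for n x
    using that by (intro nonneg) (smt (verit) of_nat_0_less_iff zero_less_Suc zero_less_divide_1_iff)
  have 1: "(\<integral>\<^sup>+x. ennreal (f x) * indicator {a + 1 / real (Suc n)..} x \<partial>lborel) =
      ennreal (T - F (a + 1 / real (Suc n)))" for n
  proof (rule nn_integral_FTC_atLeast[OF f_borel])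
    fix x assume "a + 1 / real (Suc n) \<le> x"
    then have "a < x" by (smt (verit) of_nat_0_less_iff zero_less_Suc zero_less_divide_1_iff)
    then show "DERIV F x :> f x" "0 \<le> f x" using f nonneg by auto
  qed (rule lim)
  \<comment> \<open>Monotone convergence over rays that stop short of \<open>a\<close>, where the
    integrand may blow up; the application has a singularity of type \<open>1 / sqrt s\<close> at
    0.\<close>
  have 2: "(\<lambda>n. \<integral>\<^sup>+x. ennreal (f x) * indicator {a + 1 / real (Suc n)..} x \<partial>lborel)
      \<longlonglongrightarrow> (\<integral>\<^sup>+x. ennreal (f x) * indicator {a<..} x \<partial>lborel)"
  proof (rule nn_integral_LIMSEQ)
    show "incseq (\<lambda>n x. ennreal (f x) * indicator {a + 1 / real (Suc n)..} x)"
    proof (intro incseq_SucI le_funI mult_left_mono)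
      fix n x
      have "1 / real (Suc (Suc n)) \<le> 1 / real (Suc n)" by (simp add: field_simps)
      then show "(indicator {a + 1 / real (Suc n)..} x :: ennreal) \<le> indicator {a + 1 / real (Suc (Suc n))..} x"
        by (auto split: split_indicator)
    qed simp
    show "(\<lambda>n. ennreal (f x) * indicator {a + 1 / real (Suc n)..} x) \<longlonglongrightarrow> ennreal (f x) * indicator {a<..} x" for x
    proof (cases "a < x")
      case True
      have "(\<lambda>n. a + 1 / real (Suc n)) \<longlonglongrightarrow> a + 0"
        by (intro tendsto_intros LIMSEQ_Suc lim_1_over_n)
      then have "\<forall>\<^sub>F n in sequentially. a + 1 / real (Suc n) < x"
        using True by (simp add: order_tendsto_iff)
      then have "\<forall>\<^sub>F n in sequentially. ennreal (f x) * indicator {a + 1 / real (Suc n)..} x = ennreal (f x) * indicator {a<..} x"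
        by eventually_elim (use True in auto)
      then show ?thesis by (rule tendsto_eventually)
    next
      case False
      have *: "\<not> a + 1 / real (Suc n) \<le> x" for n
        using False by (smt (verit) of_nat_0_less_iff zero_less_Suc zero_less_divide_1_iff)
      have "ennreal (f x) * indicator {a + 1 / real (Suc n)..} x = 0" for n
        using *[of n] by (simp del: of_nat_Suc)
      moreover have "ennreal (f x) * indicator {a<..} x = 0" using False by simp
      ultimately show ?thesis by (simp only: tendsto_const)
    qed
  qed (use f_borel in measurable)
  have "filterlim (\<lambda>n. a + 1 / real (Suc n)) (at_right a) sequentially"
    by real_asymp
  then have "(\<lambda>n. F (a + 1 / real (Suc n))) \<longlonglongrightarrow> F a"
    using cont filterlim_compose by blast
  then have 3: "(\<lambda>n. ennreal (T - F (a + 1 / real (Suc n)))) \<longlonglongrightarrow> ennreal (T - F a)"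
    by (intro tendsto_intros)
  show ?thesis using 2 3 unfolding 1 by (rule LIMSEQ_unique)
qed

text \<open>The measures to which the next three lemmas are applied: \<open>\<mu>\<close> with \<open>\<tau>(t) = t\<close>, Lebesgue
  measure with \<open>\<tau>(x) = |x|\<close>, and measures with density with \<open>\<tau>(s) = |s - x|\<close>.\<close>

lemma linear_growth_nn_integral:
  fixes \<tau> :: "'a \<Rightarrow> real" and g :: "real \<Rightarrow> real"
  assumes N: "sigma_finite_measure N" and \<tau>[measurable]: "\<tau> \<in> borel_measurable N"
    and growth: "\<And>s. emeasure N {x\<in>space N. \<tau> x \<le> s} \<le> ennreal (C * s)"
    and g[measurable]: "g \<in> borel_measurable borel"
    and \<phi>: "\<And>x. x \<in> space N \<Longrightarrow> \<phi> x \<le> (\<integral>\<^sup>+s. ennreal (g s) * indicator {\<tau> x..} s \<partial>lborel)"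
  shows "(\<integral>\<^sup>+x. \<phi> x \<partial>N) \<le> (\<integral>\<^sup>+s. ennreal (g s) * ennreal (C * s) \<partial>lborel)"
proof -
  interpret N: sigma_finite_measure N by fact
  interpret P: pair_sigma_finite N lborel
    by (intro pair_sigma_finite.intro N lborel.sigma_finite_measure_axioms)
  \<comment> \<open>Layer-cake argument: \<phi> is dominated by a superposition of indicators of the
    sets where \<open>\<tau> x \<le> s\<close>, with weight \<open>g s\<close>. Fubini leaves only
    the measures of these sets, which is all that \<open>growth\<close> knows about
    \<open>N\<close>.\<close>
  have "(\<integral>\<^sup>+x. \<phi> x \<partial>N) \<le> (\<integral>\<^sup>+x. \<integral>\<^sup>+s. ennreal (g s) * indicator {p. \<tau> (fst p) \<le> snd p} (x, s) \<partial>lborel \<partial>N)"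
    by (intro nn_integral_mono order_trans[OF \<phi>]) (auto intro!: nn_integral_mono split: split_indicator)
  also have "\<dots> = (\<integral>\<^sup>+s. \<integral>\<^sup>+x. ennreal (g s) * indicator {p. \<tau> (fst p) \<le> snd p} (x, s) \<partial>N \<partial>lborel)"
  proof (rule P.Fubini'[symmetric])
    have "{p \<in> space (N \<Otimes>\<^sub>M lborel). \<tau> (fst p) \<le> snd p} \<in> sets (N \<Otimes>\<^sub>M lborel)"
      by measurable
    then have "(\<lambda>p. ennreal (g (snd p)) * indicator {p \<in> space (N \<Otimes>\<^sub>M lborel). \<tau> (fst p) \<le> snd p} p)
       \<in> borel_measurable (N \<Otimes>\<^sub>M lborel)" by measurable
    then show "(\<lambda>(x, s). ennreal (g s) * indicator {p. \<tau> (fst p) \<le> snd p} (x, s)) \<in> borel_measurable (N \<Otimes>\<^sub>M lborel)"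
      by (rule measurable_cong[THEN iffD1, rotated]) (auto split: split_indicator)
  qed
  also have "\<dots> = (\<integral>\<^sup>+s. ennreal (g s) * emeasure N {x\<in>space N. \<tau> x \<le> s} \<partial>lborel)"
  proof (rule nn_integral_cong)
    fix s :: real
    have "(\<integral>\<^sup>+x. ennreal (g s) * indicator {p. \<tau> (fst p) \<le> snd p} (x, s) \<partial>N)
       = (\<integral>\<^sup>+x. ennreal (g s) * indicator {x\<in>space N. \<tau> x \<le> s} x \<partial>N)"
      by (intro nn_integral_cong) (auto split: split_indicator)
    also have "\<dots> = ennreal (g s) * emeasure N {x\<in>space N. \<tau> x \<le> s}"
      by (subst nn_integral_cmult_indicator) measurable
    finally show "(\<integral>\<^sup>+x. ennreal (g s) * indicator {p. \<tau> (fst p) \<le> snd p} (x, s) \<partial>N)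
      = ennreal (g s) * emeasure N {x\<in>space N. \<tau> x \<le> s}" .
  qed
  also have "\<dots> \<le> (\<integral>\<^sup>+s. ennreal (g s) * ennreal (C * s) \<partial>lborel)"
    by (intro nn_integral_mono mult_left_mono growth) auto
  finally show ?thesis .
qed

text \<open>Layer-cake with \<open>g\<close> equal to minus the derivative of
  \<open>y / (s + y)^2\<close>, so that the kernel at \<open>\<tau> x\<close> is the integral of
  \<open>g\<close> over the ray from \<open>\<tau> x\<close>. Then
  \<open>s / (s + y) \<le> 1\<close> leaves \<open>2 * C * y / (s + y)^2\<close>, whose integral is
  \<open>2 * C\<close>. The point is uniformity in \<open>y\<close>: it yields both the bounded
  symbol and the estimate on cones.\<close>

lemma linear_growth_poisson_kernel:
  fixes \<tau> :: "'a \<Rightarrow> real"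
  assumes N: "sigma_finite_measure N" and \<tau>: "\<tau> \<in> borel_measurable N"
    and nonneg: "\<And>x. x \<in> space N \<Longrightarrow> 0 \<le> \<tau> x"
    and growth: "\<And>s. emeasure N {x\<in>space N. \<tau> x \<le> s} \<le> ennreal (C * s)"
    and C: "C \<ge> 0" and y: "y > 0"
  shows "(\<integral>\<^sup>+x. ennreal (y / (\<tau> x + y)\<^sup>2) \<partial>N) \<le> ennreal (2 * C)"
proof -
  define g where "g s = (if 0 \<le> s then 2 * y / (s + y)^3 else 0)" for s :: real
  have g[measurable]: "g \<in> borel_measurable borel" unfolding g_def by measurable
  have "(\<integral>\<^sup>+x. ennreal (y / (\<tau> x + y)\<^sup>2) \<partial>N) \<le> (\<integral>\<^sup>+s. ennreal (g s) * ennreal (C * s) \<partial>lborel)"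
  proof (rule linear_growth_nn_integral[OF N \<tau> growth g])
    fix x assume x: "x \<in> space N"
    have "(\<integral>\<^sup>+s. ennreal (g s) * indicator {\<tau> x..} s \<partial>lborel) = ennreal (0 - (- y / (\<tau> x + y)\<^sup>2))"
    proof (rule nn_integral_FTC_atLeast[OF g])
      fix s assume s: "\<tau> x \<le> s"
      then have p: "s \<ge> 0" "s + y > 0" using nonneg[OF x] y by auto
      define u where "u = s + y"
      have "((\<lambda>s. - y / (s + y)\<^sup>2) has_real_derivative (y * (2 * u)) / (u\<^sup>2 * u\<^sup>2)) (at s)"
        using p by (auto intro!: derivative_eq_intros simp: u_def power2_eq_square)
      also have "(y * (2 * u)) / (u\<^sup>2 * u\<^sup>2) = g s"
        using p unfolding g_def u_def[symmetric] by (simp add: power2_eq_square power3_eq_cube mult.commute)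
      finally show "((\<lambda>s. - y / (s + y)\<^sup>2) has_real_derivative g s) (at s)" .
      show "0 \<le> g s" using p y by (auto simp: g_def)
    next
      show "((\<lambda>s. - y / (s + y)\<^sup>2) \<longlongrightarrow> 0) at_top" by real_asymp
    qed
    then show "ennreal (y / (\<tau> x + y)\<^sup>2) \<le> (\<integral>\<^sup>+s. ennreal (g s) * indicator {\<tau> x..} s \<partial>lborel)"
      by simp
  qed
  also have "\<dots> \<le> (\<integral>\<^sup>+s. ennreal (2 * C * y / (s + y)\<^sup>2) * indicator {0..} s \<partial>lborel)"
  proof (rule nn_integral_mono)
    fix s :: real
    show "ennreal (g s) * ennreal (C * s) \<le> ennreal (2 * C * y / (s + y)\<^sup>2) * indicator {0..} s"
    proof (cases "0 \<le> s")
      case True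
      have "2 * y / (s + y)^3 * (C * s) = 2 * C * y / (s + y)\<^sup>2 * (s / (s + y))"
        by (simp add: power2_eq_square power3_eq_cube mult_ac)
      also have "\<dots> \<le> 2 * C * y / (s + y)\<^sup>2 * 1"
        using True y C by (intro mult_left_mono) auto
      finally show ?thesis using True y C
        by (auto simp: g_def ennreal_mult[symmetric] intro!: ennreal_leI)
    qed (auto simp: g_def)
  qed
  also have "\<dots> = ennreal (0 - (- (2 * C * y) / (0 + y)))"
  proof (rule nn_integral_FTC_atLeast)
    fix s :: real assume s: "0 \<le> s"
    then have p: "s + y > 0" using y by auto
    then show "((\<lambda>s. - (2 * C * y) / (s + y)) has_real_derivative 2 * C * y / (s + y)\<^sup>2) (at s)"
      using DERIV_divide[OF DERIV_const[of "- (2 * C * y)"] DERIV_add[OF DERIV_ident DERIV_const[of y]], of s UNIV]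
      by (simp add: power2_eq_square)
    show "0 \<le> 2 * C * y / (s + y)\<^sup>2" using p y C by auto
  next
    show "((\<lambda>s. - (2 * C * y) / (s + y)) \<longlongrightarrow> 0) at_top" by real_asymp
  qed measurable
  finally show ?thesis using y by simp
qed

text \<open>Layer-cake again, with \<open>g\<close> equal to minus the derivative of
  \<open>1 / (sqrt s * (s + y))\<close>. Here \<open>s * g s\<close> is at most 3/2 times that
  function, because \<open>s * (1 / (2 * s) + 1 / (s + y)) \<le> 3 / 2\<close>, and its integral
  over the half-line is \<open>pi / sqrt y\<close>, by the primitive
  \<open>arctan (sqrt (s / y))\<close>. The result is again a multiple of the weight
  \<open>1 / sqrt y\<close>, as the Schur test requires.\<close>

lemma linear_growth_schur_kernel:
  fixes \<tau> :: "'a \<Rightarrow> real"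
  assumes N: "sigma_finite_measure N" and \<tau>: "\<tau> \<in> borel_measurable N"
    and nonneg: "\<And>x. x \<in> space N \<Longrightarrow> 0 \<le> \<tau> x"
    and growth: "\<And>s. emeasure N {x\<in>space N. \<tau> x \<le> s} \<le> ennreal (C * s)"
    and C: "C \<ge> 0" and y: "y > 0"
  shows "(\<integral>\<^sup>+x. ennreal (1 / (sqrt (\<tau> x) * (\<tau> x + y))) \<partial>N) \<le> ennreal (3 / 2 * pi * C / sqrt y)"
proof -
  define g where "g s = (if 0 < s then (1 / (2 * s) + 1 / (s + y)) / (sqrt s * (s + y)) else 0)" for s :: real
  have g[measurable]: "g \<in> borel_measurable borel" unfolding g_def by measurable
  have "(\<integral>\<^sup>+x. ennreal (1 / (sqrt (\<tau> x) * (\<tau> x + y))) \<partial>N) \<le> (\<integral>\<^sup>+s. ennreal (g s) * ennreal (C * s) \<partial>lborel)"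
  proof (rule linear_growth_nn_integral[OF N \<tau> growth g])
    fix x assume x: "x \<in> space N"
    show "ennreal (1 / (sqrt (\<tau> x) * (\<tau> x + y))) \<le> (\<integral>\<^sup>+s. ennreal (g s) * indicator {\<tau> x..} s \<partial>lborel)"
    \<comment> \<open>At \<open>\<tau> x = 0\<close> the kernel is \<open>1 / 0 = 0\<close>, so
      there is nothing to prove.\<close>
    proof (cases "\<tau> x = 0")
      case False
      with nonneg[OF x] have pos: "\<tau> x > 0" by simp
      have "(\<integral>\<^sup>+s. ennreal (g s) * indicator {\<tau> x..} s \<partial>lborel)
          = ennreal (0 - (- 1 / (sqrt (\<tau> x) * (\<tau> x + y))))"
      proof (rule nn_integral_FTC_atLeast[OF g])
        fix s assume s: "\<tau> x \<le> s"
        then have p: "s > 0" "s + y > 0" using pos y by auto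
        have ne: "sqrt s * (s + y) \<noteq> 0" using p by auto
        have d: "((\<lambda>s. sqrt s * (s + y)) has_real_derivative inverse (sqrt s) / 2 * (s + y) + sqrt s) (at s)"
          using p by (auto intro!: derivative_eq_intros)
        have "((\<lambda>s. - 1 / (sqrt s * (s + y))) has_real_derivative
            (inverse (sqrt s) / 2 * (s + y) + sqrt s) / (sqrt s * (s + y))\<^sup>2) (at s)"
          using DERIV_divide[OF DERIV_const d ne, of "- 1"] by (simp only: power2_eq_square) (simp add: add.commute)
        moreover have "(inverse (sqrt s) / 2 * (s + y) + sqrt s) / (sqrt s * (s + y))\<^sup>2 = g s"
        proof -
          define r where "r = sqrt s"
          have r: "r > 0" "s = r\<^sup>2" using p by (auto simp: r_def)
          define w where "w = s + y"
          have w: "w > 0" using p by (simp add: w_def)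
          have "(inverse r / 2 * w + r) / (r * w)\<^sup>2 = (1 / (2 * r\<^sup>2) + 1 / w) / (r * w)"
            using r(1) w by (simp add: divide_simps power2_eq_square)
          then show ?thesis unfolding g_def using p(1) by (simp add: w_def r_def)
        qed
        ultimately show "((\<lambda>s. - 1 / (sqrt s * (s + y))) has_real_derivative g s) (at s)" by simp
        show "0 \<le> g s" using p y by (auto simp: g_def)
      next
        show "((\<lambda>s. - 1 / (sqrt s * (s + y))) \<longlongrightarrow> 0) at_top" by real_asymp
      qed
      then show ?thesis by simp
    qed simp
  qed
  also have "\<dots> \<le> (\<integral>\<^sup>+s. ennreal (3 / 2 * C / (sqrt s * (s + y))) * indicator {0<..} s \<partial>lborel)"
  proof (rule nn_integral_mono)
    fix s :: real
    show "ennreal (g s) * ennreal (C * s) \<le> ennreal (3 / 2 * C / (sqrt s * (s + y))) * indicator {0<..} s"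
    proof (cases "0 < s")
      case True
      have "s / (s + y) \<le> 1" using True y by simp
      moreover have "(1 / (2 * s) + 1 / (s + y)) * s = 1 / 2 + s / (s + y)"
        using True by (simp add: distrib_right)
      ultimately have "(1 / (2 * s) + 1 / (s + y)) * s \<le> 3 / 2" by simp
      then have "C / (sqrt s * (s + y)) * ((1 / (2 * s) + 1 / (s + y)) * s) \<le> C / (sqrt s * (s + y)) * (3/2)"
        using True y C by (intro mult_left_mono) auto
      then have "g s * (C * s) \<le> 3 / 2 * C / (sqrt s * (s + y))"
        using True by (simp add: g_def algebra_simps)
      then show ?thesis using True y C
        by (auto simp: g_def ennreal_mult[symmetric] intro!: ennreal_leI)
    qed (auto simp: g_def)
  qed
  also have "\<dots> = ennreal ((3 / 2 * C) * (2 / sqrt y) * (pi / 2) - (3 / 2 * C) * (2 / sqrt y) * arctan (sqrt (0 / y)))"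
  proof (rule nn_integral_FTC_greaterThan)
    fix s :: real assume s: "0 < s"
    have d1: "((\<lambda>s. sqrt (s / y)) has_real_derivative inverse (sqrt (s / y)) / 2 * (1 / y)) (at s)"
      using s y by (auto intro!: derivative_eq_intros simp: divide_less_0_iff)
    have "((\<lambda>s. (3 / 2 * C) * (2 / sqrt y) * arctan (sqrt (s / y))) has_real_derivative
        (3 / 2 * C) * (2 / sqrt y) * (inverse (sqrt (s / y)) / 2 * (1 / y) / (1 + (sqrt (s / y))\<^sup>2))) (at s)"
      using DERIV_cmult[OF DERIV_chain2[OF DERIV_arctan d1], of "(3 / 2 * C) * (2 / sqrt y)"]
      by (simp only: divide_inverse mult_ac)
    moreover have "(3 / 2 * C) * (2 / sqrt y) * (inverse (sqrt (s / y)) / 2 * (1 / y) / (1 + (sqrt (s / y))\<^sup>2))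
       = 3 / 2 * C / (sqrt s * (s + y))"
    proof -
      have sy: "sqrt (s / y) = sqrt s / sqrt y" by (rule real_sqrt_divide)
      have yy: "sqrt y * sqrt y = y" using y by simp
      have ss: "(sqrt (s / y))\<^sup>2 = s / y" using s y by simp
      show ?thesis unfolding ss unfolding sy using s y by (simp add: field_simps)
    qed
    ultimately show "((\<lambda>s. (3 / 2 * C) * (2 / sqrt y) * arctan (sqrt (s / y))) has_real_derivative
        3 / 2 * C / (sqrt s * (s + y))) (at s)" by simp
    show "0 \<le> 3 / 2 * C / (sqrt s * (s + y))" using s y C by auto
  next
    have "isCont (\<lambda>s. (3 / 2 * C) * (2 / sqrt y) * arctan (sqrt (s / y))) 0"
      using y by (intro continuous_intros) auto
    then show "((\<lambda>s. (3 / 2 * C) * (2 / sqrt y) * arctan (sqrt (s / y))) \<longlongrightarrow> (3 / 2 * C) * (2 / sqrt y) * arctan (sqrt (0 / y))) (at_right 0)"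
      unfolding isCont_def by (rule tendsto_mono[OF at_le, rotated]) auto
    have "filterlim (\<lambda>s. sqrt (s / y)) at_top at_top" using y by real_asymp
    then show "((\<lambda>s. (3 / 2 * C) * (2 / sqrt y) * arctan (sqrt (s / y))) \<longlongrightarrow> (3 / 2 * C) * (2 / sqrt y) * (pi / 2)) at_top"
      by (intro tendsto_intros filterlim_compose[OF tendsto_arctan_at_top])
  qed measurable
  finally show ?thesis using y by (simp add: field_simps)
qed

text \<open>Write \<open>K u\<close> as \<open>sqrt (K b)\<close> times
  \<open>sqrt (K u^2 / b)\<close> and apply Cauchy-Schwarz in \<open>y\<close>. The row bound turns
  the first factor into \<open>A * a x\<close>; after exchanging the integrals the column bound
  produces \<open>B * b y\<close>, which cancels the division by \<open>b\<close>. Positivity of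
  \<open>b\<close> is asked almost everywhere because the weight used on the line takes the value
  \<open>1 / sqrt 0 = 0\<close> at the origin.\<close>

lemma schur_test:
  fixes K :: "'a \<Rightarrow> 'b \<Rightarrow> real" and u :: "'b \<Rightarrow> real"
  assumes M: "sigma_finite_measure M" and N: "sigma_finite_measure N"
    and K[measurable]: "(\<lambda>(x, y). K x y) \<in> borel_measurable (M \<Otimes>\<^sub>M N)"
    and u[measurable]: "u \<in> borel_measurable N"
    and a[measurable]: "a \<in> borel_measurable M" and b[measurable]: "b \<in> borel_measurable N"
    and nonneg: "\<And>x y. K x y \<ge> 0" "\<And>x. a x \<ge> 0" "\<And>y. b y \<ge> 0" "\<And>y. u y \<ge> 0"
    and pos: "AE y in N. b y > 0"
    and A: "A \<ge> 0" "AE x in M. (\<integral>\<^sup>+y. ennreal (K x y * b y) \<partial>N) \<le> ennreal (A * a x)"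
    and B: "B \<ge> 0" "AE y in N. (\<integral>\<^sup>+x. ennreal (K x y * a x) \<partial>M) \<le> ennreal (B * b y)"
  shows "(\<integral>\<^sup>+x. (\<integral>\<^sup>+y. ennreal (K x y * u y) \<partial>N)\<^sup>2 \<partial>M) \<le> ennreal (A * B) * (\<integral>\<^sup>+y. ennreal ((u y)\<^sup>2) \<partial>N)"
proof -
  interpret M: sigma_finite_measure M by fact
  interpret N: sigma_finite_measure N by fact
  interpret P: pair_sigma_finite M N by (intro pair_sigma_finite.intro M N)
  have Kx[measurable]: "K x \<in> borel_measurable N" if "x \<in> space M" for x
    using measurable_compose[OF measurable_Pair1'[OF that] K] by simp
  have "(\<integral>\<^sup>+y. ennreal (K x y * u y) \<partial>N)\<^sup>2 \<le> (\<integral>\<^sup>+y. ennreal (K x y * b y) \<partial>N) * (\<integral>\<^sup>+y. ennreal (K x y * (u y)\<^sup>2 / b y) \<partial>N)"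
    if x: "x \<in> space M" for x
  proof -
    note [measurable] = Kx[OF x]
    have "(\<integral>\<^sup>+y. ennreal (K x y * u y) \<partial>N) =
        (\<integral>\<^sup>+y. ennreal (sqrt (K x y * b y)) * ennreal (sqrt (K x y * (u y)\<^sup>2 / b y)) \<partial>N)"
    proof (rule nn_integral_cong_AE)
      show "AE y in N. ennreal (K x y * u y) = ennreal (sqrt (K x y * b y)) * ennreal (sqrt (K x y * (u y)\<^sup>2 / b y))"
        using pos
      proof eventually_elim
        fix y assume b: "b y > 0"
        have "sqrt (K x y * b y) * sqrt (K x y * (u y)\<^sup>2 / b y) = sqrt ((K x y * u y)\<^sup>2)"
          unfolding real_sqrt_mult[symmetric] using b
          by (intro arg_cong[where f=sqrt]) (simp add: power2_eq_square mult_ac)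
        also have "\<dots> = K x y * u y" using nonneg by simp
        finally show "ennreal (K x y * u y) = ennreal (sqrt (K x y * b y)) * ennreal (sqrt (K x y * (u y)\<^sup>2 / b y))"
          using nonneg by (simp add: ennreal_mult[symmetric])
      qed
    qed
    also have "\<dots>\<^sup>2 \<le> (\<integral>\<^sup>+y. (ennreal (sqrt (K x y * b y)))\<^sup>2 \<partial>N) * (\<integral>\<^sup>+y. (ennreal (sqrt (K x y * (u y)\<^sup>2 / b y)))\<^sup>2 \<partial>N)"
      by (rule Cauchy_Schwarz_nn_integral) measurable
    also have "\<dots> = (\<integral>\<^sup>+y. ennreal (K x y * b y) \<partial>N) * (\<integral>\<^sup>+y. ennreal (K x y * (u y)\<^sup>2 / b y) \<partial>N)"
      using nonneg by (simp add: ennreal_power)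
    finally show ?thesis .
  qed
  then have "(\<integral>\<^sup>+x. (\<integral>\<^sup>+y. ennreal (K x y * u y) \<partial>N)\<^sup>2 \<partial>M) \<le>
      (\<integral>\<^sup>+x. (\<integral>\<^sup>+y. ennreal (K x y * b y) \<partial>N) * (\<integral>\<^sup>+y. ennreal (K x y * (u y)\<^sup>2 / b y) \<partial>N) \<partial>M)"
    by (intro nn_integral_mono)
  also have "\<dots> \<le> (\<integral>\<^sup>+x. ennreal (A * a x) * (\<integral>\<^sup>+y. ennreal (K x y * (u y)\<^sup>2 / b y) \<partial>N) \<partial>M)"
    using A(2) by (intro nn_integral_mono_AE) (auto elim!: eventually_mono intro!: mult_right_mono)
  also have "\<dots> = (\<integral>\<^sup>+x. \<integral>\<^sup>+y. ennreal A * ennreal ((u y)\<^sup>2 / b y) * ennreal (K x y * a x) \<partial>N \<partial>M)"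
  proof (rule nn_integral_cong)
    fix x assume x: "x \<in> space M"
    note [measurable] = Kx[OF x]
    show "ennreal (A * a x) * (\<integral>\<^sup>+y. ennreal (K x y * (u y)\<^sup>2 / b y) \<partial>N)
      = (\<integral>\<^sup>+y. ennreal A * ennreal ((u y)\<^sup>2 / b y) * ennreal (K x y * a x) \<partial>N)"
      by (subst nn_integral_cmult[symmetric], measurable)
        (use nonneg A in \<open>auto intro!: nn_integral_cong simp: ennreal_mult[symmetric] mult_ac\<close>)
  qed
  also have "\<dots> = (\<integral>\<^sup>+y. \<integral>\<^sup>+x. ennreal A * ennreal ((u y)\<^sup>2 / b y) * ennreal (K x y * a x) \<partial>M \<partial>N)"
    by (rule P.Fubini'[symmetric]) measurable
  also have "\<dots> = (\<integral>\<^sup>+y. ennreal A * ennreal ((u y)\<^sup>2 / b y) * (\<integral>\<^sup>+x. ennreal (K x y * a x) \<partial>M) \<partial>N)"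
  proof (rule nn_integral_cong)
    fix y assume y: "y \<in> space N"
    have [measurable]: "(\<lambda>x. K x y) \<in> borel_measurable M"
      using measurable_compose[OF measurable_Pair2'[OF y] K] by simp
    show "(\<integral>\<^sup>+x. ennreal A * ennreal ((u y)\<^sup>2 / b y) * ennreal (K x y * a x) \<partial>M) =
      ennreal A * ennreal ((u y)\<^sup>2 / b y) * (\<integral>\<^sup>+x. ennreal (K x y * a x) \<partial>M)"
      by (rule nn_integral_cmult) measurable
  qed
  also have "\<dots> \<le> (\<integral>\<^sup>+y. ennreal (A * B) * ennreal ((u y)\<^sup>2) \<partial>N)"
  proof (rule nn_integral_mono_AE)
    show "AE y in N. ennreal A * ennreal ((u y)\<^sup>2 / b y) * (\<integral>\<^sup>+x. ennreal (K x y * a x) \<partial>M) \<le> ennreal (A * B) * ennreal ((u y)\<^sup>2)"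
      using B(2) pos
    proof eventually_elim
      fix y assume *: "(\<integral>\<^sup>+x. ennreal (K x y * a x) \<partial>M) \<le> ennreal (B * b y)" and b: "b y > 0"
      have "ennreal A * ennreal ((u y)\<^sup>2 / b y) * (\<integral>\<^sup>+x. ennreal (K x y * a x) \<partial>M) \<le> ennreal A * ennreal ((u y)\<^sup>2 / b y) * ennreal (B * b y)"
        using * by (intro mult_left_mono) auto
      also have "\<dots> = ennreal (A * B) * ennreal ((u y)\<^sup>2)"
        using A B b by (simp add: ennreal_mult[symmetric] mult_ac)
      finally show "ennreal A * ennreal ((u y)\<^sup>2 / b y) * (\<integral>\<^sup>+x. ennreal (K x y * a x) \<partial>M) \<le> ennreal (A * B) * ennreal ((u y)\<^sup>2)" .
    qed
  qed
  also have "\<dots> = ennreal (A * B) * (\<integral>\<^sup>+y. ennreal ((u y)\<^sup>2) \<partial>N)"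
    by (rule nn_integral_cmult) measurable
  finally show ?thesis .
qed

section \<open>Square integrable functions: pairing, limits, completeness\<close>

definition L2sq :: "'a measure \<Rightarrow> ('a \<Rightarrow> complex) \<Rightarrow> ennreal" where
  "L2sq M f = (\<integral>\<^sup>+x. ennreal ((norm (f x))\<^sup>2) \<partial>M)"

lemma L2sq_mono_AE:
  "AE x in M. norm (f x) \<le> norm (g x) \<Longrightarrow> L2sq M f \<le> L2sq M g"
  unfolding L2sq_def
  by (intro nn_integral_mono_AE) (auto elim!: eventually_mono intro!: ennreal_leI power_mono)

lemma L2sq_cmult:
  "f \<in> borel_measurable M \<Longrightarrow> L2sq M (\<lambda>x. c * f x) = ennreal ((norm c)\<^sup>2) * L2sq M f"
  unfolding L2sq_def
  by (simp add: norm_mult power_mult_distrib ennreal_mult nn_integral_cmult)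

lemma L2sq_add_le:
  assumes [measurable]: "f \<in> borel_measurable M" "g \<in> borel_measurable M"
  shows "L2sq M (\<lambda>x. f x + g x) \<le> 2 * L2sq M f + 2 * L2sq M g"
proof -
  have "L2sq M (\<lambda>x. f x + g x) \<le> (\<integral>\<^sup>+x. 2 * ennreal ((norm (f x))\<^sup>2) + 2 * ennreal ((norm (g x))\<^sup>2) \<partial>M)"
    unfolding L2sq_def
  proof (rule nn_integral_mono)
    fix x
    have "(norm (f x + g x))\<^sup>2 \<le> (norm (f x) + norm (g x))\<^sup>2"
      by (intro power_mono norm_triangle_ineq) auto
    also have "\<dots> \<le> 2 * (norm (f x))\<^sup>2 + 2 * (norm (g x))\<^sup>2"
      using sum_squares_bound[of "norm (f x)" "norm (g x)"] by (simp add: power2_sum)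
    finally have "ennreal ((norm (f x + g x))\<^sup>2) \<le> ennreal (2 * (norm (f x))\<^sup>2 + 2 * (norm (g x))\<^sup>2)"
      by (rule ennreal_leI)
    then show "ennreal ((norm (f x + g x))\<^sup>2) \<le> 2 * ennreal ((norm (f x))\<^sup>2) + 2 * ennreal ((norm (g x))\<^sup>2)"
      by (simp add: ennreal_mult)
  qed
  also have "\<dots> = 2 * L2sq M f + 2 * L2sq M g"
    unfolding L2sq_def by (subst nn_integral_add, measurable) (simp add: nn_integral_cmult)
  finally show ?thesis .
qed

lemma nn_integral_prod_le_L2sq:
  assumes [measurable]: "f \<in> borel_measurable M" "g \<in> borel_measurable M"
  shows "(\<integral>\<^sup>+x. ennreal (norm (f x * g x)) \<partial>M)\<^sup>2 \<le> L2sq M f * L2sq M g"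
  using Cauchy_Schwarz_nn_integral[of "\<lambda>x. ennreal (norm (f x))" M "\<lambda>x. ennreal (norm (g x))"]
  by (simp add: L2sq_def norm_mult ennreal_mult ennreal_power)

lemma L2sq_mult_integrable:
  assumes [measurable]: "f \<in> borel_measurable M" "g \<in> borel_measurable M"
    and "L2sq M f < \<infinity>" "L2sq M g < \<infinity>"
  shows "integrable M (\<lambda>x. f x * g x)"
proof (rule integrableI_bounded)
  have "(\<integral>\<^sup>+x. ennreal (norm (f x * g x)) \<partial>M)\<^sup>2 < \<infinity>"
    using nn_integral_prod_le_L2sq[of f M g] assms by (auto simp: ennreal_mult_less_top intro: le_less_trans)
  then show "(\<integral>\<^sup>+x. ennreal (norm (f x * g x)) \<partial>M) < \<infinity>"
    by (simp add: power_less_top_ennreal)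
qed measurable

lemma L2sq_mult_integral_le:
  assumes [measurable]: "f \<in> borel_measurable M" "g \<in> borel_measurable M"
    and "L2sq M f < \<infinity>" "L2sq M g < \<infinity>"
  shows "norm (LINT x|M. f x * g x) \<le> sqrt (enn2real (L2sq M f)) * sqrt (enn2real (L2sq M g))"
proof -
  let ?I = "LINT x|M. norm (f x * g x)"
  have int: "integrable M (\<lambda>x. norm (f x * g x))"
    using L2sq_mult_integrable[OF assms] by simp
  have "(ennreal ?I)\<^sup>2 \<le> L2sq M f * L2sq M g"
    using nn_integral_prod_le_L2sq[of f M g] nn_integral_eq_integral[OF int] by simp
  also have "\<dots> = ennreal (enn2real (L2sq M f) * enn2real (L2sq M g))"
    using assms by (simp add: ennreal_mult)
  finally have "?I\<^sup>2 \<le> enn2real (L2sq M f) * enn2real (L2sq M g)"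
    by (simp add: ennreal_power)
  then have "?I \<le> sqrt (enn2real (L2sq M f) * enn2real (L2sq M g))"
    by (rule real_le_rsqrt)
  then show ?thesis
    unfolding real_sqrt_mult by (rule order_trans[OF integral_norm_bound])
qed

lemma L2sq_add_finite:
  assumes [measurable]: "f \<in> borel_measurable M" "g \<in> borel_measurable M"
    and "L2sq M f < \<infinity>" "L2sq M g < \<infinity>"
  shows "L2sq M (\<lambda>x. f x + g x) < \<infinity>"
  using L2sq_add_le[of f M g] assms by (auto simp: ennreal_mult_less_top intro: le_less_trans)

text \<open>Split \<open>a b - A B\<close> into
  \<open>(a - A) (b - B) + A (b - B) + (a - A) B\<close> and bound each integral by Cauchy-Schwarz.
  Finiteness is assumed for the limits alone; for the approximants it follows eventually. This is
  the device that carries every integral formula from a line at height \<epsilon> to the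
  boundary.\<close>

lemma L2sq_tendsto_integral_mult:
  assumes meas: "\<And>i. a i \<in> borel_measurable M" "\<And>i. b i \<in> borel_measurable M"
      "A \<in> borel_measurable M" "B \<in> borel_measurable M"
    and fin: "L2sq M A < \<infinity>" "L2sq M B < \<infinity>"
    and lim: "((\<lambda>i. L2sq M (\<lambda>x. a i x - A x)) \<longlongrightarrow> 0) F" "((\<lambda>i. L2sq M (\<lambda>x. b i x - B x)) \<longlongrightarrow> 0) F"
  shows "((\<lambda>i. LINT x|M. a i x * b i x) \<longlongrightarrow> (LINT x|M. A x * B x)) F"
proof -
  note [measurable] = meas
  define p where "p i = sqrt (enn2real (L2sq M (\<lambda>x. a i x - A x)))" for i
  define q where "q i = sqrt (enn2real (L2sq M (\<lambda>x. b i x - B x)))" for i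
  define P where "P = sqrt (enn2real (L2sq M A))"
  define Q where "Q = sqrt (enn2real (L2sq M B))"
  have ev: "\<forall>\<^sub>F i in F. L2sq M (\<lambda>x. a i x - A x) < \<infinity> \<and> L2sq M (\<lambda>x. b i x - B x) < \<infinity>"
    using order_tendstoD(2)[OF lim(1), of \<infinity>] order_tendstoD(2)[OF lim(2), of \<infinity>] by (auto intro: eventually_conj)
  have pq: "(p \<longlongrightarrow> 0) F" "(q \<longlongrightarrow> 0) F"
    unfolding p_def q_def
    using tendsto_real_sqrt[OF tendsto_enn2real[of _ 0]] lim by fastforce+
  have "\<forall>\<^sub>F i in F. norm ((LINT x|M. a i x * b i x) - (LINT x|M. A x * B x)) \<le> p i * q i + P * q i + p i * Q"
    using ev
  proof eventually_elim
    case (elim i)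
    let ?a = "\<lambda>x. a i x - A x" and ?b = "\<lambda>x. b i x - B x"
    have f: "L2sq M ?a < \<infinity>" "L2sq M ?b < \<infinity>" using elim by auto
    have i: "integrable M (\<lambda>x. ?a x * ?b x)" "integrable M (\<lambda>x. A x * ?b x)"
       "integrable M (\<lambda>x. ?a x * B x)" "integrable M (\<lambda>x. A x * B x)"
      using f fin by (auto intro!: L2sq_mult_integrable)
    have "(LINT x|M. a i x * b i x) = (LINT x|M. (?a x * ?b x + A x * ?b x + ?a x * B x) + A x * B x)"
      by (intro Bochner_Integration.integral_cong) (auto simp: algebra_simps)
    also have "\<dots> = (LINT x|M. ?a x * ?b x) + (LINT x|M. A x * ?b x) + (LINT x|M. ?a x * B x) + (LINT x|M. A x * B x)"
      using i by simp
    finally have h0: "(LINT x|M. a i x * b i x) - (LINT x|M. A x * B x) = (LINT x|M. ?a x * ?b x) + (LINT x|M. A x * ?b x) + (LINT x|M. ?a x * B x)"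
      by simp
    have h1: "norm (LINT x|M. ?a x * ?b x) \<le> p i * q i"
      unfolding p_def q_def by (rule L2sq_mult_integral_le[OF _ _ f]) measurable
    have h2: "norm (LINT x|M. A x * ?b x) \<le> P * q i"
      unfolding P_def q_def by (rule L2sq_mult_integral_le[OF _ _ fin(1) f(2)]) measurable
    have h3: "norm (LINT x|M. ?a x * B x) \<le> p i * Q"
      unfolding p_def Q_def by (rule L2sq_mult_integral_le[OF _ _ f(1) fin(2)]) measurable
    show ?case
      unfolding h0 by (rule norm_triangle_mono[OF norm_triangle_mono[OF h1 h2] h3])
  qed
  moreover have "((\<lambda>i. p i * q i + P * q i + p i * Q) \<longlongrightarrow> 0 * 0 + P * 0 + 0 * Q) F"
    by (intro tendsto_intros pq)
  ultimately have "((\<lambda>i. (LINT x|M. a i x * b i x) - (LINT x|M. A x * B x)) \<longlongrightarrow> 0) F"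
    by (intro Lim_null_comparison[where f="\<lambda>i. (LINT x|M. a i x * b i x) - (LINT x|M. A x * B x)"]) simp_all
  then show ?thesis by (simp add: LIM_zero_iff)
qed

text \<open>Iterating \<open>|p + q|^2 \<le> 2 |p|^2 + 2 |q|^2\<close> keeps everything quadratic,
  at the price of weights \<open>2 ^ Suc k\<close>. A rate of convergence faster than
  \<open>(1 / 2) ^ k\<close> beats these weights.\<close>

lemma norm_telescope_weighted:
  fixes a :: "nat \<Rightarrow> complex"
  shows "(norm (a (n + m) - a n))\<^sup>2 \<le> (\<Sum>k<m. 2 ^ Suc k * (norm (a (Suc (n + k)) - a (n + k)))\<^sup>2)"
proof (induction m arbitrary: n)
  case (Suc m)
  have "(norm (a (n + Suc m) - a n))\<^sup>2 \<le> (norm (a (n + Suc m) - a (Suc n)) + norm (a (Suc n) - a n))\<^sup>2"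
    by (intro power_mono) (metis diff_add_cancel add_diff_eq norm_triangle_ineq, simp)
  also have "\<dots> \<le> 2 * (norm (a (Suc n + m) - a (Suc n)))\<^sup>2 + 2 * (norm (a (Suc n) - a n))\<^sup>2"
    using sum_squares_bound[of "norm (a (n + Suc m) - a (Suc n))" "norm (a (Suc n) - a n)"] by (simp add: power2_sum)
  also have "\<dots> \<le> 2 * (\<Sum>k<m. 2 ^ Suc k * (norm (a (Suc (Suc n + k)) - a (Suc n + k)))\<^sup>2) + 2 * (norm (a (Suc n) - a n))\<^sup>2"
    using Suc.IH[of "Suc n"] by simp
  also have "\<dots> = (\<Sum>k<Suc m. 2 ^ Suc k * (norm (a (Suc (n + k)) - a (n + k)))\<^sup>2)"
    by (subst sum.lessThan_Suc_shift) (simp add: sum_distrib_left mult.assoc)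
  finally show ?case .
qed simp

text \<open>Riesz-Fischer for a rapidly converging sequence. The rate \<open>(1 / 8) ^ n\<close> is
  chosen to beat the weights of \<open>norm_telescope_weighted\<close>: the resulting geometric
  series has ratio 1/4 and sum \<open>8 / 3\<close>, rounded up to 3.\<close>

lemma L2sq_complete:
  fixes a :: "nat \<Rightarrow> 'a \<Rightarrow> complex"
  assumes meas: "\<And>n. a n \<in> borel_measurable M"
    and fin: "L2sq M (a 0) < \<infinity>"
    and fast: "\<And>n. L2sq M (\<lambda>x. a (Suc n) x - a n x) \<le> ennreal ((1 / 8) ^ n)"
  shows "\<exists>u\<in>borel_measurable M. L2sq M u < \<infinity> \<and> (\<lambda>n. L2sq M (\<lambda>x. a n x - u x)) \<longlonglongrightarrow> 0"
proof -
  note [measurable] = meas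
  define d where "d k x = (norm (a (Suc k) x - a k x))\<^sup>2" for k x
  have [measurable]: "d k \<in> borel_measurable M" for k unfolding d_def by measurable
  \<comment> \<open>\<open>T n\<close> dominates \<open>|a (n + m) - a n|^2\<close> for all
    \<open>m\<close> at once. Finiteness of \<open>T 0\<close> at a point gives pointwise
    convergence there, and the integral of \<open>T n\<close> gives the rate.\<close>
  define T where "T n x = (\<Sum>k. ennreal (2 ^ Suc k * d (n + k) x))" for n x
  have [measurable]: "T n \<in> borel_measurable M" for n unfolding T_def by measurable
  define u where "u x = lim (\<lambda>n. a n x)" for x
  have u[measurable]: "u \<in> borel_measurable M" unfolding u_def by measurable
  have T_le: "(\<integral>\<^sup>+x. T n x \<partial>M) \<le> ennreal (3 * (1 / 8) ^ n)" for n
  proof -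
    have "(\<integral>\<^sup>+x. T n x \<partial>M) = (\<Sum>k. \<integral>\<^sup>+x. ennreal (2 ^ Suc k * d (n + k) x) \<partial>M)"
      unfolding T_def by (rule nn_integral_suminf) measurable
    also have "\<dots> = (\<Sum>k. ennreal (2 ^ Suc k) * L2sq M (\<lambda>x. a (Suc (n + k)) x - a (n + k) x))"
      unfolding L2sq_def d_def
      by (intro suminf_cong, subst nn_integral_cmult[symmetric], measurable)
        (auto intro!: nn_integral_cong simp: ennreal_mult[symmetric])
    also have "\<dots> \<le> (\<Sum>k. ennreal (2 * (1/8)^n * (1 / 4) ^ k))"
    proof (rule suminf_le)
      fix k
      have "ennreal (2 ^ Suc k) * L2sq M (\<lambda>x. a (Suc (n + k)) x - a (n + k) x) \<le> ennreal (2 ^ Suc k) * ennreal ((1 / 8) ^ (n + k))"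
        by (intro mult_left_mono fast) simp
      also have "\<dots> = ennreal (2 ^ Suc k * (1 / 8) ^ (n + k))"
        by (simp add: ennreal_mult[symmetric] del: power_Suc)
      also have "(2::real) ^ Suc k * (1 / 8) ^ (n + k) = 2 * (1/8)^n * (2 * (1 / 8)) ^ k"
        by (simp only: power_mult_distrib power_add power_Suc mult_ac)
      finally show "ennreal (2 ^ Suc k) * L2sq M (\<lambda>x. a (Suc (n + k)) x - a (n + k) x) \<le> ennreal (2 * (1/8)^n * (1 / 4) ^ k)"
        by simp
    qed auto
    also have "\<dots> = ennreal (2 * (1/8)^n * (1 / (1 - 1 / 4)))"
    proof (rule suminf_ennreal_eq)
      show "(\<lambda>k. 2 * (1/8)^n * (1 / 4) ^ k) sums (2 * (1/8)^n * (1 / (1 - 1 / 4 :: real)))"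
        by (intro sums_mult geometric_sums) simp
    qed simp
    also have "\<dots> \<le> ennreal (3 * (1/8)^n)"
      by (intro ennreal_leI) simp
    finally show ?thesis .
  qed
  have "(\<integral>\<^sup>+x. T 0 x \<partial>M) \<noteq> \<infinity>" using T_le[of 0] by (auto simp: top_unique)
  then have fin0: "AE x in M. T 0 x \<noteq> \<infinity>" by (intro nn_integral_PInf_AE) auto
  have conv: "(\<lambda>n. a n x) \<longlonglongrightarrow> u x" if "T 0 x \<noteq> \<infinity>" for x
  proof -
    define B where "B = enn2real (T 0 x)"
    have B: "T 0 x = ennreal B" using that by (simp add: B_def less_top)
    have dk: "norm (a (Suc k) x - a k x) \<le> sqrt B * (1 / sqrt 2) ^ k" for k
    proof -
      have "ennreal (2 ^ Suc k * d k x) \<le> T 0 x"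
        using sum_le_suminf[of "\<lambda>k. ennreal (2 ^ Suc k * d k x)" "{k}"] unfolding T_def by simp
      then have "2 ^ Suc k * d k x \<le> B"
        unfolding B by (simp add: B_def del: power_Suc)
      then have "2 ^ k * d k x \<le> B" 
        by (rule order_trans[rotated]) (simp add: d_def mult_right_mono)
      then have "d k x \<le> B * (1 / 2) ^ k" by (simp add: field_simps power_one_over)
      then have "sqrt (d k x) \<le> sqrt (B * (1 / 2) ^ k)" by simp
      then show ?thesis unfolding d_def by (simp add: real_sqrt_mult real_sqrt_power real_sqrt_divide)
    qed
    have "summable (\<lambda>k. sqrt B * (1 / sqrt 2) ^ k)"
      by (intro summable_mult summable_geometric) simp
    then have "summable (\<lambda>k. a (Suc k) x - a k x)"
      by (rule summable_comparison_test'[of _ 0]) (rule dk)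
    then have "convergent (\<lambda>n. \<Sum>k<n. a (Suc k) x - a k x)"
      by (simp add: summable_iff_convergent)
    then have "convergent (\<lambda>n. a n x - a 0 x)"
      by (simp only: sum_lessThan_telescope[of "\<lambda>n. a n x"])
    then have "convergent (\<lambda>n. a n x)"
      using convergent_add[OF _ convergent_const[of "a 0 x"]] by force
    then show ?thesis unfolding u_def by (simp add: convergent_LIMSEQ_iff)
  qed
  have bound: "L2sq M (\<lambda>x. a n x - u x) \<le> ennreal (3 * (1 / 8) ^ n)" for n
  proof -
    have "L2sq M (\<lambda>x. a n x - u x) \<le> (\<integral>\<^sup>+x. T n x \<partial>M)"
      unfolding L2sq_def
    proof (rule nn_integral_mono_AE)
      show "AE x in M. ennreal ((norm (a n x - u x))\<^sup>2) \<le> T n x"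
        using fin0
      proof eventually_elim
        fix x assume "T 0 x \<noteq> \<infinity>"
        then have "(\<lambda>n. a n x) \<longlonglongrightarrow> u x" by (rule conv)
        then have "(\<lambda>m. a (n + m) x) \<longlonglongrightarrow> u x"
          using LIMSEQ_ignore_initial_segment[of "\<lambda>n. a n x" "u x" n] by (simp add: add.commute)
        then have "(\<lambda>m. ennreal ((norm (a (n + m) x - a n x))\<^sup>2)) \<longlonglongrightarrow> ennreal ((norm (u x - a n x))\<^sup>2)"
          by (intro tendsto_intros)
        then have "ennreal ((norm (u x - a n x))\<^sup>2) \<le> T n x"
        proof (rule tendsto_upperbound)
          show "\<forall>\<^sub>F m in sequentially. ennreal ((norm (a (n + m) x - a n x))\<^sup>2) \<le> T n x"
          proof (rule always_eventually, rule allI)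
            fix m
            have "ennreal ((norm (a (n + m) x - a n x))\<^sup>2) \<le> ennreal (\<Sum>k<m. 2 ^ Suc k * d (n + k) x)"
              unfolding d_def by (intro ennreal_leI norm_telescope_weighted[of "\<lambda>n. a n x"])
            also have "\<dots> = (\<Sum>k<m. ennreal (2 ^ Suc k * d (n + k) x))"
              by (rule sum_ennreal[symmetric]) (simp add: d_def)
            also have "\<dots> \<le> T n x"
              unfolding T_def by (rule sum_le_suminf) auto
            finally show "ennreal ((norm (a (n + m) x - a n x))\<^sup>2) \<le> T n x" .
          qed
        qed simp
        then show "ennreal ((norm (a n x - u x))\<^sup>2) \<le> T n x" by (simp add: norm_minus_commute)
      qed
    qed
    then show ?thesis using T_le[of n] by (rule order_trans)
  qed
  have "(\<lambda>n. ennreal (3 * (1 / 8) ^ n)) \<longlonglongrightarrow> ennreal (3 * 0)"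
    by (intro tendsto_intros LIMSEQ_realpow_zero) auto
  then have lim3: "(\<lambda>n. ennreal (3 * (1 / 8) ^ n)) \<longlonglongrightarrow> 0" by simp
  have lim: "(\<lambda>n. L2sq M (\<lambda>x. a n x - u x)) \<longlonglongrightarrow> 0"
    by (rule tendsto_sandwich[OF always_eventually always_eventually tendsto_const lim3])
      (simp_all add: bound)
  have "L2sq M (\<lambda>x. a 0 x - u x) < \<infinity>"
    using bound[of 0] by (rule le_less_trans) simp
  then have "L2sq M (\<lambda>x. (- 1) * (a 0 x - u x)) < \<infinity>"
    by (subst L2sq_cmult) simp_all
  then have "L2sq M (\<lambda>x. a 0 x + (- 1) * (a 0 x - u x)) < \<infinity>"
    by (intro L2sq_add_finite fin) measurable
  then have "L2sq M u < \<infinity>" by simp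
  with lim u show ?thesis by blast
qed

section \<open>Covering arguments: the maximal function and null sets\<close>

lemma emeasure_UN_countable_subadditive:
  assumes "countable C" and [measurable]: "\<And>i. i \<in> C \<Longrightarrow> X i \<in> sets M"
  shows "emeasure M (\<Union>i\<in>C. X i) \<le> (\<integral>\<^sup>+i. emeasure M (X i) \<partial>count_space C)"
proof -
  have "(\<Union>i\<in>C. X i) \<in> sets M" using assms by (rule sets.countable_UN'')
  then have "emeasure M (\<Union>i\<in>C. X i) = (\<integral>\<^sup>+x. indicator (\<Union>i\<in>C. X i) x \<partial>M)" by simp
  also have "\<dots> \<le> (\<integral>\<^sup>+x. \<integral>\<^sup>+i. indicator (X i) x \<partial>count_space C \<partial>M)"
  proof (rule nn_integral_mono)
    fix x
    show "indicator (\<Union>i\<in>C. X i) x \<le> (\<integral>\<^sup>+i. indicator (X i) x \<partial>count_space C)"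
    proof (cases "x \<in> (\<Union>i\<in>C. X i)")
      case True
      then obtain i where i: "i \<in> C" "x \<in> X i" by auto
      have "indicator (\<Union>i\<in>C. X i) x = (indicator (X i) x :: ennreal)" using True i by simp
      then show ?thesis using nn_integral_ge_point[OF i(1), of "\<lambda>i. indicator (X i) x"] by simp
    qed simp
  qed
  also have "\<dots> = (\<integral>\<^sup>+i. \<integral>\<^sup>+x. indicator (X i) x \<partial>M \<partial>count_space C)"
    by (rule nn_integral_count_space_nn_integral) (use assms in auto)
  also have "\<dots> = (\<integral>\<^sup>+i. emeasure M (X i) \<partial>count_space C)"
    by (intro nn_integral_cong) simp
  finally show ?thesis .
qed

text \<open>Hardy-Littlewood weak type inequality from the Vitali covering lemma: the bad balls are
  covered by the fivefold enlargements of a disjoint subfamily, and disjointness bounds the sum of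
  their \<open>w\<close>-masses by \<open>I\<close>. An enlarged ball has length
  \<open>10 * r\<close>, which gives the constant 10. Taking \<open>U\<close> to be the enlarged
  balls, instead of the set of bad points, makes it Borel at once.\<close>

lemma maximal_function_weak_type:
  fixes w :: "real \<Rightarrow> ennreal"
  assumes [measurable]: "w \<in> borel_measurable borel" and c: "c > 0"
    and I: "(\<integral>\<^sup>+x. w x \<partial>lborel) \<le> ennreal I" and I0: "I \<ge> 0"
  shows "\<exists>U\<in>sets borel. emeasure lborel U \<le> ennreal (10 * I / c) \<and>
           (\<forall>x. x \<notin> U \<longrightarrow> (\<forall>r>0. (\<integral>\<^sup>+s. w s * indicator (cball x r) s \<partial>lborel) \<le> ennreal (c * r)))"
proof -
  define D where "D = density lborel w"
  have D: "emeasure D A = (\<integral>\<^sup>+s. w s * indicator A s \<partial>lborel)" if "A \<in> sets borel" for A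
    using that unfolding D_def by (subst emeasure_density) auto
  define K where "K = {(x, r). r > 0 \<and> ennreal (c * r) < emeasure D (cball x r)}"
  \<comment> \<open>The Vitali lemma needs bounded radii; a bad ball of radius \<open>r\<close> has
    mass above \<open>c * r\<close>, which the total mass \<open>I\<close> limits.\<close>
  have rK: "0 < snd i \<and> snd i \<le> I / c" if "i \<in> K" for i
  proof -
    have "ennreal (c * snd i) < emeasure D (cball (fst i) (snd i))"
      using that by (auto simp: K_def)
    also have "\<dots> \<le> (\<integral>\<^sup>+s. w s \<partial>lborel)"
      by (subst D, simp) (auto intro!: nn_integral_mono split: split_indicator)
    also have "\<dots> \<le> ennreal I" by (rule I)
    finally have "c * snd i < I" using that c by (subst (asm) ennreal_less_iff) (auto simp: K_def)
    then show ?thesis using that c by (auto simp: K_def field_simps)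
  qed
  obtain C where C: "countable C" "C \<subseteq> K"
     "pairwise (\<lambda>i j. disjnt (cball (fst i) (snd i)) (cball (fst j) (snd j))) C"
     "(\<Union>i\<in>K. cball (fst i) (snd i)) \<subseteq> (\<Union>i\<in>C. cball (fst i) (5 * snd i))"
    by (rule Vitali_covering_lemma_cballs[where a=fst and r=snd and K=K, OF order_refl rK])
  define U where "U = (\<Union>i\<in>C. cball (fst i) (5 * snd i))"
  have U[measurable]: "U \<in> sets borel" unfolding U_def using C(1) by (intro sets.countable_UN'') auto
  have "emeasure lborel U \<le> (\<integral>\<^sup>+i. emeasure lborel (cball (fst i) (5 * snd i)) \<partial>count_space C)"
    unfolding U_def by (rule emeasure_UN_countable_subadditive) (use C in auto)
  also have "\<dots> \<le> (\<integral>\<^sup>+i. ennreal (10 / c) * emeasure D (cball (fst i) (snd i)) \<partial>count_space C)"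
  proof (rule nn_integral_mono)
    fix i assume "i \<in> space (count_space C)"
    then have i: "i \<in> K" using C by auto
    have "emeasure lborel (cball (fst i) (5 * snd i)) = ennreal (10 / c) * ennreal (c * snd i)"
      using rK[OF i] c by (simp add: cball_eq_atLeastAtMost ennreal_mult[symmetric])
    also have "\<dots> \<le> ennreal (10 / c) * emeasure D (cball (fst i) (snd i))"
      using i by (intro mult_left_mono) (auto simp: K_def)
    finally show "emeasure lborel (cball (fst i) (5 * snd i)) \<le> ennreal (10 / c) * emeasure D (cball (fst i) (snd i))" .
  qed
  also have "\<dots> = ennreal (10 / c) * (\<integral>\<^sup>+i. emeasure D (cball (fst i) (snd i)) \<partial>count_space C)"
    by (rule nn_integral_cmult) simp
  also have "(\<integral>\<^sup>+i. emeasure D (cball (fst i) (snd i)) \<partial>count_space C) = emeasure D (\<Union>i\<in>C. cball (fst i) (snd i))"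
    by (rule emeasure_UN_countable[symmetric])
      (use C in \<open>auto simp: D_def disjoint_family_on_def pairwise_def disjnt_def\<close>)
  also have "ennreal (10 / c) * \<dots> \<le> ennreal (10 / c) * ennreal I"
  proof (rule mult_left_mono)
    have "emeasure D (\<Union>i\<in>C. cball (fst i) (snd i)) \<le> (\<integral>\<^sup>+s. w s \<partial>lborel)"
      by (subst D, rule sets.countable_UN'') (use C in \<open>auto intro!: nn_integral_mono split: split_indicator\<close>)
    then show "emeasure D (\<Union>i\<in>C. cball (fst i) (snd i)) \<le> ennreal I" using I by (rule order_trans)
  qed simp
  also have "\<dots> = ennreal (10 * I / c)" using c I0 by (simp add: ennreal_mult[symmetric])
  finally have 1: "emeasure lborel U \<le> ennreal (10 * I / c)" .
  have "(\<integral>\<^sup>+s. w s * indicator (cball x r) s \<partial>lborel) \<le> ennreal (c * r)" if x: "x \<notin> U" and r: "r > 0" for x r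
  proof (rule ccontr)
    assume "\<not> ?thesis"
    then have "(x, r) \<in> K" using r by (auto simp: K_def D)
    then have "x \<in> (\<Union>i\<in>K. cball (fst i) (snd i))" using r by (intro UN_I[of "(x, r)"]) auto
    then have "x \<in> U" unfolding U_def using C(4) by (rule subsetD[rotated])
    then show False using x by simp
  qed
  then show ?thesis using 1 U by blast
qed

text \<open>Measurability of \<open>A\<close> is not claimed: the sets to be covered are defined by
  limits over uncountable cones, and only a null superset is extracted.\<close>

lemma null_set_of_small_covers:
  assumes "\<And>e::real. e > 0 \<Longrightarrow> \<exists>U\<in>sets M. A \<subseteq> U \<and> emeasure M U \<le> ennreal e"
  shows "\<exists>N\<in>null_sets M. A \<subseteq> N"
proof -
  have "\<forall>n. \<exists>U\<in>sets M. A \<subseteq> U \<and> emeasure M U \<le> ennreal (1 / real (Suc n))"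
    using assms by simp
  then obtain U where U: "\<And>n. U n \<in> sets M" "\<And>n. A \<subseteq> U n" "\<And>n. emeasure M (U n) \<le> ennreal (1 / real (Suc n))"
    by metis
  have "emeasure M (\<Inter>n. U n) \<le> ennreal (1 / real (Suc n))" for n
    by (rule order_trans[OF emeasure_mono U(3)]) (use U in auto)
  moreover have "(\<lambda>n. ennreal (1 / real (Suc n))) \<longlonglongrightarrow> ennreal 0"
    by (intro tendsto_ennrealI LIMSEQ_Suc lim_1_over_n)
  ultimately have "emeasure M (\<Inter>n. U n) \<le> ennreal 0"
    by (intro tendsto_lowerbound[of _ "ennreal 0" sequentially]) (auto simp del: of_nat_Suc)
  then have "(\<Inter>n. U n) \<in> null_sets M" using U by (auto intro!: null_setsI)
  then show ?thesis by (intro bexI[of _ "\<Inter>n. U n"] INT_greatest U(2))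
qed

lemma nn_integral_cauchy_kernel:
  assumes r: "(r::real) > 0"
  shows "(\<integral>\<^sup>+x. ennreal (1 / ((x - a)\<^sup>2 + r\<^sup>2)) \<partial>lborel) = ennreal (pi / r)"
proof -
  let ?f = "\<lambda>x. 1 / ((x - a)\<^sup>2 + r\<^sup>2)"
  have pos: "(x - a)\<^sup>2 + r\<^sup>2 > 0" for x using r by (simp add: add_nonneg_pos)
  have 1: "(\<integral>\<^sup>+x. ennreal (?f x) * indicator {a..} x \<partial>lborel) = ennreal (1 / r * (pi / 2) - 1 / r * arctan ((a - a) / r))"
  proof (rule nn_integral_FTC_atLeast[where F="\<lambda>x. 1 / r * arctan ((x - a) / r)"])
    fix x
    have "((\<lambda>x. (x - a) / r) has_real_derivative 1 / r) (at x)"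
      using r by (auto intro!: derivative_eq_intros)
    from DERIV_cmult[OF DERIV_chain2[OF DERIV_arctan this], of "1 / r"]
    have "((\<lambda>x. 1 / r * arctan ((x - a) / r)) has_real_derivative 1 / r * (inverse (1 + ((x - a) / r)\<^sup>2) * (1 / r))) (at x)" .
    also have "1 / r * (inverse (1 + ((x - a) / r)\<^sup>2) * (1 / r)) = ?f x"
    proof -
      have "1 + ((x - a) / r)\<^sup>2 = ((x - a)\<^sup>2 + r\<^sup>2) / r\<^sup>2" using r by (simp add: power_divide add_divide_distrib)
      then show ?thesis using r pos[of x] by (simp add: power2_eq_square)
    qed
    finally show "((\<lambda>x. 1 / r * arctan ((x - a) / r)) has_real_derivative ?f x) (at x)" .
    show "0 \<le> ?f x" by simp
  next
    have "filterlim (\<lambda>x. (x - a) / r) at_top at_top" using r by real_asymp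
    then show "((\<lambda>x. 1 / r * arctan ((x - a) / r)) \<longlongrightarrow> 1 / r * (pi / 2)) at_top"
      by (intro tendsto_intros filterlim_compose[OF tendsto_arctan_at_top])
  qed measurable
  have 2: "(\<integral>\<^sup>+x. ennreal (?f x) * indicator {..<a} x \<partial>lborel) = (\<integral>\<^sup>+x. ennreal (?f x) * indicator {a..} x \<partial>lborel)"
  proof -
    have "(\<integral>\<^sup>+x. ennreal (?f x) * indicator {..<a} x \<partial>lborel) =
        (\<integral>\<^sup>+x. ennreal (?f (2 * a + (-1) * x)) * indicator {..<a} (2 * a + (-1) * x) \<partial>lborel)"
      by (subst nn_integral_real_affine[of _ "-1" "2 * a"]) auto
    also have "\<dots> = (\<integral>\<^sup>+x. ennreal (?f x) * indicator {a..} x \<partial>lborel)"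
    proof (rule nn_integral_cong_AE)
      have "AE x in lborel. x \<noteq> a" by (rule AE_lborel_singleton)
      then show "AE x in lborel. ennreal (?f (2 * a + (-1) * x)) * indicator {..<a} (2 * a + (-1) * x) = ennreal (?f x) * indicator {a..} x"
      proof eventually_elim
        fix x assume "x \<noteq> a"
        have "(2 * a + (-1) * x - a)\<^sup>2 = (x - a)\<^sup>2" by (simp add: power2_eq_square algebra_simps)
        then show "ennreal (?f (2 * a + (-1) * x)) * indicator {..<a} (2 * a + (-1) * x) = ennreal (?f x) * indicator {a..} x"
          using \<open>x \<noteq> a\<close> by (simp split: split_indicator)
      qed
    qed
    finally show ?thesis .
  qed
  have "(\<integral>\<^sup>+x. ennreal (?f x) \<partial>lborel) = (\<integral>\<^sup>+x. ennreal (?f x) * indicator {..<a} x + ennreal (?f x) * indicator {a..} x \<partial>lborel)"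
    by (intro nn_integral_cong) (auto split: split_indicator)
  also have "\<dots> = ennreal (pi / (2 * r)) + ennreal (pi / (2 * r))"
    by (subst nn_integral_add, measurable, unfold 2 1) (simp add: field_simps)
  also have "\<dots> = ennreal (pi / r)" using r by (subst ennreal_plus[symmetric]) (auto simp: field_simps)
  finally show ?thesis .
qed

section \<open>Hardy space functions: Cauchy and Poisson representation\<close>

lemma borel_measurable_line:
  assumes f: "f holomorphic_on S" and S: "\<And>x::real. Complex x y \<in> S"
  shows "(\<lambda>x. f (Complex x y)) \<in> borel_measurable borel"
proof (rule borel_measurable_continuous_onI)
  have "continuous_on UNIV (\<lambda>x. f (Complex x y))"
    by (rule continuous_on_compose2[OF holomorphic_on_imp_continuous_on[OF f]])
      (use S in \<open>auto intro!: continuous_intros simp: complex_eq_iff Complex_eq\<close>)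
  then show "continuous_on UNIV (\<lambda>x. f (Complex x y))" .
qed

lemma emeasure_lborel_atLeast: "emeasure lborel {a::real..} = \<infinity>"
proof (rule ccontr)
  assume "emeasure lborel {a..} \<noteq> \<infinity>"
  then obtain r where r: "emeasure lborel {a..} = ennreal r" "r \<ge> 0"
    by (cases "emeasure lborel {a..}") auto
  obtain n where n: "r < real n" using reals_Archimedean2 by blast
  have "ennreal (real n) = emeasure lborel {a..a + real n}" by simp
  also have "\<dots> \<le> emeasure lborel {a..}" by (rule emeasure_mono) auto
  finally show False using n r by simp
qed

text \<open>Contour shift without pointwise decay. A primitive \<open>G\<close> reduces the
  difference of the two integrals, truncated to \<open>[-n, n]\<close>, to the difference of the
  vertical sides \<open>V n - V (- n)\<close>. By Fubini over the strip \<open>V\<close> is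
  integrable, so the limit of these side terms, which exists, must be 0.\<close>

lemma strip_integral_eq:
  fixes g :: "complex \<Rightarrow> complex"
  assumes hol: "g holomorphic_on {z. a < Im z \<and> Im z < b}"
    and y: "a < y1" "y1 < y2" "y2 < b"
    and bound: "\<And>y. y1 \<le> y \<Longrightarrow> y \<le> y2 \<Longrightarrow> (\<integral>\<^sup>+x. ennreal (norm (g (Complex x y))) \<partial>lborel) \<le> ennreal K"
  shows "(LINT x|lborel. g (Complex x y1)) = (LINT x|lborel. g (Complex x y2))"
proof -
  define S where "S = {z. a < Im z \<and> Im z < b}"
  have opS: "open S" unfolding S_def
    by (intro open_Collect_conj open_Collect_less continuous_intros)
  have cvx: "convex S"
  proof -
    have "S = {z. Im z > a} \<inter> {z. Im z < b}" by (auto simp: S_def)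
    then show ?thesis by (simp add: convex_Int convex_halfspace_Im_gt convex_halfspace_Im_lt)
  qed
  obtain G where G: "\<And>z. z \<in> S \<Longrightarrow> (G has_field_derivative g z) (at z)"
  proof -
    obtain G where "\<And>z. z \<in> S \<Longrightarrow> (G has_field_derivative g z) (at z within S)"
      by (rule holomorphic_convex_primitive'[OF cvx opS]) (use hol in \<open>auto simp: S_def\<close>)
    then show ?thesis using that at_within_open[OF _ opS] by auto
  qed
  have contg: "continuous_on S g" using hol unfolding S_def by (rule holomorphic_on_imp_continuous_on)
  have inS: "Complex x y \<in> S" if "y1 \<le> y" "y \<le> y2" for x y
    using that assms(2-4) by (auto simp: S_def)
  have meas: "(\<lambda>x. g (Complex x y)) \<in> borel_measurable borel" if "y1 \<le> y" "y \<le> y2" for y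
    by (rule borel_measurable_line[OF hol]) (use inS[OF that] in \<open>auto simp: S_def\<close>)
  have int: "integrable lborel (\<lambda>x. g (Complex x y))" if "y1 \<le> y" "y \<le> y2" for y
    using meas[OF that] bound[OF that] by (intro integrableI_bounded) (auto intro: le_less_trans)
  have FTC: "(LINT x|lborel. indicator {-n..n} x *\<^sub>R g (Complex x y)) = G (Complex n y) - G (Complex (-n) y)"
    if "y1 \<le> y" "y \<le> y2" "0 \<le> n" for y n
  proof (rule integral_FTC_atLeastAtMost)
    show "- n \<le> n" using that by simp
    fix x :: real
    have "((\<lambda>x. Complex x y) has_vector_derivative 1) (at x)"
      unfolding Complex_eq by (auto intro!: derivative_eq_intros)
    then have "(G \<circ> (\<lambda>x. Complex x y) has_vector_derivative 1 * g (Complex x y)) (at x)"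
      by (rule field_vector_diff_chain_at) (rule G[OF inS[OF that(1,2)]])
    then show "((\<lambda>x. G (Complex x y)) has_vector_derivative g (Complex x y)) (at x within {- n..n})"
      by (simp add: o_def has_vector_derivative_at_within)
  next
    show "continuous_on {- n..n} (\<lambda>x. g (Complex x y))"
      by (rule continuous_on_compose2[OF contg])
        (use inS[OF that(1,2)] in \<open>auto intro!: continuous_intros simp: Complex_eq\<close>)
  qed
  have lim: "((\<lambda>n. LINT x|lborel. indicator {-n..n} x *\<^sub>R g (Complex x y)) \<longlongrightarrow> (LINT x|lborel. g (Complex x y))) at_top"
    if "y1 \<le> y" "y \<le> y2" for y
  proof (rule integral_dominated_convergence_at_top[where w="\<lambda>x. norm (g (Complex x y))"])
    show "AE x in lborel. ((\<lambda>n. indicator {-n..n} x *\<^sub>R g (Complex x y)) \<longlongrightarrow> g (Complex x y)) at_top"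
    proof (rule AE_I2)
      fix x :: real
      have "\<forall>\<^sub>F n in at_top. \<bar>x\<bar> \<le> n" by (rule eventually_ge_at_top)
      then have "\<forall>\<^sub>F n in at_top. indicator {-n..n} x *\<^sub>R g (Complex x y) = g (Complex x y)"
        by eventually_elim (auto simp: indicator_def)
      then show "((\<lambda>n. indicator {-n..n} x *\<^sub>R g (Complex x y)) \<longlongrightarrow> g (Complex x y)) at_top"
        by (rule tendsto_eventually)
    qed
  qed (use meas[OF that] int[OF that] in \<open>auto intro!: always_eventually AE_I2 split: split_indicator\<close>)
  \<comment> \<open>Up to the factor \<i> this is the integral of \<open>g\<close> over the vertical
    segment at abscissa \<open>x\<close>.\<close>
  define V where "V x = G (Complex x y2) - G (Complex x y1)" for x
  have Vmeas: "V \<in> borel_measurable borel"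
  proof -
    have "G holomorphic_on S" using G opS by (auto simp: holomorphic_on_open)
    then show ?thesis unfolding V_def
      by (intro borel_measurable_diff borel_measurable_line) (use inS y in auto)
  qed
  have V_le: "ennreal (norm (V x)) \<le> (\<integral>\<^sup>+s. ennreal (norm (g (Complex x s))) * indicator {y1..y2} s \<partial>lborel)" for x
  proof -
    have cont: "continuous_on {y1..y2} (\<lambda>s. \<i> * g (Complex x s))"
      by (intro continuous_intros continuous_on_compose2[OF contg])
        (use inS in \<open>auto intro!: continuous_intros simp: Complex_eq\<close>)
    have "(LINT s|lborel. indicator {y1..y2} s *\<^sub>R (\<i> * g (Complex x s))) = G (Complex x y2) - G (Complex x y1)"
    proof (rule integral_FTC_atLeastAtMost)
      show "y1 \<le> y2" using y by simp
      fix s :: real assume s: "y1 \<le> s" "s \<le> y2"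
      have "((\<lambda>s. Complex x s) has_vector_derivative \<i>) (at s)"
        unfolding Complex_eq by (auto intro!: derivative_eq_intros)
      then have "(G \<circ> (\<lambda>s. Complex x s) has_vector_derivative \<i> * g (Complex x s)) (at s)"
        by (rule field_vector_diff_chain_at) (rule G[OF inS[OF s]])
      then show "((\<lambda>s. G (Complex x s)) has_vector_derivative \<i> * g (Complex x s)) (at s within {y1..y2})"
        by (simp add: o_def has_vector_derivative_at_within)
    qed (rule cont)
    moreover have "integrable lborel (\<lambda>s. indicator {y1..y2} s *\<^sub>R (\<i> * g (Complex x s)))"
      using borel_integrable_compact[OF compact_Icc cont] .
    ultimately have "ennreal (norm (V x)) \<le> (\<integral>\<^sup>+s. ennreal (norm (indicator {y1..y2} s *\<^sub>R (\<i> * g (Complex x s)))) \<partial>lborel)"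
      unfolding V_def using integral_norm_bound_ennreal by metis
    also have "\<dots> = (\<integral>\<^sup>+s. ennreal (norm (g (Complex x s))) * indicator {y1..y2} s \<partial>lborel)"
      by (intro nn_integral_cong) (auto simp: norm_mult split: split_indicator)
    finally show ?thesis .
  qed
  have "(\<lambda>p. ennreal (norm (indicator (UNIV \<times> {y1..y2}) p *\<^sub>R g (Complex (fst p) (snd p))))) \<in> borel_measurable borel"
  proof -
    have "(\<lambda>p. indicator (UNIV \<times> {y1..y2}) p *\<^sub>R g (Complex (fst p) (snd p))) \<in> borel_measurable borel"
      by (rule borel_measurable_continuous_on_indicator)
        (use inS in \<open>auto intro!: continuous_on_compose2[OF contg] continuous_intros simp: Complex_eq closed_Times borel_closed\<close>)
    from measurable_compose[OF this borel_measurable_norm] show ?thesis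
      by (rule measurable_compose[OF _ measurable_ennreal])
  qed
  moreover have "(\<lambda>p. ennreal (norm (indicator (UNIV \<times> {y1..y2}) p *\<^sub>R g (Complex (fst p) (snd p)))))
      = (\<lambda>(x, s). ennreal (norm (g (Complex x s))) * indicator {y1..y2} s)"
    by (auto simp: fun_eq_iff split: split_indicator)
  ultimately have meas2: "(\<lambda>(x, s). ennreal (norm (g (Complex x s))) * indicator {y1..y2} s) \<in> borel_measurable (lborel \<Otimes>\<^sub>M lborel)"
    unfolding lborel_prod measurable_lborel2 by (rule subst[rotated])
  have "(\<integral>\<^sup>+x. ennreal (norm (V x)) \<partial>lborel) \<le> (\<integral>\<^sup>+x. \<integral>\<^sup>+s. ennreal (norm (g (Complex x s))) * indicator {y1..y2} s \<partial>lborel \<partial>lborel)"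
    by (intro nn_integral_mono V_le)
  also have "\<dots> = (\<integral>\<^sup>+s. \<integral>\<^sup>+x. ennreal (norm (g (Complex x s))) * indicator {y1..y2} s \<partial>lborel \<partial>lborel)"
    by (rule lborel_pair.Fubini'[OF meas2, symmetric])
  also have "\<dots> \<le> (\<integral>\<^sup>+s. ennreal K * indicator {y1..y2} s \<partial>lborel)"
    by (intro nn_integral_mono) (auto simp: bound split: split_indicator)
  also have "\<dots> < \<infinity>"
    using y by (simp add: nn_integral_cmult_indicator ennreal_mult_less_top)
  finally have Vfin: "(\<integral>\<^sup>+x. ennreal (norm (V x)) \<partial>lborel) < \<infinity>" .
  have Vfin': "(\<integral>\<^sup>+x. ennreal (norm (V (- x))) \<partial>lborel) < \<infinity>"
    using Vfin Vmeas nn_integral_real_affine[of "\<lambda>x. ennreal (norm (V x))" "-1" 0] by simp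
  define L where "L = (LINT x|lborel. g (Complex x y2)) - (LINT x|lborel. g (Complex x y1))"
  have "((\<lambda>n. (LINT x|lborel. indicator {-n..n} x *\<^sub>R g (Complex x y2)) - (LINT x|lborel. indicator {-n..n} x *\<^sub>R g (Complex x y1))) \<longlongrightarrow> L) at_top"
    unfolding L_def using y by (intro tendsto_diff lim) auto
  moreover have "\<forall>\<^sub>F n in at_top. (LINT x|lborel. indicator {-n..n} x *\<^sub>R g (Complex x y2)) - (LINT x|lborel. indicator {-n..n} x *\<^sub>R g (Complex x y1)) = V n - V (- n)"
    using eventually_ge_at_top[of 0]
  proof eventually_elim
    case (elim n)
    have e1: "(LINT x|lborel. indicator {-n..n} x *\<^sub>R g (Complex x y1)) = G (Complex n y1) - G (Complex (-n) y1)"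
      by (rule FTC) (use elim y in auto)
    have e2: "(LINT x|lborel. indicator {-n..n} x *\<^sub>R g (Complex x y2)) = G (Complex n y2) - G (Complex (-n) y2)"
      by (rule FTC) (use elim y in auto)
    show ?case unfolding e1 e2 V_def by simp
  qed
  ultimately have WL: "((\<lambda>n. V n - V (- n)) \<longlongrightarrow> L) at_top"
    by (rule Lim_transform_eventually)
  \<comment> \<open>A nonzero limit would keep \<open>|V x| + |V (- x)|\<close> above a positive
    constant on a whole ray, contradicting integrability.\<close>
  have "L = 0"
  proof (rule ccontr)
    assume L: "L \<noteq> 0"
    have "((\<lambda>n. norm (V n - V (- n))) \<longlongrightarrow> norm L) at_top" by (intro tendsto_norm WL)
    then have "\<forall>\<^sub>F n in at_top. norm (V n - V (- n)) > norm L / 2"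
      using L by (intro order_tendstoD(1)) auto
    then obtain x0 where x0: "\<And>x. x \<ge> x0 \<Longrightarrow> norm (V x - V (- x)) > norm L / 2"
      by (auto simp: eventually_at_top_linorder)
    have "\<infinity> = (\<integral>\<^sup>+x. ennreal (norm L / 2) * indicator {x0..} x \<partial>lborel)"
      using L by (simp add: nn_integral_cmult_indicator ennreal_mult_top emeasure_lborel_atLeast)
    also have "\<dots> \<le> (\<integral>\<^sup>+x. ennreal (norm (V x)) + ennreal (norm (V (- x))) \<partial>lborel)"
    proof (rule nn_integral_mono)
      fix x :: real
      show "ennreal (norm L / 2) * indicator {x0..} x \<le> ennreal (norm (V x)) + ennreal (norm (V (- x)))"
      proof (cases "x \<ge> x0")
        case True
        have "norm L / 2 \<le> norm (V x) + norm (V (- x))"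
          using x0[OF True] norm_triangle_ineq4[of "V x" "V (- x)"] by simp
        then have "ennreal (norm L / 2) \<le> ennreal (norm (V x) + norm (V (- x)))" by (rule ennreal_leI)
        then show ?thesis using True by (simp add: ennreal_plus)
      qed simp
    qed
    also have "\<dots> = (\<integral>\<^sup>+x. ennreal (norm (V x)) \<partial>lborel) + (\<integral>\<^sup>+x. ennreal (norm (V (- x))) \<partial>lborel)"
      using Vmeas by (intro nn_integral_add) auto
    also have "\<dots> < \<infinity>" using Vfin Vfin' by simp
    finally show False by simp
  qed
  then show ?thesis by (simp add: L_def)
qed

lemma cauchy_kernel_integral:
  assumes r: "(r::real) > 0"
  shows "integrable lborel (\<lambda>x. 1 / ((x - a)\<^sup>2 + r\<^sup>2))" "(LINT x|lborel. 1 / ((x - a)\<^sup>2 + r\<^sup>2)) = pi / r"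
proof -
  show "integrable lborel (\<lambda>x. 1 / ((x - a)\<^sup>2 + r\<^sup>2))"
    by (rule integrableI_nonneg) (auto simp: nn_integral_cauchy_kernel[OF r])
  show "(LINT x|lborel. 1 / ((x - a)\<^sup>2 + r\<^sup>2)) = pi / r"
    by (subst integral_eq_nn_integral) (use r in \<open>auto simp: nn_integral_cauchy_kernel\<close>)
qed

lemma L2sq_cauchy_kernel:
  assumes "Im z \<noteq> 0"
  shows "L2sq lborel (\<lambda>s. 1 / (complex_of_real s - z)) = ennreal (pi / \<bar>Im z\<bar>)"
proof -
  have "(norm (1 / (complex_of_real s - z)))\<^sup>2 = 1 / ((s - Re z)\<^sup>2 + \<bar>Im z\<bar>\<^sup>2)" for s
    by (simp add: norm_divide power_divide cmod_power2)
  then show ?thesis unfolding L2sq_def using assms nn_integral_cauchy_kernel[of "\<bar>Im z\<bar>" "Re z"] by simp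
qed

text \<open>Subtract from \<open>f\<close> the multiple of \<open>1 / (w - cnj z)\<close> that
  agrees with it at \<open>z\<close>. The quotient \<open>k\<close> by \<open>w - z\<close> is then
  holomorphic and, as a product of two square integrable factors, integrable on lines, so its line
  integral is independent of the height; letting the height tend to infinity shows that it is 0.
  What remains on the real line is the subtracted term, an explicit Poisson integral, and it
  supplies \<open>2 * pi * \<i> * f z\<close>.\<close>

lemma hardy_cauchy:
  assumes \<delta>: "\<delta> > 0" and hol: "f holomorphic_on {z. -\<delta> < Im z}"
    and M: "\<And>y. -\<delta> < y \<Longrightarrow> L2sq lborel (\<lambda>x. f (Complex x y)) \<le> ennreal M"
    and z: "Im z > 0"
  shows "(LINT s|lborel. f (complex_of_real s) / (complex_of_real s - z)) = 2 * pi * \<i> * f z"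
proof -
  define y0 where "y0 = Im z"
  define x0 where "x0 = Re z"
  define r where "r = y0 / 2"
  \<comment> \<open>Keeps the pole \<open>cnj z\<close>, at height \<open>- y0\<close>, outside the
    domain \<open>D\<close>.\<close>
  define \<delta>' where "\<delta>' = min \<delta> r"
  define D where "D = {w. -\<delta>' < Im w}"
  define M' where "M' = max M 0"
  have pos: "y0 > 0" "r > 0" "\<delta>' > 0" "M' \<ge> 0" using z \<delta> by (auto simp: y0_def r_def \<delta>'_def M'_def)
  have opD: "open D" unfolding D_def by (intro open_Collect_less continuous_intros)
  have zD: "z \<in> D" using pos by (auto simp: D_def y0_def)
  have cz: "Im w + y0 > 0" if "w \<in> D" for w
    using that pos by (auto simp: D_def \<delta>'_def r_def)
  \<comment> \<open>Since \<open>z - cnj z = 2 * \<i> * y0\<close>, the subtracted term equals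
    \<open>f z\<close> at \<open>w = z\<close>, so \<open>F\<close> vanishes there.\<close>
  define F where "F w = f w - f z * (2 * \<i> * y0) / (w - cnj z)" for w
  have holf: "f holomorphic_on D" by (rule holomorphic_on_subset[OF hol]) (auto simp: D_def \<delta>'_def)
  have holF: "F holomorphic_on D" unfolding F_def
    by (intro holomorphic_intros holf) (use cz in \<open>force simp: complex_eq_iff y0_def\<close>)
  have "z - cnj z = 2 * \<i> * y0" by (simp add: complex_eq_iff y0_def)
  then have Fz: "F z = 0" using pos by (simp add: F_def)
  define k where "k w = (if w = z then deriv F z else (F w - F z) / (w - z))" for w
  have holk: "k holomorphic_on D" unfolding k_def by (rule pole_lemma_open[OF holF opD])
  have k_ne: "k w = F w / (w - z)" if "w \<noteq> z" for w using that Fz by (simp add: k_def)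
  have cball: "cball z r \<subseteq> D"
  proof
    fix w assume "w \<in> cball z r"
    then have "\<bar>Im w - Im z\<bar> \<le> r"
      using abs_Im_le_cmod[of "w - z"] by (simp add: dist_norm norm_minus_commute)
    then have "Im w > 0" using pos unfolding r_def y0_def by linarith
    then show "w \<in> D" using pos by (simp add: D_def)
  qed
  have "bounded (k ` cball z r)"
    by (intro compact_imp_bounded compact_continuous_image compact_cball
        continuous_on_subset[OF holomorphic_on_imp_continuous_on[OF holk] cball])
  then obtain B where B: "B > 0" "\<And>w. w \<in> cball z r \<Longrightarrow> norm (k w) \<le> B"
    unfolding bounded_pos by auto
  define c where "c = norm (f z) * (2 * y0)"
  have c: "c \<ge> 0" using pos by (simp add: c_def)
  define P where "P x = 1 / ((x - x0)\<^sup>2 + r\<^sup>2)" for x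
  have Ppos: "P x \<ge> 0" for x by (simp add: P_def)
  have dpos: "(x - x0)\<^sup>2 + r\<^sup>2 > 0" for x using pos by (simp add: add_nonneg_pos)
  have nF: "norm (F w) \<le> norm (f w) + c / norm (w - cnj z)" for w
  proof -
    have "norm (F w) \<le> norm (f w) + norm (f z * (2 * \<i> * y0) / (w - cnj z))"
      unfolding F_def by (rule norm_triangle_ineq4)
    then show ?thesis using pos by (simp add: c_def norm_divide norm_mult)
  qed
  have nsq: "(norm (w - v))\<^sup>2 = (Re w - Re v)\<^sup>2 + (Im w - Im v)\<^sup>2" for w v
    by (simp add: cmod_power2)
  have q: "(c / norm (w - cnj z))\<^sup>2 \<le> c\<^sup>2 * P (Re w)" if "Im w \<ge> 0" for w
  proof -
    have "(norm (w - cnj z))\<^sup>2 = (Re w - x0)\<^sup>2 + (Im w + y0)\<^sup>2" by (simp add: nsq x0_def y0_def)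
    moreover have "r\<^sup>2 \<le> (Im w + y0)\<^sup>2" using that pos by (intro power_mono) (auto simp: r_def)
    ultimately have "(Re w - x0)\<^sup>2 + r\<^sup>2 \<le> (norm (w - cnj z))\<^sup>2" by simp
    then have "c\<^sup>2 / (norm (w - cnj z))\<^sup>2 \<le> c\<^sup>2 / ((Re w - x0)\<^sup>2 + r\<^sup>2)"
      using dpos[of "Re w"] by (intro divide_left_mono mult_pos_pos) auto
    then show ?thesis by (simp add: P_def power_divide)
  qed
  \<comment> \<open>Weighted arithmetic-geometric inequality. It is used with weight 1 for a bound
    uniform in the height and with weight \<open>1 / T\<close> for decay.\<close>
  have quad: "(p + q) * s \<le> \<eta> * p\<^sup>2 + \<eta> * q\<^sup>2 + s\<^sup>2 / (2 * \<eta>)" if "\<eta> > 0" for p q s \<eta> :: real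
  proof -
    have "0 \<le> (\<eta> * (p + q) - s)\<^sup>2 + \<eta>\<^sup>2 * (p - q)\<^sup>2" by simp
    also have "\<dots> = 2 * \<eta> * (\<eta> * p\<^sup>2 + \<eta> * q\<^sup>2 + s\<^sup>2 / (2 * \<eta>) - (p + q) * s)"
      using that by (simp add: field_simps power2_eq_square)
    finally show ?thesis using that by (simp add: zero_le_mult_iff)
  qed
  \<comment> \<open>\<open>2 * r^2 * B\<close> pays for the disc around \<open>z\<close>, where
    \<open>k\<close> is bounded by compactness and \<open>2 * r^2 * P \<ge> 1\<close>;
    \<open>c^2 + 1\<close> pays for the complement.\<close>
  define C1 where "C1 = 2 * r\<^sup>2 * B + c\<^sup>2 + 1"
  have C1: "C1 \<ge> 0" using B by (simp add: C1_def)
  have k_le: "norm (k w) \<le> (norm (f w))\<^sup>2 + C1 * P (Re w)" if w: "Im w \<ge> 0" for w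
  proof (cases "w \<in> cball z r")
    case True
    have "(norm (w - z))\<^sup>2 \<le> r\<^sup>2" using True by (intro power_mono) (auto simp: dist_norm norm_minus_commute)
    then have "(Re w - x0)\<^sup>2 \<le> r\<^sup>2" unfolding nsq by (simp add: x0_def) (smt (verit) zero_le_power2)
    then have "1 \<le> 2 * r\<^sup>2 * P (Re w)" using dpos[of "Re w"] by (simp add: P_def)
    then have "B * 1 \<le> B * (2 * r\<^sup>2 * P (Re w))" using B by (intro mult_left_mono) auto
    then have "norm (k w) \<le> 2 * r\<^sup>2 * B * P (Re w)" using B(2)[OF True] by (simp add: mult_ac)
    also have "\<dots> \<le> C1 * P (Re w)" unfolding C1_def by (intro mult_right_mono Ppos) simp
    finally show ?thesis by (smt (verit) zero_le_power2)
  next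
    case False
    then have far: "norm (w - z) > r" by (auto simp: dist_norm norm_minus_commute)
    have "r\<^sup>2 \<le> (norm (w - z))\<^sup>2" using far pos by (intro power_mono) auto
    moreover have "(Re w - x0)\<^sup>2 \<le> (norm (w - z))\<^sup>2" by (simp add: nsq x0_def)
    ultimately have "((Re w - x0)\<^sup>2 + r\<^sup>2) \<le> 2 * (norm (w - z))\<^sup>2" by simp
    then have s: "(1 / norm (w - z))\<^sup>2 / 2 \<le> P (Re w)"
    proof -
      have n: "(norm (w - z))\<^sup>2 > 0" using far pos by auto
      have "1 / (2 * (norm (w - z))\<^sup>2) \<le> 1 / ((Re w - x0)\<^sup>2 + r\<^sup>2)"
        using \<open>((Re w - x0)\<^sup>2 + r\<^sup>2) \<le> 2 * (norm (w - z))\<^sup>2\<close> dpos[of "Re w"] n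
        by (intro divide_left_mono mult_pos_pos) auto
      then show ?thesis by (simp add: P_def power_divide mult.commute)
    qed
    have "norm (k w) = norm (F w) * (1 / norm (w - z))" using far pos by (subst k_ne) (auto simp: norm_divide)
    also have "\<dots> \<le> (norm (f w) + c / norm (w - cnj z)) * (1 / norm (w - z))"
      by (intro mult_right_mono nF) simp
    also have "\<dots> \<le> 1 * (norm (f w))\<^sup>2 + 1 * (c / norm (w - cnj z))\<^sup>2 + (1 / norm (w - z))\<^sup>2 / (2 * 1)"
      by (rule quad) simp
    also have "\<dots> \<le> (norm (f w))\<^sup>2 + c\<^sup>2 * P (Re w) + P (Re w)"
      using q[OF w] s by simp
    also have "\<dots> \<le> (norm (f w))\<^sup>2 + C1 * P (Re w)"
    proof -
      have "0 \<le> 2 * r\<^sup>2 * B * P (Re w)" using B Ppos by simp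
      then show ?thesis unfolding C1_def by (simp add: algebra_simps)
    qed
    finally show ?thesis .
  qed
  have Pm[measurable]: "P \<in> borel_measurable borel" unfolding P_def by measurable
  have P_int: "(\<integral>\<^sup>+x. ennreal (P x) \<partial>lborel) = ennreal (pi / r)"
    unfolding P_def by (rule nn_integral_cauchy_kernel) (use pos in simp)
  have M'_le: "L2sq lborel (\<lambda>x. f (Complex x y)) \<le> ennreal M'" if "0 \<le> y" for y
    using M[of y] that \<delta> by (auto simp: M'_def intro: order_trans ennreal_leI)
  have fm: "(\<lambda>x. f (Complex x y)) \<in> borel_measurable borel" if "0 \<le> y" for y
    by (rule borel_measurable_line[OF holf]) (use that pos in \<open>auto simp: D_def\<close>)
  have k_int: "(\<integral>\<^sup>+x. ennreal (norm (k (Complex x y))) \<partial>lborel) \<le> ennreal (M' + C1 * (pi / r))" if y: "0 \<le> y" for y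
  proof -
    note [measurable] = fm[OF y]
    have "(\<integral>\<^sup>+x. ennreal (norm (k (Complex x y))) \<partial>lborel) \<le> (\<integral>\<^sup>+x. ennreal ((norm (f (Complex x y)))\<^sup>2) + ennreal C1 * ennreal (P x) \<partial>lborel)"
      using k_le[of "Complex _ y"] y C1 Ppos
      by (intro nn_integral_mono) (auto simp: ennreal_mult[symmetric] ennreal_plus[symmetric] simp del: ennreal_plus intro!: ennreal_leI)
    also have "\<dots> = L2sq lborel (\<lambda>x. f (Complex x y)) + ennreal C1 * ennreal (pi / r)"
      unfolding L2sq_def by (subst nn_integral_add, measurable) (simp add: nn_integral_cmult P_int)
    also have "\<dots> \<le> ennreal M' + ennreal C1 * ennreal (pi / r)"
      by (intro add_right_mono M'_le y)
    also have "\<dots> = ennreal (M' + C1 * (pi / r))"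
      using C1 pos by (simp add: ennreal_mult[symmetric] ennreal_plus[symmetric] del: ennreal_plus)
    finally show ?thesis .
  qed
  define I where "I = (LINT x|lborel. k (Complex x 0))"
  define C2 where "C2 = M' + c\<^sup>2 * (pi / r) + pi / 2"
  \<comment> \<open>At height \<open>y0 + T^2\<close> the factor \<open>1 / (w - z)\<close> has
    squared norm \<open>pi / T^2\<close>. With the weight \<open>1 / T\<close> in
    \<open>quad\<close> it contributes \<open>pi / (2 * T)\<close>, and the other two terms carry
    \<open>1 / T\<close> as well, so everything is of order \<open>1 / T\<close>.\<close>
  have I_le: "norm I \<le> C2 / T" if T: "T > 0" for T
  proof -
    define Y where "Y = y0 + T\<^sup>2"
    have Y: "0 < Y" using pos T by (simp add: Y_def add_pos_nonneg)
    note [measurable] = fm[OF less_imp_le[OF Y]]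
    have "I = (LINT x|lborel. k (Complex x Y))"
      unfolding I_def
    proof (rule strip_integral_eq)
      show "k holomorphic_on {w. - \<delta>' < Im w \<and> Im w < Y + 1}"
        by (rule holomorphic_on_subset[OF holk]) (auto simp: D_def)
    qed (use pos Y k_int in auto)
    also have "ennreal (norm \<dots>) \<le> (\<integral>\<^sup>+x. ennreal (norm (k (Complex x Y))) \<partial>lborel)"
    proof (rule integral_norm_bound_ennreal, rule integrableI_bounded)
      show "(\<lambda>x. k (Complex x Y)) \<in> borel_measurable lborel"
        using borel_measurable_line[OF holk, of Y] Y pos by (auto simp: D_def)
      show "(\<integral>\<^sup>+x. ennreal (norm (k (Complex x Y))) \<partial>lborel) < \<infinity>"
        using k_int[of Y] Y by (auto intro: le_less_trans)
    qed
    also have "\<dots> \<le> (\<integral>\<^sup>+x. ennreal (1 / T) * ennreal ((norm (f (Complex x Y)))\<^sup>2) + ennreal (c\<^sup>2 / T) * ennreal (P x)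
         + ennreal (T / 2) * ennreal (1 / ((x - x0)\<^sup>2 + (T\<^sup>2)\<^sup>2)) \<partial>lborel)"
    proof (rule nn_integral_mono)
      fix x
      let ?w = "Complex x Y"
      have ne: "?w \<noteq> z" using T by (auto simp: complex_eq_iff Y_def y0_def)
      have "norm (k ?w) = norm (F ?w) * (1 / norm (?w - z))" using ne by (subst k_ne) (auto simp: norm_divide)
      also have "\<dots> \<le> (norm (f ?w) + c / norm (?w - cnj z)) * (1 / norm (?w - z))"
        by (intro mult_right_mono nF) simp
      also have "\<dots> \<le> 1 / T * (norm (f ?w))\<^sup>2 + 1 / T * (c / norm (?w - cnj z))\<^sup>2 + (1 / norm (?w - z))\<^sup>2 / (2 * (1 / T))"
        using T by (intro quad) simp
      also have "(1 / norm (?w - z))\<^sup>2 / (2 * (1 / T)) = T / 2 * (1 / ((x - x0)\<^sup>2 + (T\<^sup>2)\<^sup>2))"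
        by (simp add: power_divide nsq Y_def x0_def y0_def)
      also have "1 / T * (c / norm (?w - cnj z))\<^sup>2 \<le> 1 / T * (c\<^sup>2 * P x)"
        using q[of ?w] Y T by (intro mult_left_mono) auto
      finally have "norm (k ?w) \<le> 1 / T * (norm (f ?w))\<^sup>2 + c\<^sup>2 / T * P x + T / 2 * (1 / ((x - x0)\<^sup>2 + (T\<^sup>2)\<^sup>2))"
        by simp
      then have "ennreal (norm (k ?w)) \<le> ennreal (1 / T * (norm (f ?w))\<^sup>2 + c\<^sup>2 / T * P x + T / 2 * (1 / ((x - x0)\<^sup>2 + (T\<^sup>2)\<^sup>2)))"
        by (rule ennreal_leI)
      also have "\<dots> = ennreal (1 / T) * ennreal ((norm (f ?w))\<^sup>2) + ennreal (c\<^sup>2 / T) * ennreal (P x) + ennreal (T / 2) * ennreal (1 / ((x - x0)\<^sup>2 + (T\<^sup>2)\<^sup>2))"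
      proof -
        have h: "ennreal (a * a' + b * b' + d * d') = ennreal a * ennreal a' + ennreal b * ennreal b' + ennreal d * ennreal d'"
          if "0 \<le> a" "0 \<le> a'" "0 \<le> b" "0 \<le> b'" "0 \<le> d" "0 \<le> d'" for a a' b b' d d' :: real
          using that by (simp add: ennreal_mult)
        show ?thesis by (rule h) (use T Ppos[of x] in auto)
      qed
      finally show "ennreal (norm (k ?w)) \<le> \<dots>" .
    qed
    also have "\<dots> = ennreal (1 / T) * L2sq lborel (\<lambda>x. f (Complex x Y)) + ennreal (c\<^sup>2 / T) * ennreal (pi / r)
        + ennreal (T / 2) * ennreal (pi / T\<^sup>2)"
      unfolding L2sq_def using nn_integral_cauchy_kernel[of "T\<^sup>2" x0] T
      by (simp add: nn_integral_add nn_integral_cmult P_int)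
    also have "\<dots> \<le> ennreal (1 / T) * ennreal M' + ennreal (c\<^sup>2 / T) * ennreal (pi / r) + ennreal (T / 2) * ennreal (pi / T\<^sup>2)"
      using Y by (intro add_mono mult_left_mono M'_le) auto
    also have "\<dots> = ennreal (1 / T * M' + c\<^sup>2 / T * (pi / r) + T / 2 * (pi / T\<^sup>2))"
      using T pos by (simp add: ennreal_mult[symmetric] ennreal_plus[symmetric] del: ennreal_plus)
    also have "1 / T * M' + c\<^sup>2 / T * (pi / r) + T / 2 * (pi / T\<^sup>2) = C2 / T"
      using T by (simp add: C2_def add_divide_distrib power2_eq_square)
    finally have "ennreal (norm I) \<le> ennreal (C2 / T)" .
    moreover have "C2 / T \<ge> 0" using T pos by (simp add: C2_def)
    ultimately show ?thesis by simp
  qed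
  have "((\<lambda>T. C2 / T) \<longlongrightarrow> 0) at_top" by real_asymp
  then have "norm I \<le> 0"
    by (rule tendsto_lowerbound) (auto intro!: eventually_mono[OF eventually_gt_at_top[of 0]] I_le)
  then have I0: "I = 0" by simp
  let ?p = "\<lambda>s. f (complex_of_real s) / (complex_of_real s - z)"
  let ?q = "\<lambda>s. f z * (2 * \<i> * y0) * complex_of_real (1 / ((s - x0)\<^sup>2 + y0\<^sup>2))"
  have ip: "integrable lborel ?p"
  proof -
    have "integrable lborel (\<lambda>s. f (Complex s 0) * (1 / (complex_of_real s - z)))"
      using M'_le[of 0] fm[of 0] z
      by (intro L2sq_mult_integrable) (auto simp: L2sq_cauchy_kernel intro: le_less_trans)
    then show ?thesis by (simp add: Complex_eq)
  qed
  have iq: "integrable lborel ?q" "(LINT s|lborel. ?q s) = f z * (2 * \<i> * y0) * complex_of_real (pi / y0)"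
    using cauchy_kernel_integral[OF pos(1), of x0]
    by (auto intro!: integrable_mult_right integrable_of_real simp del: of_real_divide of_real_add)
  have "I = (LINT s|lborel. ?p s - ?q s)"
    unfolding I_def
  proof (rule Bochner_Integration.integral_cong)
    fix s :: real
    have ne: "complex_of_real s \<noteq> z" "complex_of_real s \<noteq> cnj z" using z by (auto simp: complex_eq_iff)
    have "(complex_of_real s - cnj z) * (complex_of_real s - z) = complex_of_real ((s - x0)\<^sup>2 + y0\<^sup>2)"
      by (simp add: complex_eq_iff x0_def y0_def power2_eq_square algebra_simps)
    then have e: "complex_of_real (1 / ((s - x0)\<^sup>2 + y0\<^sup>2)) = 1 / ((complex_of_real s - cnj z) * (complex_of_real s - z))"
      by (metis of_real_1 of_real_divide)
    have "k (complex_of_real s) = ?p s - ?q s"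
      unfolding e k_ne[OF ne(1)] F_def by (simp add: diff_divide_distrib)
    then show "k (Complex s 0) = ?p s - ?q s" by (simp add: Complex_eq)
  qed simp
  also have "\<dots> = (LINT s|lborel. ?p s) - (LINT s|lborel. ?q s)" by (intro Bochner_Integration.integral_diff ip iq)
  finally show ?thesis using I0 iq(2) pos by (simp add: mult_ac)
qed

text \<open>Cauchy-Schwarz in Cauchy's formula, the kernel having squared norm
  \<open>pi / Im z\<close>; \<open>sqrt pi \<le> 2 * pi\<close> absorbs the constants. The rate
  \<open>(Im z) ^ (-1/2)\<close> makes vertical translates of Hardy functions bounded.\<close>

lemma hardy_pointwise_bound:
  assumes \<delta>: "\<delta> > 0" and hol: "f holomorphic_on {z. -\<delta> < Im z}"
    and M: "\<And>y. -\<delta> < y \<Longrightarrow> L2sq lborel (\<lambda>x. f (Complex x y)) \<le> ennreal M"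
    and z: "Im z > 0" and M0: "M \<ge> 0"
  shows "norm (f z) \<le> sqrt M / sqrt (Im z)"
proof -
  have fm: "(\<lambda>x. f (complex_of_real x)) \<in> borel_measurable lborel"
    using borel_measurable_line[OF hol, of 0] \<delta> by (simp add: Complex_eq)
  have M': "L2sq lborel (\<lambda>x. f (complex_of_real x)) \<le> ennreal M"
    using M[of 0] \<delta> by (simp add: Complex_eq)
  have "norm (2 * pi * \<i> * f z) = norm (LINT s|lborel. f (complex_of_real s) * (1 / (complex_of_real s - z)))"
    using hardy_cauchy[OF assms(1-4)] by simp
  also have "\<dots> \<le> sqrt (enn2real (L2sq lborel (\<lambda>x. f (complex_of_real x)))) * sqrt (enn2real (L2sq lborel (\<lambda>s. 1 / (complex_of_real s - z))))"
    using fm M' z by (intro L2sq_mult_integral_le) (auto simp: L2sq_cauchy_kernel intro: le_less_trans)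
  also have "\<dots> \<le> sqrt M * sqrt (pi / Im z)"
    using M' z M0 by (intro mult_mono real_sqrt_le_mono) (auto simp: L2sq_cauchy_kernel enn2real_leI)
  also have "\<dots> \<le> sqrt M * (2 * pi / sqrt (Im z))"
  proof -
    have "sqrt pi \<le> 2 * pi"
      using pi_gt3 by (intro real_le_lsqrt) (auto simp: power2_eq_square intro: order_trans[of _ "pi * 1"])
    then show ?thesis using z M0 by (intro mult_left_mono) (auto simp: real_sqrt_divide divide_right_mono)
  qed
  finally have "2 * pi * norm (f z) \<le> 2 * pi * (sqrt M / sqrt (Im z))"
    by (simp add: norm_mult mult_ac)
  then show ?thesis by (rule mult_left_le_imp_le) simp
qed

text \<open>Multiplying a bounded \<open>G\<close> by \<open>2 * \<i> * y / (w - cnj z)\<close>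
  produces a function to which Cauchy's formula applies, with the value \<open>G z\<close> at
  \<open>z\<close>; the two linear factors combine to \<open>|s - z|^2\<close> on the real line.
  Boundedness is the right hypothesis because the formula is also applied to a product of two
  translated Hardy functions.\<close>

lemma poisson_bounded:
  fixes G :: "complex \<Rightarrow> complex"
  assumes \<delta>: "\<delta> > 0" and hol: "G holomorphic_on {z. -\<delta> < Im z}"
    and B: "\<And>w. -\<delta> < Im w \<Longrightarrow> norm (G w) \<le> B"
    and z: "Im z > 0"
  shows "(LINT s|lborel. G (complex_of_real s) / complex_of_real ((norm (complex_of_real s - z))\<^sup>2)) = pi / Im z * G z"
proof -
  define y where "y = Im z"
  define \<delta>' where "\<delta>' = min \<delta> (y / 2)"
  have pos: "y > 0" "\<delta>' > 0" "\<delta>' \<le> \<delta>" "\<delta>' \<le> y / 2" using z \<delta> by (auto simp: y_def \<delta>'_def)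
  define F where "F w = G w * (2 * \<i> * y) / (w - cnj z)" for w
  have "F z = G z"
  proof -
    have "z - cnj z = 2 * \<i> * y" by (simp add: complex_eq_iff y_def)
    then show ?thesis using pos by (simp add: F_def)
  qed
  moreover have "(LINT s|lborel. F (complex_of_real s) / (complex_of_real s - z)) = 2 * pi * \<i> * F z"
  proof (rule hardy_cauchy[OF pos(2) _ _ z])
    show "F holomorphic_on {w. - \<delta>' < Im w}"
      unfolding F_def
      by (intro holomorphic_intros holomorphic_on_subset[OF hol])
        (use pos in \<open>auto simp: complex_eq_iff y_def\<close>)
    fix t assume t: "- \<delta>' < t"
    have yt: "t + y > y / 2" using t pos by auto
    have Bnn: "0 \<le> B" using B[of 0] \<delta> by (auto intro: order_trans[OF norm_ge_zero])
    have "L2sq lborel (\<lambda>x. F (Complex x t)) \<le> (\<integral>\<^sup>+x. ennreal ((B * (2 * y))\<^sup>2) * ennreal (1 / ((x - Re z)\<^sup>2 + (t + y)\<^sup>2)) \<partial>lborel)"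
      unfolding L2sq_def
    proof (rule nn_integral_mono)
      fix x
      have "(norm (Complex x t - cnj z))\<^sup>2 = (x - Re z)\<^sup>2 + (t + y)\<^sup>2"
        by (simp add: cmod_power2 y_def)
      then have "(norm (F (Complex x t)))\<^sup>2 = (norm (G (Complex x t)) * (2 * y))\<^sup>2 * (1 / ((x - Re z)\<^sup>2 + (t + y)\<^sup>2))"
        using pos by (simp add: F_def norm_mult norm_divide power_mult_distrib power_divide)
      also have "\<dots> \<le> (B * (2 * y))\<^sup>2 * (1 / ((x - Re z)\<^sup>2 + (t + y)\<^sup>2))"
        using B[of "Complex x t"] t pos by (intro mult_right_mono power_mono) auto
      finally show "ennreal ((norm (F (Complex x t)))\<^sup>2) \<le> ennreal ((B * (2 * y))\<^sup>2) * ennreal (1 / ((x - Re z)\<^sup>2 + (t + y)\<^sup>2))"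
        by (simp add: ennreal_mult[symmetric] ennreal_leI del: times_divide_eq_right)
    qed
    also have "\<dots> = ennreal ((B * (2 * y))\<^sup>2) * ennreal (pi / (t + y))"
      using yt pos by (subst nn_integral_cmult) (auto simp: nn_integral_cauchy_kernel)
    also have "\<dots> = ennreal ((B * (2 * y))\<^sup>2 * (pi / (t + y)))"
      using yt pos by (simp add: ennreal_mult[symmetric])
    also have "\<dots> \<le> ennreal ((B * (2 * y))\<^sup>2 * (pi / (y / 2)))"
      using yt pos by (intro ennreal_leI mult_left_mono divide_left_mono) auto
    finally show "L2sq lborel (\<lambda>x. F (Complex x t)) \<le> ennreal ((B * (2 * y))\<^sup>2 * (pi / (y / 2)))" .
  qed
  moreover have "(LINT s|lborel. F (complex_of_real s) / (complex_of_real s - z)) =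
      (LINT s|lborel. (2 * \<i> * y) * (G (complex_of_real s) / complex_of_real ((norm (complex_of_real s - z))\<^sup>2)))"
  proof (rule Bochner_Integration.integral_cong)
    fix s :: real
    have "complex_of_real ((norm (complex_of_real s - z))\<^sup>2) = (complex_of_real s - cnj z) * (complex_of_real s - z)"
      by (simp only: complex_norm_square) (simp add: mult.commute)
    then show "F (complex_of_real s) / (complex_of_real s - z) =
      (2 * \<i> * y) * (G (complex_of_real s) / complex_of_real ((norm (complex_of_real s - z))\<^sup>2))"
      by (simp add: F_def)
  qed simp
  moreover have "\<dots> = (2 * \<i> * y) * (LINT s|lborel. G (complex_of_real s) / complex_of_real ((norm (complex_of_real s - z))\<^sup>2))"
    by (rule integral_mult_right_zero)
  ultimately have "(2 * \<i> * y) * (LINT s|lborel. G (complex_of_real s) / complex_of_real ((norm (complex_of_real s - z))\<^sup>2)) = 2 * pi * \<i> * G z"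
    by metis
  then show ?thesis using z by (simp add: y_def nonzero_eq_divide_eq mult.commute)
qed

section \<open>Hardy functions on horizontal lines\<close>

lemma borel_measurable_cnj [measurable (raw)]:
  "f \<in> borel_measurable M \<Longrightarrow> (\<lambda>x. cnj (f x)) \<in> borel_measurable M"
  by (rule borel_measurable_continuous_on[where f=cnj]) (intro continuous_intros)

lemma upper_half_plane_iff: "z \<in> upper_half_plane \<longleftrightarrow> Im z > 0"
  by (simp add: upper_half_plane_def)

lemma hardy2_holomorphic: "f \<in> hardy2 \<Longrightarrow> f holomorphic_on upper_half_plane"
  by (simp add: hardy2_def)

lemma hardy2_L2sq_bound:
  fixes f :: "complex \<Rightarrow> complex"
  assumes "f \<in> hardy2"
  obtains M where "M \<ge> 0" "\<And>y. y > 0 \<Longrightarrow> L2sq lborel (\<lambda>x. f (Complex x y)) \<le> ennreal M"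
proof -
  let ?S = "SUP y\<in>{0<..}. L2sq lborel (\<lambda>x. f (Complex x y))"
  have fin: "?S < \<infinity>" using assms by (simp add: hardy2_def L2sq_def)
  show ?thesis
  proof (rule that[of "enn2real ?S"])
    fix y :: real assume "y > 0"
    then have "L2sq lborel (\<lambda>x. f (Complex x y)) \<le> ?S" by (intro SUP_upper) auto
    then show "L2sq lborel (\<lambda>x. f (Complex x y)) \<le> ennreal (enn2real ?S)" using fin by simp
  qed simp
qed

lemma hardy2I:
  fixes f :: "complex \<Rightarrow> complex"
  assumes "f holomorphic_on upper_half_plane" "c < \<infinity>"
    and "\<And>y. y > 0 \<Longrightarrow> L2sq lborel (\<lambda>x. f (Complex x y)) \<le> c"
  shows "f \<in> hardy2"
proof -
  have "(SUP y\<in>{0<..}. L2sq lborel (\<lambda>x. f (Complex x y))) \<le> c"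
    using assms by (intro SUP_least) auto
  then show ?thesis using assms by (auto simp: hardy2_def L2sq_def intro: le_less_trans)
qed

lemma hardy2_measurable_line:
  fixes f :: "complex \<Rightarrow> complex"
  assumes "f \<in> hardy2" "y > 0"
  shows "(\<lambda>x. f (Complex x y)) \<in> borel_measurable borel"
  by (rule borel_measurable_line[OF hardy2_holomorphic[OF assms(1)]]) (use assms(2) in \<open>simp add: upper_half_plane_iff\<close>)

lemma hardy2_L2sq_finite:
  fixes f :: "complex \<Rightarrow> complex"
  assumes "f \<in> hardy2" "y > 0"
  shows "L2sq lborel (\<lambda>x. f (Complex x y)) < \<infinity>"
  using hardy2_L2sq_bound[OF assms(1)] assms(2) by (metis ennreal_less_top infinity_ennreal_def le_less_trans)

lemma hardy2_shift_holomorphic: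
  fixes f :: "complex \<Rightarrow> complex"
  assumes "f \<in> hardy2"
  shows "(\<lambda>w. f (w + \<i> * complex_of_real \<epsilon>)) holomorphic_on {w. - \<epsilon> < Im w}"
proof -
  have "(f \<circ> (\<lambda>w. w + \<i> * complex_of_real \<epsilon>)) holomorphic_on {w. - \<epsilon> < Im w}"
    by (rule holomorphic_on_compose_gen[OF _ hardy2_holomorphic[OF assms]])
      (auto intro!: holomorphic_intros simp: upper_half_plane_iff)
  then show ?thesis by (simp add: o_def)
qed

lemma hardy2_shift_L2sq:
  "L2sq lborel (\<lambda>x. f (Complex x y + \<i> * complex_of_real \<epsilon>)) = L2sq lborel (\<lambda>x. f (Complex x (y + \<epsilon>)))"
proof -
  have "Complex x y + \<i> * complex_of_real \<epsilon> = Complex x (y + \<epsilon>)" for x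
    by (simp add: complex_eq_iff)
  then show ?thesis by simp
qed

lemma hardy2_cauchy:
  fixes f :: "complex \<Rightarrow> complex"
  assumes f: "f \<in> hardy2" and \<epsilon>: "\<epsilon> > 0" and z: "Im z > 0"
  shows "(LINT s|lborel. f (Complex s \<epsilon>) / (complex_of_real s - z)) = 2 * pi * \<i> * f (z + \<i> * complex_of_real \<epsilon>)"
proof -
  obtain M where M: "M \<ge> 0" "\<And>y. y > 0 \<Longrightarrow> L2sq lborel (\<lambda>x. f (Complex x y)) \<le> ennreal M"
    using hardy2_L2sq_bound[OF f] by blast
  have "complex_of_real s + \<i> * complex_of_real \<epsilon> = Complex s \<epsilon>" for s by (simp add: complex_eq_iff)
  with hardy_cauchy[OF \<epsilon> hardy2_shift_holomorphic[OF f] _ z, of M] M(2) show ?thesis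
    by (simp add: hardy2_shift_L2sq)
qed

lemma hardy2_pointwise_bound:
  fixes f :: "complex \<Rightarrow> complex"
  assumes f: "f \<in> hardy2"
  obtains C where "C \<ge> 0" "\<And>z. Im z > 0 \<Longrightarrow> norm (f z) \<le> C / sqrt (Im z)"
proof -
  obtain M where M: "M \<ge> 0" "\<And>y. y > 0 \<Longrightarrow> L2sq lborel (\<lambda>x. f (Complex x y)) \<le> ennreal M"
    using hardy2_L2sq_bound[OF f] by blast
  show ?thesis
  proof (rule that[of "sqrt (2 * M)"])
    fix z :: complex assume z: "Im z > 0"
    define e where "e = Im z / 2"
    have e: "e > 0" using z by (simp add: e_def)
    have "norm (f ((z - \<i> * complex_of_real e) + \<i> * complex_of_real e)) \<le> sqrt M / sqrt (Im (z - \<i> * complex_of_real e))"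
    proof (rule hardy_pointwise_bound[OF e hardy2_shift_holomorphic[OF f]])
      show "L2sq lborel (\<lambda>x. f (Complex x t + \<i> * complex_of_real e)) \<le> ennreal M" if "- e < t" for t
        unfolding hardy2_shift_L2sq by (rule M(2)) (use that in simp)
    qed (use M z in \<open>auto simp: e_def\<close>)
    then show "norm (f z) \<le> sqrt (2 * M) / sqrt (Im z)"
      by (simp add: e_def real_sqrt_divide real_sqrt_mult mult.commute)
  qed (use M in simp)
qed

lemma hardy2_shift_bounded:
  fixes f :: "complex \<Rightarrow> complex"
  assumes f: "f \<in> hardy2" and \<epsilon>: "\<epsilon> > 0"
  obtains B where "B \<ge> 0" "\<And>w. -\<epsilon> / 2 < Im w \<Longrightarrow> norm (f (w + \<i> * complex_of_real \<epsilon>)) \<le> B"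
proof -
  obtain C where C: "C \<ge> 0" "\<And>z. Im z > 0 \<Longrightarrow> norm (f z) \<le> C / sqrt (Im z)"
    using hardy2_pointwise_bound[OF f] by blast
  show ?thesis
  proof (rule that[of "C / sqrt (\<epsilon> / 2)"])
    fix w :: complex assume w: "-\<epsilon> / 2 < Im w"
    have "norm (f (w + \<i> * complex_of_real \<epsilon>)) \<le> C / sqrt (Im (w + \<i> * complex_of_real \<epsilon>))"
      using w \<epsilon> by (intro C) auto
    also have "\<dots> \<le> C / sqrt (\<epsilon> / 2)"
      using w \<epsilon> C by (intro divide_left_mono real_sqrt_le_mono mult_pos_pos) auto
    finally show "norm (f (w + \<i> * complex_of_real \<epsilon>)) \<le> C / sqrt (\<epsilon> / 2)" .
  qed (use C \<epsilon> in auto)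
qed

lemma hardy2_poisson:
  fixes f :: "complex \<Rightarrow> complex"
  assumes f: "f \<in> hardy2" and \<epsilon>: "\<epsilon> > 0" and z: "Im z > 0"
  shows "(LINT s|lborel. f (Complex s \<epsilon>) / complex_of_real ((norm (complex_of_real s - z))\<^sup>2)) =
    pi / Im z * f (z + \<i> * complex_of_real \<epsilon>)"
proof -
  obtain B where B: "B \<ge> 0" "\<And>w. -\<epsilon> / 2 < Im w \<Longrightarrow> norm (f (w + \<i> * complex_of_real \<epsilon>)) \<le> B"
    using hardy2_shift_bounded[OF f \<epsilon>] by blast
  have "complex_of_real s + \<i> * complex_of_real \<epsilon> = Complex s \<epsilon>" for s by (simp add: complex_eq_iff)
  moreover have "(\<lambda>w. f (w + \<i> * complex_of_real \<epsilon>)) holomorphic_on {w. - (\<epsilon> / 2) < Im w}"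
    by (rule holomorphic_on_subset[OF hardy2_shift_holomorphic[OF f, of \<epsilon>]]) (use \<epsilon> in auto)
  ultimately show ?thesis
    using poisson_bounded[of "\<epsilon> / 2" "\<lambda>w. f (w + \<i> * complex_of_real \<epsilon>)" B z] \<epsilon> z B
    by auto
qed

text \<open>With \<open>F w = f (w + \<i> c)\<close>, the product of \<open>F w\<close> and
  \<open>cnj (F (cnj w))\<close> is holomorphic in the strip of half-width \<open>c\<close>. On the
  line at height \<open>t\<close> it is the integrand for the heights \<open>c - t\<close> and
  \<open>c + t\<close>, so \<open>strip_integral_eq\<close> applies.\<close>

lemma hardy2_line_correlation:
  fixes f :: "complex \<Rightarrow> complex"
  assumes f: "f \<in> hardy2" and \<tau>: "0 < \<tau>" "\<tau> < c"
  shows "(LINT x|lborel. cnj (f (Complex x (c - \<tau>))) * f (Complex x (c + \<tau>))) =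
    (LINT x|lborel. cnj (f (Complex x c)) * f (Complex x c))"
proof -
  obtain M where M: "M \<ge> 0" "\<And>y. y > 0 \<Longrightarrow> L2sq lborel (\<lambda>x. f (Complex x y)) \<le> ennreal M"
    using hardy2_L2sq_bound[OF f] by blast
  define F where "F w = f (w + \<i> * complex_of_real c)" for w
  define g where "g w = (cnj \<circ> F \<circ> cnj) w * F w" for w
  let ?S = "{w. - c < Im w \<and> Im w < c}"
  have opS: "open ?S" by (intro open_Collect_conj open_Collect_less continuous_intros)
  have cS: "cnj ` ?S = ?S"
  proof (intro set_eqI iffI)
    fix w assume "w \<in> ?S" then have "cnj w \<in> ?S" by auto
    then show "w \<in> cnj ` ?S" by (metis complex_cnj_cnj image_eqI)
  qed auto
  have holF: "F holomorphic_on ?S"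
    unfolding F_def by (rule holomorphic_on_subset[OF hardy2_shift_holomorphic[OF f]]) auto
  have "(cnj \<circ> F \<circ> cnj) holomorphic_on ?S"
    by (rule holomorphic_on_compose_cnj_cnj) (simp_all add: cS holF opS)
  then have holg: "g holomorphic_on ?S"
    unfolding g_def by (intro holomorphic_on_mult holF)
  have g: "g (Complex x t) = cnj (f (Complex x (c - t))) * f (Complex x (c + t))" for x t
  proof -
    have "cnj (Complex x t) + \<i> * complex_of_real c = Complex x (c - t)" "Complex x t + \<i> * complex_of_real c = Complex x (c + t)"
      by (simp_all add: complex_eq_iff)
    then show ?thesis by (simp add: g_def F_def)
  qed
  have "(LINT x|lborel. g (Complex x 0)) = (LINT x|lborel. g (Complex x \<tau>))"
  proof (rule strip_integral_eq[OF holg])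
    fix t assume t: "0 \<le> t" "t \<le> \<tau>"
    have [measurable]: "(\<lambda>x. f (Complex x (c - t))) \<in> borel_measurable borel" "(\<lambda>x. f (Complex x (c + t))) \<in> borel_measurable borel"
      using t \<tau> by (auto intro!: hardy2_measurable_line f)
    have "(\<integral>\<^sup>+x. ennreal (norm (g (Complex x t))) \<partial>lborel) \<le> (\<integral>\<^sup>+x. ennreal ((norm (f (Complex x (c - t))))\<^sup>2) + ennreal ((norm (f (Complex x (c + t))))\<^sup>2) \<partial>lborel)"
    proof (rule nn_integral_mono)
      fix x
      have "p * q \<le> p\<^sup>2 + q\<^sup>2" for p q :: real
        using sum_squares_bound[of p q] zero_le_power2[of p] zero_le_power2[of q] by linarith
      then have "norm (g (Complex x t)) \<le> (norm (f (Complex x (c - t))))\<^sup>2 + (norm (f (Complex x (c + t))))\<^sup>2"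
        by (simp add: g norm_mult)
      then show "ennreal (norm (g (Complex x t))) \<le> ennreal ((norm (f (Complex x (c - t))))\<^sup>2) + ennreal ((norm (f (Complex x (c + t))))\<^sup>2)"
        by (simp add: ennreal_plus[symmetric] ennreal_leI del: ennreal_plus)
    qed
    also have "\<dots> = L2sq lborel (\<lambda>x. f (Complex x (c - t))) + L2sq lborel (\<lambda>x. f (Complex x (c + t)))"
      unfolding L2sq_def by (intro nn_integral_add) measurable
    also have "\<dots> \<le> ennreal M + ennreal M" using t \<tau> by (intro add_mono M) auto
    finally show "(\<integral>\<^sup>+x. ennreal (norm (g (Complex x t))) \<partial>lborel) \<le> ennreal (M + M)"
      unfolding ennreal_plus[OF M(1) M(1)] .
  qed (use \<tau> in auto)
  then show ?thesis by (simp add: g)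
qed

text \<open>Expand the square: the cross term depends only on \<open>y + y'\<close>, so it equals
  the squared norm on the line halfway between. The second claim, nonnegativity of the left side, is
  midpoint convexity of \<open>N\<close>.\<close>

lemma hardy2_L2sq_diff:
  fixes f :: "complex \<Rightarrow> complex"
  assumes f: "f \<in> hardy2" and y: "0 < y" "0 < y'"
  defines "N \<equiv> \<lambda>y. enn2real (L2sq lborel (\<lambda>x. f (Complex x y)))"
  shows "L2sq lborel (\<lambda>x. f (Complex x y) - f (Complex x y')) = ennreal (N y + N y' - 2 * N ((y + y') / 2))"
    and "0 \<le> N y + N y' - 2 * N ((y + y') / 2)"
proof -
  have "L2sq lborel (\<lambda>x. f (Complex x y) - f (Complex x y')) = ennreal (N y + N y' - 2 * N ((y + y') / 2))
      \<and> 0 \<le> N y + N y' - 2 * N ((y + y') / 2)"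
    using y
  proof (induction y y' rule: linorder_wlog)
    case (sym y y')
    have "L2sq lborel (\<lambda>x. f (Complex x y) - f (Complex x y')) = L2sq lborel (\<lambda>x. f (Complex x y') - f (Complex x y))"
      unfolding L2sq_def by (simp add: norm_minus_commute)
    then show ?case using sym by (simp add: add.commute)
  next
    case (le y y')
    define c where "c = (y + y') / 2"
    have c: "c > 0" using le by (simp add: c_def)
    have meas: "(\<lambda>x. f (Complex x t)) \<in> borel_measurable borel" if "t > 0" for t
      using f that by (rule hardy2_measurable_line)
    have N: "has_bochner_integral lborel (\<lambda>x. (norm (f (Complex x t)))\<^sup>2) (N t)" if t: "t > 0" for t
    proof (rule has_bochner_integral_nn_integral)
      show "(\<integral>\<^sup>+x. ennreal ((norm (f (Complex x t)))\<^sup>2) \<partial>lborel) = ennreal (N t)"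
        using hardy2_L2sq_finite[OF f t] by (simp add: N_def L2sq_def)
    qed (use meas[OF t] in \<open>auto simp: N_def\<close>)
    have Nc: "(LINT x|lborel. cnj (f (Complex x c)) * f (Complex x c)) = complex_of_real (N c)"
    proof -
      have "(LINT x|lborel. cnj (f (Complex x c)) * f (Complex x c)) = (LINT x|lborel. complex_of_real ((norm (f (Complex x c)))\<^sup>2))"
        by (intro Bochner_Integration.integral_cong refl) (simp only: complex_norm_square mult.commute)
      also have "\<dots> = complex_of_real (N c)"
        using has_bochner_integral_integral_eq[OF N[OF c]] by (simp only: integral_complex_of_real)
      finally show ?thesis .
    qed
    have corr: "(LINT x|lborel. cnj (f (Complex x y)) * f (Complex x y')) = complex_of_real (N c)"
    proof (cases "y = y'")
      case True then show ?thesis using Nc by (simp add: c_def)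
    next
      case False
      have "c - (y' - y) / 2 = y" "c + (y' - y) / 2 = y'" by (simp_all add: c_def field_simps)
      with hardy2_line_correlation[OF f, of "(y' - y) / 2" c] Nc show ?thesis
        using le False by (auto simp: c_def field_simps)
    qed
    have int: "integrable lborel (\<lambda>x. cnj (f (Complex x y)) * f (Complex x y'))"
      by (rule L2sq_mult_integrable)
        (use meas le hardy2_L2sq_finite[OF f] in \<open>auto simp: L2sq_def intro!: borel_measurable_cnj\<close>)
    have "has_bochner_integral lborel (\<lambda>x. (norm (f (Complex x y)))\<^sup>2 + (norm (f (Complex x y')))\<^sup>2 - 2 * Re (cnj (f (Complex x y)) * f (Complex x y')))
       (N y + N y' - 2 * Re (complex_of_real (N c)))"
      using le int corr
      by (intro has_bochner_integral_diff has_bochner_integral_add N has_bochner_integral_mult_right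
          has_bochner_integral_Re) (auto simp: has_bochner_integral_iff)
    moreover have "(norm (a - b))\<^sup>2 = (norm a)\<^sup>2 + (norm b)\<^sup>2 - 2 * Re (cnj a * b)" for a b :: complex
      by (simp only: cmod_power2) (simp add: power2_eq_square algebra_simps)
    ultimately have *: "has_bochner_integral lborel (\<lambda>x. (norm (f (Complex x y) - f (Complex x y')))\<^sup>2) (N y + N y' - 2 * N c)"
      by simp
    have "0 \<le> (LINT x|lborel. (norm (f (Complex x y) - f (Complex x y')))\<^sup>2)"
      by (intro integral_nonneg_AE) simp
    then have "0 \<le> N y + N y' - 2 * N c" unfolding has_bochner_integral_integral_eq[OF *] .
    with * show ?case unfolding L2sq_def c_def
      by (subst nn_integral_eq_integral) (auto simp: has_bochner_integral_iff)
  qed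
  then show "L2sq lborel (\<lambda>x. f (Complex x y) - f (Complex x y')) = ennreal (N y + N y' - 2 * N ((y + y') / 2))"
    and "0 \<le> N y + N y' - 2 * N ((y + y') / 2)" by auto
qed

text \<open>If \<open>N\<close> grew by a positive amount from \<open>a\<close> to \<open>b\<close>,
  midpoint convexity would force at least the same growth over every further step of length
  \<open>b - a\<close>, and \<open>N\<close> would exceed any bound.\<close>

lemma midpoint_convex_bounded_antimono:
  fixes N :: "real \<Rightarrow> real"
  assumes mid: "\<And>a b. 0 < a \<Longrightarrow> 0 < b \<Longrightarrow> 2 * N ((a + b) / 2) \<le> N a + N b"
    and bdd: "\<And>a. 0 < a \<Longrightarrow> N a \<le> S" and ab: "0 < a" "a \<le> b"
  shows "N b \<le> N a"
proof (rule ccontr)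
  assume "\<not> N b \<le> N a"
  define d where "d = b - a"
  define \<delta> where "\<delta> = N b - N a"
  have \<delta>: "\<delta> > 0" using \<open>\<not> N b \<le> N a\<close> by (simp add: \<delta>_def)
  have d: "d \<ge> 0" using ab by (simp add: d_def)
  have step: "\<delta> \<le> N (a + real (Suc k) * d) - N (a + real k * d)" for k
  proof (induction k)
    case 0 then show ?case by (simp add: d_def \<delta>_def)
  next
    case (Suc k)
    have p: "0 < a + real k * d" "0 < a + real (Suc (Suc k)) * d"
      using ab d by (auto intro!: add_pos_nonneg)
    have "(a + real k * d + (a + real (Suc (Suc k)) * d)) / 2 = a + real (Suc k) * d"
      by (simp add: field_simps)
    from mid[OF p, unfolded this] Suc show ?case by linarith
  qed
  have "N a + real k * \<delta> \<le> N (a + real k * d)" for k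
  proof (induction k)
    case (Suc k) then show ?case using step[of k] by (simp add: algebra_simps)
  qed simp
  moreover have "N (a + real k * d) \<le> S" for k
    using ab d by (intro bdd add_pos_nonneg) auto
  ultimately have *: "N a + real k * \<delta> \<le> S" for k by (rule order_trans)
  obtain k where "S - N a < real k * \<delta>" using reals_Archimedean3[OF \<delta>] by blast
  then show False using *[of k] by simp
qed

text \<open>\<open>N\<close> is antimonotone and bounded, with supremum \<open>S\<close> approached
  at 0. Once \<open>N y0 > S - e / 2\<close>, two heights below \<open>y0\<close> have their
  midpoint below \<open>y0\<close> too, so \<open>N y + N y' - 2 * N ((y + y') / 2)\<close> is at
  most \<open>2 * S - 2 * N y0\<close>, hence below \<open>e\<close>.\<close>

lemma hardy2_L2_cauchy:
  fixes f :: "complex \<Rightarrow> complex"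
  assumes f: "f \<in> hardy2" and e: "e > 0"
  shows "\<exists>\<delta>>0. \<forall>y y'. 0 < y \<and> y < \<delta> \<and> 0 < y' \<and> y' < \<delta> \<longrightarrow>
    L2sq lborel (\<lambda>x. f (Complex x y) - f (Complex x y')) \<le> ennreal e"
proof -
  obtain M where M: "M \<ge> 0" "\<And>y. y > 0 \<Longrightarrow> L2sq lborel (\<lambda>x. f (Complex x y)) \<le> ennreal M"
    using hardy2_L2sq_bound[OF f] by blast
  define N where "N y = enn2real (L2sq lborel (\<lambda>x. f (Complex x y)))" for y
  have N_le: "N y \<le> M" if "y > 0" for y unfolding N_def using M that by (intro enn2real_leI) auto
  have diff: "L2sq lborel (\<lambda>x. f (Complex x y) - f (Complex x y')) = ennreal (N y + N y' - 2 * N ((y + y') / 2))"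
    if "0 < y" "0 < y'" for y y' unfolding N_def using hardy2_L2sq_diff(1)[OF f that] .
  have mid: "2 * N ((y + y') / 2) \<le> N y + N y'" if "0 < y" "0 < y'" for y y'
    using hardy2_L2sq_diff(2)[OF f that] unfolding N_def by simp
  define S where "S = (SUP y\<in>{0<..}. N y)"
  have bdd: "bdd_above (N ` {0<..})" using N_le by (intro bdd_aboveI[of _ M]) auto
  obtain y0 where y0: "y0 > 0" "S - e / 2 < N y0"
    using less_cSUP_iff[OF _ bdd, of "S - e / 2"] e by (auto simp: S_def)
  have S: "N y \<le> S" if "y > 0" for y unfolding S_def using that by (intro cSUP_upper bdd) auto
  show ?thesis
  proof (intro exI[of _ y0] conjI allI impI y0)
    fix y y' assume *: "0 < y \<and> y < y0 \<and> 0 < y' \<and> y' < y0"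
    have "N y0 \<le> N ((y + y') / 2)"
      by (rule midpoint_convex_bounded_antimono[of N M]) (use * mid N_le in auto)
    then show "L2sq lborel (\<lambda>x. f (Complex x y) - f (Complex x y')) \<le> ennreal e"
      using * S[of y] S[of y'] y0 by (subst diff) (auto intro!: ennreal_leI)
  qed
qed

section \<open>Boundary functions and Fatou's theorem\<close>

lemma L2sq_reflect:
  fixes F :: "real \<Rightarrow> complex"
  assumes [measurable]: "F \<in> borel_measurable borel"
  shows "L2sq lborel (\<lambda>x. F (- x)) = L2sq lborel F"
  unfolding L2sq_def
  using nn_integral_real_affine[of "\<lambda>x. ennreal ((norm (F x))\<^sup>2)" "-1" 0] by simp

lemma tendsto_ennreal_0I:
  fixes g :: "'a \<Rightarrow> ennreal"
  assumes "\<And>e::real. e > 0 \<Longrightarrow> \<forall>\<^sub>F x in F. g x \<le> ennreal e"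
  shows "(g \<longlongrightarrow> 0) F"
proof (rule order_tendstoI)
  fix a :: ennreal assume "0 < a"
  then obtain e where e: "0 < e" "ennreal e < a"
    by (metis ennreal_0 ennreal_less_zero_iff dense ennreal_cases top.not_eq_extremum infinity_ennreal_def ennreal_less_top less_trans)
  from assms[OF e(1)] show "\<forall>\<^sub>F x in F. g x < a"
    by eventually_elim (use e in auto)
qed simp

text \<open>A Borel representative of the \<open>L\<^sup>2\<close> limit of the lines; a relation,
  since the limit is unique only up to null sets. Analysis uses this function, and Fatou's theorem
  identifies it with \<open>boundary_value\<close> afterwards.\<close>

definition L2_boundary :: "(complex \<Rightarrow> complex) \<Rightarrow> (real \<Rightarrow> complex) \<Rightarrow> bool" where
  "L2_boundary f u \<longleftrightarrow> u \<in> borel_measurable borel \<and> L2sq lborel u < \<infinity> \<and>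
     ((\<lambda>y. L2sq lborel (\<lambda>x. f (Complex x y) - u x)) \<longlongrightarrow> 0) (at_right 0)"

lemma hardy2_L2_boundary_exists:
  fixes f :: "complex \<Rightarrow> complex"
  assumes f: "f \<in> hardy2"
  shows "\<exists>u. L2_boundary f u"
proof -
  have "\<forall>n. \<exists>\<delta>>0. \<forall>y y'. 0 < y \<and> y < \<delta> \<and> 0 < y' \<and> y' < \<delta> \<longrightarrow>
    L2sq lborel (\<lambda>x. f (Complex x y) - f (Complex x y')) \<le> ennreal ((1 / 8) ^ n)"
    using hardy2_L2_cauchy[OF f] by simp
  then obtain \<delta> where \<delta>: "\<And>n. \<delta> n > 0" "\<And>n y y'. 0 < y \<and> y < \<delta> n \<and> 0 < y' \<and> y' < \<delta> n \<Longrightarrow>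
    L2sq lborel (\<lambda>x. f (Complex x y) - f (Complex x y')) \<le> ennreal ((1 / 8) ^ n)"
    by metis
  \<comment> \<open>\<delta> need not be monotone. Staying below all of
    \<open>\<delta> 0, ..., \<delta> n\<close> lets \<open>\<delta> n\<close> control both
    \<open>Y n\<close> and \<open>Y (Suc n)\<close>.\<close>
  define Y where "Y n = Min (\<delta> ` {..n}) / 2" for n
  have Y: "0 < Y n" "k \<le> n \<Longrightarrow> Y n < \<delta> k" for n k
  proof -
    have "Min (\<delta> ` {..n}) \<in> \<delta> ` {..n}" by (intro Min_in) auto
    then have pos: "Min (\<delta> ` {..n}) > 0" using \<delta>(1) by auto
    then show "0 < Y n" by (simp add: Y_def)
    assume "k \<le> n"
    then have "Min (\<delta> ` {..n}) \<le> \<delta> k" by (intro Min_le) auto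
    then show "Y n < \<delta> k" using pos \<delta>(1)[of k] unfolding Y_def by linarith
  qed
  define a where "a n x = f (Complex x (Y n))" for n x
  have meas: "a n \<in> borel_measurable lborel" for n
    unfolding a_def using hardy2_measurable_line[OF f Y(1)] by simp
  have "\<exists>u\<in>borel_measurable lborel. L2sq lborel u < \<infinity> \<and> (\<lambda>n. L2sq lborel (\<lambda>x. a n x - u x)) \<longlonglongrightarrow> 0"
  proof (rule L2sq_complete[OF meas])
    show "L2sq lborel (a 0) < \<infinity>" unfolding a_def by (rule hardy2_L2sq_finite[OF f Y(1)])
    show "L2sq lborel (\<lambda>x. a (Suc n) x - a n x) \<le> ennreal ((1 / 8) ^ n)" for n
      unfolding a_def by (rule \<delta>(2)) (auto intro!: Y)
  qed
  then obtain u where u: "u \<in> borel_measurable borel" "L2sq lborel u < \<infinity>" "(\<lambda>n. L2sq lborel (\<lambda>x. a n x - u x)) \<longlonglongrightarrow> 0"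
    by auto
  have "((\<lambda>y. L2sq lborel (\<lambda>x. f (Complex x y) - u x)) \<longlongrightarrow> 0) (at_right 0)"
  proof (rule tendsto_ennreal_0I)
    fix e :: real assume e: "e > 0"
    have "(\<lambda>n. 2 * ennreal ((1/8)^n) + 2 * L2sq lborel (\<lambda>x. a n x - u x)) \<longlonglongrightarrow> 2 * ennreal 0 + 2 * 0"
      by (intro tendsto_add ennreal_tendsto_cmult tendsto_ennrealI u(3) LIMSEQ_realpow_zero) auto
    then have "\<forall>\<^sub>F n in sequentially. 2 * ennreal ((1/8)^n) + 2 * L2sq lborel (\<lambda>x. a n x - u x) < ennreal e"
      using e by (intro order_tendstoD(2)) auto
    then obtain n where n: "2 * ennreal ((1/8)^n) + 2 * L2sq lborel (\<lambda>x. a n x - u x) < ennreal e"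
      by (auto simp: eventually_sequentially)
    have "\<forall>\<^sub>F y in at_right 0. 0 < y \<and> y < \<delta> n"
      using \<delta>(1)[of n] by (auto simp: eventually_at_right_field intro!: exI[of _ "\<delta> n"])
    then show "\<forall>\<^sub>F y in at_right 0. L2sq lborel (\<lambda>x. f (Complex x y) - u x) \<le> ennreal e"
    proof eventually_elim
      case (elim y)
      have "L2sq lborel (\<lambda>x. f (Complex x y) - u x) = L2sq lborel (\<lambda>x. (f (Complex x y) - a n x) + (a n x - u x))"
        by simp
      also have "\<dots> \<le> 2 * L2sq lborel (\<lambda>x. f (Complex x y) - a n x) + 2 * L2sq lborel (\<lambda>x. a n x - u x)"
        using hardy2_measurable_line[OF f, of y] elim meas[of n] u(1) by (intro L2sq_add_le) auto
      also have "\<dots> \<le> 2 * ennreal ((1/8)^n) + 2 * L2sq lborel (\<lambda>x. a n x - u x)"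
        unfolding a_def using elim Y by (intro add_mono mult_left_mono \<delta>(2)) auto
      finally show ?case using n by simp
    qed
  qed
  with u show ?thesis unfolding L2_boundary_def by auto
qed

lemma L2_boundary_sequence:
  assumes "L2_boundary f u"
  shows "(\<lambda>n. L2sq lborel (\<lambda>x. f (Complex x (1 / real (Suc n))) - u x)) \<longlonglongrightarrow> 0"
proof -
  have "filterlim (\<lambda>n. 1 / real (Suc n)) (at_right 0) sequentially" by real_asymp
  with assms show ?thesis unfolding L2_boundary_def by (auto intro: filterlim_compose)
qed

lemma hardy2_isCont:
  fixes f :: "complex \<Rightarrow> complex"
  assumes "f \<in> hardy2" "Im z > 0"
  shows "isCont f z"
proof -
  have "open upper_half_plane" unfolding upper_half_plane_def by (intro open_Collect_less continuous_intros)
  then show ?thesis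
    using holomorphic_on_imp_continuous_on[OF hardy2_holomorphic[OF assms(1)]] assms(2)
    by (auto simp: continuous_on_eq_continuous_at upper_half_plane_iff)
qed

lemma hardy2_shift_tendsto:
  fixes f :: "complex \<Rightarrow> complex"
  assumes "f \<in> hardy2" "Im z > 0"
  shows "(\<lambda>n. f (z + \<i> * complex_of_real (1 / real (Suc n)))) \<longlonglongrightarrow> f z"
proof -
  have "(\<lambda>n. z + \<i> * complex_of_real (1 / real (Suc n))) \<longlonglongrightarrow> z + \<i> * complex_of_real 0"
    by (intro tendsto_intros LIMSEQ_Suc lim_1_over_n)
  then have *: "(\<lambda>n. z + \<i> * complex_of_real (1 / real (Suc n))) \<longlonglongrightarrow> z" by simp
  show ?thesis by (rule isCont_tendsto_compose[OF hardy2_isCont[OF assms] *])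
qed

lemma L2_boundary_cauchy:
  fixes f :: "complex \<Rightarrow> complex"
  assumes f: "f \<in> hardy2" and u: "L2_boundary f u" and z: "Im z > 0"
  shows "(LINT s|lborel. u s / (complex_of_real s - z)) = 2 * pi * \<i> * f z"
proof -
  have [measurable]: "u \<in> borel_measurable borel" using u by (simp add: L2_boundary_def)
  have "(\<lambda>n. LINT s|lborel. f (Complex s (1 / real (Suc n))) * (1 / (complex_of_real s - z))) \<longlonglongrightarrow> (LINT s|lborel. u s * (1 / (complex_of_real s - z)))"
  proof (rule L2sq_tendsto_integral_mult[where b="\<lambda>_ s. 1 / (complex_of_real s - z)", OF _ _ _ _ _ _ L2_boundary_sequence[OF u]])
    show "(\<lambda>s. f (Complex s (1 / real (Suc n)))) \<in> borel_measurable lborel" for n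
      using hardy2_measurable_line[OF f, of "1 / real (Suc n)"] by simp
    show "L2sq lborel u < \<infinity>" using u by (simp add: L2_boundary_def)
    show "L2sq lborel (\<lambda>s. 1 / (complex_of_real s - z)) < \<infinity>" using z by (simp add: L2sq_cauchy_kernel)
  qed (simp_all add: L2sq_def)
  moreover have "(LINT s|lborel. f (Complex s (1 / real (Suc n))) * (1 / (complex_of_real s - z))) = 2 * pi * \<i> * f (z + \<i> * complex_of_real (1 / real (Suc n)))" for n
    using hardy2_cauchy[OF f _ z, of "1 / real (Suc n)"] by simp
  moreover have "(\<lambda>n. 2 * pi * \<i> * f (z + \<i> * complex_of_real (1 / real (Suc n)))) \<longlonglongrightarrow> 2 * pi * \<i> * f z"
    by (intro tendsto_intros hardy2_shift_tendsto f z)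
  ultimately show ?thesis by (simp add: LIMSEQ_unique)
qed

lemma norm_of_real_minus_le:
  assumes "Im z > 0"
  shows "Im z \<le> norm (complex_of_real s - z)"
  using abs_Im_le_cmod[of "complex_of_real s - z"] assms by simp

lemma poisson_kernel_L2sq:
  assumes z: "Im z > 0"
  shows "L2sq lborel (\<lambda>s. 1 / complex_of_real ((norm (complex_of_real s - z))\<^sup>2)) < \<infinity>"
proof -
  have "L2sq lborel (\<lambda>s. 1 / complex_of_real ((norm (complex_of_real s - z))\<^sup>2)) \<le> L2sq lborel (\<lambda>s. complex_of_real (1 / Im z) * (1 / (complex_of_real s - z)))"
  proof (rule L2sq_mono_AE, rule AE_I2)
    fix s
    have "Im z \<le> norm (complex_of_real s - z)" by (rule norm_of_real_minus_le[OF z])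
    then have "Im z * norm (complex_of_real s - z) \<le> (norm (complex_of_real s - z))\<^sup>2"
      unfolding power2_eq_square by (intro mult_right_mono) auto
    moreover have "norm (complex_of_real s - z) > 0" using norm_of_real_minus_le[OF z, of s] z by linarith
    ultimately have "1 / (norm (complex_of_real s - z))\<^sup>2 \<le> 1 / (Im z * norm (complex_of_real s - z))"
      using z by (intro divide_left_mono mult_pos_pos) auto
    then show "norm (1 / complex_of_real ((norm (complex_of_real s - z))\<^sup>2)) \<le> norm (complex_of_real (1 / Im z) * (1 / (complex_of_real s - z)))"
      using z by (simp add: norm_divide norm_mult norm_power)
  qed
  also have "\<dots> = ennreal ((norm (complex_of_real (1 / Im z)))\<^sup>2) * ennreal (pi / \<bar>Im z\<bar>)"
    using z by (subst L2sq_cmult) (auto simp: L2sq_cauchy_kernel)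
  also have "\<dots> < \<infinity>" by (simp add: ennreal_mult_less_top)
  finally show ?thesis .
qed

lemma L2_boundary_poisson:
  fixes f :: "complex \<Rightarrow> complex"
  assumes f: "f \<in> hardy2" and u: "L2_boundary f u" and z: "Im z > 0"
  shows "(LINT s|lborel. u s / complex_of_real ((norm (complex_of_real s - z))\<^sup>2)) = pi / Im z * f z"
proof -
  have [measurable]: "u \<in> borel_measurable borel" using u by (simp add: L2_boundary_def)
  let ?P = "\<lambda>s. 1 / complex_of_real ((norm (complex_of_real s - z))\<^sup>2)"
  have "(\<lambda>n. LINT s|lborel. f (Complex s (1 / real (Suc n))) * ?P s) \<longlonglongrightarrow> (LINT s|lborel. u s * ?P s)"
  proof (rule L2sq_tendsto_integral_mult[where b="\<lambda>_ s. ?P s", OF _ _ _ _ _ _ L2_boundary_sequence[OF u]])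
    show "(\<lambda>s. f (Complex s (1 / real (Suc n)))) \<in> borel_measurable lborel" for n
      using hardy2_measurable_line[OF f, of "1 / real (Suc n)"] by simp
    show "L2sq lborel u < \<infinity>" using u by (simp add: L2_boundary_def)
    show "L2sq lborel ?P < \<infinity>" by (rule poisson_kernel_L2sq[OF z])
  qed (simp_all add: L2sq_def)
  moreover have "(LINT s|lborel. f (Complex s (1 / real (Suc n))) * ?P s) = pi / Im z * f (z + \<i> * complex_of_real (1 / real (Suc n)))" for n
    using hardy2_poisson[OF f _ z, of "1 / real (Suc n)"] by simp
  moreover have "(\<lambda>n. pi / Im z * f (z + \<i> * complex_of_real (1 / real (Suc n)))) \<longlonglongrightarrow> pi / Im z * f z"
    by (intro tendsto_intros hardy2_shift_tendsto f z)
  ultimately show ?thesis by (simp add: LIMSEQ_unique)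
qed

text \<open>The function \<open>w \<mapsto> cnj (q (- cnj w))\<close> is again analytic in the half
  plane and equals \<open>cnj (uq (- s))\<close> on its boundary. Its product with \<open>g\<close>
  and with \<open>2 w / (w + \<i> \<kappa>)\<close> is therefore analytic, and the Poisson formula
  at \<open>\<i> \<kappa>\<close> evaluates it, because
  \<open>- cnj (\<i> \<kappa>) = \<i> \<kappa>\<close> and the last factor is 1 there. At height
  \<epsilon> the product is bounded; the boundary case follows by \<open>L\<^sup>2\<close> limits in
  both factors.\<close>

lemma L2_boundary_product:
  fixes q g :: "complex \<Rightarrow> complex" and uq ug :: "real \<Rightarrow> complex"
  assumes q: "q \<in> hardy2" "L2_boundary q uq" and g: "g \<in> hardy2" "L2_boundary g ug" and \<kappa>: "\<kappa> > 0"
  shows "(LINT s|lborel. cnj (uq (- s)) * (ug s * (2 * complex_of_real s / (complex_of_real s + \<i> * complex_of_real \<kappa>) / complex_of_real (s\<^sup>2 + \<kappa>\<^sup>2))))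
    = pi / \<kappa> * (cnj (q (\<i> * complex_of_real \<kappa>)) * g (\<i> * complex_of_real \<kappa>))"
proof -
  define z where "z = \<i> * complex_of_real \<kappa>"
  have z: "Im z = \<kappa>" "Re z = 0" by (simp_all add: z_def)
  \<comment> \<open>The analytic factor times the Poisson denominator at
    \<open>\<i> \<kappa>\<close>. It is bounded, so multiplying \<open>g\<close> by it preserves
    \<open>L\<^sup>2\<close> convergence.\<close>
  define kk where "kk s = 2 * complex_of_real s / (complex_of_real s + z) / complex_of_real (s\<^sup>2 + \<kappa>\<^sup>2)" for s
  have [measurable]: "uq \<in> borel_measurable borel" "ug \<in> borel_measurable borel"
    using q g by (auto simp: L2_boundary_def)
  have [measurable]: "kk \<in> borel_measurable borel" unfolding kk_def by measurable
  have kk: "norm (kk s) \<le> 2 / \<kappa>\<^sup>2" for s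
  proof -
    have "s\<^sup>2 \<le> (norm (complex_of_real s + z))\<^sup>2" by (simp add: cmod_power2 z)
    then have "\<bar>s\<bar> \<le> norm (complex_of_real s + z)" by (rule power2_le_imp_le[of "\<bar>s\<bar>", simplified]) simp
    then have "norm (2 * complex_of_real s / (complex_of_real s + z)) \<le> 2"
      by (simp add: norm_divide norm_mult divide_le_eq)
    moreover have "\<kappa>\<^sup>2 \<le> norm (complex_of_real (s\<^sup>2 + \<kappa>\<^sup>2))" unfolding norm_of_real by simp
    ultimately show ?thesis unfolding kk_def norm_divide[of "2 * complex_of_real s / (complex_of_real s + z)"]
      using \<kappa> by (intro frac_le) auto
  qed
  define \<epsilon> where "\<epsilon> n = 1 / real (Suc n)" for n
  have \<epsilon>: "\<epsilon> n > 0" for n by (simp add: \<epsilon>_def)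
  have level: "(LINT s|lborel. cnj (q (Complex (- s) (\<epsilon> n))) * (g (Complex s (\<epsilon> n)) * kk s))
      = pi / \<kappa> * (cnj (q (z + \<i> * \<epsilon> n)) * g (z + \<i> * \<epsilon> n))" for n
  proof -
    obtain B1 where B1: "B1 \<ge> 0" "\<And>w. -\<epsilon> n / 2 < Im w \<Longrightarrow> norm (q (w + \<i> * complex_of_real (\<epsilon> n))) \<le> B1"
      using hardy2_shift_bounded[OF q(1) \<epsilon>] by blast
    obtain B2 where B2: "B2 \<ge> 0" "\<And>w. -\<epsilon> n / 2 < Im w \<Longrightarrow> norm (g (w + \<i> * complex_of_real (\<epsilon> n))) \<le> B2"
      using hardy2_shift_bounded[OF g(1) \<epsilon>] by blast
    \<comment> \<open>The half-widths leave room on both sides: the translates stay bounded, and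
      \<open>w + z\<close> stays away from its zero at height \<open>- \<kappa>\<close>.\<close>
    define \<delta> where "\<delta> = min (\<epsilon> n / 2) (\<kappa> / 2)"
    have \<delta>: "\<delta> > 0" "\<delta> \<le> \<epsilon> n / 2" "\<delta> \<le> \<kappa> / 2" using \<epsilon> \<kappa> by (auto simp: \<delta>_def)
    let ?S = "{w. - \<delta> < Im w}"
    have opS: "open ?S" by (intro open_Collect_less continuous_intros)
    define G where "G w = (cnj \<circ> (\<lambda>v. q (- v + \<i> * complex_of_real (\<epsilon> n))) \<circ> cnj) w * (g (w + \<i> * complex_of_real (\<epsilon> n)) * (2 * w / (w + z)))" for w
    have wz: "Im (w + z) > \<kappa> / 2" if "- \<delta> < Im w" for w using that \<delta> z by simp
    have wz0: "w + z \<noteq> 0" if "w \<in> ?S" for w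
    proof
      assume "w + z = 0"
      then have "Im (w + z) = 0" by simp
      then show False using wz[of w] that \<kappa> by simp
    qed
    have "(\<lambda>v. q (- v + \<i> * complex_of_real (\<epsilon> n))) holomorphic_on cnj ` ?S"
    proof -
      have "((\<lambda>w. q (w + \<i> * complex_of_real (\<epsilon> n))) \<circ> uminus) holomorphic_on cnj ` ?S"
        by (rule holomorphic_on_compose_gen[OF _ hardy2_shift_holomorphic[OF q(1)]])
          (use \<delta> in \<open>auto intro!: holomorphic_intros\<close>)
      then show ?thesis by (simp add: o_def)
    qed
    then have "(cnj \<circ> (\<lambda>v. q (- v + \<i> * complex_of_real (\<epsilon> n))) \<circ> cnj) holomorphic_on ?S"
      by (rule holomorphic_on_compose_cnj_cnj) (rule opS)
    moreover have "(\<lambda>w. g (w + \<i> * complex_of_real (\<epsilon> n))) holomorphic_on ?S"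
      by (rule holomorphic_on_subset[OF hardy2_shift_holomorphic[OF g(1)]]) (use \<delta> in auto)
    ultimately have holG: "G holomorphic_on ?S" unfolding G_def
      by (intro holomorphic_intros wz0)
    \<comment> \<open>The 6 is \<open>2 * 3\<close>: from
      \<open>|w| \<le> |w + z| + \<kappa>\<close> and \<open>|w + z| \<ge> \<kappa> / 2\<close> the
      quotient \<open>|w| / |w + z|\<close> is at most 3.\<close>
    have bddG: "norm (G w) \<le> B1 * (B2 * 6)" if w: "- \<delta> < Im w" for w
    proof -
      have "norm (w + z) \<ge> \<kappa> / 2" using abs_Im_le_cmod[of "w + z"] wz[OF w] by linarith
      moreover have "norm w \<le> norm (w + z) + \<kappa>"
        using norm_triangle_ineq4[of "w + z" z] \<kappa> by (simp add: z_def norm_mult)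
      ultimately have "norm (2 * w / (w + z)) \<le> 6"
        using \<kappa> by (simp add: norm_divide norm_mult divide_le_eq)
      moreover have "norm (cnj (q (- cnj w + \<i> * complex_of_real (\<epsilon> n)))) \<le> B1"
        unfolding complex_mod_cnj by (rule B1(2)) (use w \<delta> in simp)
      moreover have "norm (g (w + \<i> * complex_of_real (\<epsilon> n))) \<le> B2"
        by (rule B2(2)) (use w \<delta> in simp)
      ultimately show ?thesis unfolding G_def norm_mult o_def
        using B1(1) B2(1) by (intro mult_mono mult_nonneg_nonneg norm_ge_zero)
    qed
    have "(LINT s|lborel. G (complex_of_real s) / complex_of_real ((norm (complex_of_real s - z))\<^sup>2)) = pi / Im z * G z"
      by (rule poisson_bounded[OF \<delta>(1) holG bddG]) (simp_all add: z \<kappa>)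
    moreover have "G (complex_of_real s) / complex_of_real ((norm (complex_of_real s - z))\<^sup>2)
        = cnj (q (Complex (- s) (\<epsilon> n))) * (g (Complex s (\<epsilon> n)) * kk s)" for s
    proof -
      have "- cnj (complex_of_real s) + \<i> * complex_of_real (\<epsilon> n) = Complex (- s) (\<epsilon> n)"
        "complex_of_real s + \<i> * complex_of_real (\<epsilon> n) = Complex s (\<epsilon> n)" by (simp_all add: complex_eq_iff)
      moreover have "(norm (complex_of_real s - z))\<^sup>2 = s\<^sup>2 + \<kappa>\<^sup>2" by (simp add: cmod_power2 z)
      ultimately show ?thesis by (simp add: G_def kk_def)
    qed
    moreover have "G z = cnj (q (z + \<i> * \<epsilon> n)) * g (z + \<i> * \<epsilon> n)"
    proof -
      have z': "- cnj z = z" "z + z \<noteq> 0" using \<kappa> by (simp_all add: z_def)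
      then have "2 * z / (z + z) = 1" by simp
      then show ?thesis by (simp only: G_def o_def z' mult_1_right)
    qed
    ultimately show ?thesis by (simp add: z)
  qed
  have "(\<lambda>n. LINT s|lborel. cnj (q (Complex (- s) (\<epsilon> n))) * (g (Complex s (\<epsilon> n)) * kk s)) \<longlonglongrightarrow>
      (LINT s|lborel. cnj (uq (- s)) * (ug s * kk s))"
  proof (rule L2sq_tendsto_integral_mult)
    have qm[measurable]: "(\<lambda>s. q (Complex s (\<epsilon> n))) \<in> borel_measurable borel" for n by (rule hardy2_measurable_line[OF q(1) \<epsilon>])
    have [measurable]: "(\<lambda>s. q (Complex (- s) (\<epsilon> n))) \<in> borel_measurable borel" for n
      using measurable_compose[OF borel_measurable_uminus[OF measurable_ident_sets[OF refl]] qm] by simp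
    show "(\<lambda>s. cnj (q (Complex (- s) (\<epsilon> n)))) \<in> borel_measurable lborel" for n by measurable
    have gm[measurable]: "(\<lambda>s. g (Complex s (\<epsilon> n))) \<in> borel_measurable borel" for n by (rule hardy2_measurable_line[OF g(1) \<epsilon>])
    show "(\<lambda>s. g (Complex s (\<epsilon> n)) * kk s) \<in> borel_measurable lborel" for n by measurable
    show "(\<lambda>s. cnj (uq (- s))) \<in> borel_measurable lborel" "(\<lambda>s. ug s * kk s) \<in> borel_measurable lborel" by measurable
    have mult_kk: "L2sq lborel (\<lambda>s. h s * kk s) \<le> ennreal ((2 / \<kappa>\<^sup>2)\<^sup>2) * L2sq lborel h" if [measurable]: "h \<in> borel_measurable borel" for h
    proof -
      have "L2sq lborel (\<lambda>s. h s * kk s) \<le> L2sq lborel (\<lambda>s. complex_of_real (2 / \<kappa>\<^sup>2) * h s)"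
      proof (rule L2sq_mono_AE, rule AE_I2)
        fix s
        have "norm (h s) * norm (kk s) \<le> norm (h s) * (2 / \<kappa>\<^sup>2)" by (intro mult_left_mono kk) simp
        then show "norm (h s * kk s) \<le> norm (complex_of_real (2 / \<kappa>\<^sup>2) * h s)"
          by (simp add: norm_mult norm_divide norm_power mult.commute)
      qed
      also have "\<dots> = ennreal ((2 / \<kappa>\<^sup>2)\<^sup>2) * L2sq lborel h"
        by (subst L2sq_cmult) (auto simp: norm_divide norm_power)
      finally show ?thesis .
    qed
    show "L2sq lborel (\<lambda>s. cnj (uq (- s))) < \<infinity>"
      using L2sq_reflect[of uq] q by (simp add: L2_boundary_def L2sq_def)
    show "L2sq lborel (\<lambda>s. ug s * kk s) < \<infinity>"
      using mult_kk[of ug] g by (auto simp: L2_boundary_def ennreal_mult_less_top intro: le_less_trans)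
    have "L2sq lborel (\<lambda>s. cnj (q (Complex (- s) (\<epsilon> n))) - cnj (uq (- s))) = L2sq lborel (\<lambda>s. q (Complex s (\<epsilon> n)) - uq s)" for n
    proof -
      have "L2sq lborel (\<lambda>s. cnj (q (Complex (- s) (\<epsilon> n))) - cnj (uq (- s))) = L2sq lborel (\<lambda>s. q (Complex (- s) (\<epsilon> n)) - uq (- s))"
        unfolding L2sq_def by (simp add: complex_cnj_diff[symmetric] del: complex_cnj_diff)
      also have "\<dots> = L2sq lborel (\<lambda>s. q (Complex s (\<epsilon> n)) - uq s)"
        by (rule L2sq_reflect) measurable
      finally show ?thesis .
    qed
    then show "(\<lambda>n. L2sq lborel (\<lambda>s. cnj (q (Complex (- s) (\<epsilon> n))) - cnj (uq (- s)))) \<longlonglongrightarrow> 0"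
      using L2_boundary_sequence[OF q(2)] by (simp add: \<epsilon>_def)
    have up: "L2sq lborel (\<lambda>s. g (Complex s (\<epsilon> n)) * kk s - ug s * kk s) \<le> ennreal ((2 / \<kappa>\<^sup>2)\<^sup>2) * L2sq lborel (\<lambda>s. g (Complex s (\<epsilon> n)) - ug s)" for n
      using mult_kk[of "\<lambda>s. g (Complex s (\<epsilon> n)) - ug s"] by (simp add: left_diff_distrib)
    have "(\<lambda>n. ennreal ((2 / \<kappa>\<^sup>2)\<^sup>2) * L2sq lborel (\<lambda>s. g (Complex s (\<epsilon> n)) - ug s)) \<longlonglongrightarrow> ennreal ((2 / \<kappa>\<^sup>2)\<^sup>2) * 0"
      using L2_boundary_sequence[OF g(2)] by (intro ennreal_tendsto_cmult) (auto simp: \<epsilon>_def)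
    then have lim0: "(\<lambda>n. ennreal ((2 / \<kappa>\<^sup>2)\<^sup>2) * L2sq lborel (\<lambda>s. g (Complex s (\<epsilon> n)) - ug s)) \<longlonglongrightarrow> 0" by simp
    show "(\<lambda>n. L2sq lborel (\<lambda>s. g (Complex s (\<epsilon> n)) * kk s - ug s * kk s)) \<longlonglongrightarrow> 0"
      by (rule tendsto_sandwich[OF always_eventually always_eventually tendsto_const lim0]) (simp_all add: up)
  qed
  moreover have "(\<lambda>n. pi / \<kappa> * (cnj (q (z + \<i> * \<epsilon> n)) * g (z + \<i> * \<epsilon> n))) \<longlonglongrightarrow> pi / \<kappa> * (cnj (q z) * g z)"
    unfolding \<epsilon>_def by (intro tendsto_intros hardy2_shift_tendsto q g) (simp_all add: z \<kappa>)
  ultimately have "(LINT s|lborel. cnj (uq (- s)) * (ug s * kk s)) = pi / \<kappa> * (cnj (q z) * g z)"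
    unfolding level by (rule LIMSEQ_unique)
  then show ?thesis unfolding kk_def z_def .
qed

section \<open>From the boundary function in the mean to non-tangential limits\<close>

lemma ennreal_power2_le_imp_le:
  assumes "X\<^sup>2 \<le> ennreal (p\<^sup>2)" "p \<ge> 0"
  shows "X \<le> ennreal p"
proof (cases X)
  case (real r)
  then have "ennreal (r\<^sup>2) \<le> ennreal (p\<^sup>2)" using assms by (simp add: ennreal_power)
  then have "r\<^sup>2 \<le> p\<^sup>2" by simp
  then have "r \<le> p" using assms(2) by (rule power2_le_imp_le)
  then show ?thesis using real by (simp add: ennreal_leI)
next
  case top
  then show ?thesis using assms by (simp add: top_unique power2_eq_square ennreal_mult_top)
qed

lemma cone_kernel_le:
  assumes z: "Im z > 0" "\<bar>Re z - x\<bar> < a * Im z"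
  shows "\<bar>s - x\<bar> + Im z \<le> (2 + a) * norm (complex_of_real s - z)"
proof -
  have y: "Im z \<le> norm (complex_of_real s - z)" by (rule norm_of_real_minus_le[OF z(1)])
  have r: "\<bar>s - Re z\<bar> \<le> norm (complex_of_real s - z)" using abs_Re_le_cmod[of "complex_of_real s - z"] by simp
  have a: "a \<ge> 0" using z by (smt (verit) mult_nonpos_nonneg)
  have "a * Im z \<le> a * norm (complex_of_real s - z)" using y a by (rule mult_left_mono)
  then show ?thesis using z(2) y r by (simp add: algebra_simps)
qed

text \<open>The hypothesis \<open>max\<close> says that the measure \<open>|v| ds\<close> has linear
  growth around \<open>x\<close>, so \<open>linear_growth_poisson_kernel\<close> applies with
  \<open>\<tau> s = |s - x|\<close>. Moving \<open>z\<close> off the vertical axis of the cone costs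
  the factor \<open>(2 + a)^2\<close>.\<close>

lemma poisson_integral_cone_bound:
  fixes v :: "real \<Rightarrow> complex"
  assumes v[measurable]: "v \<in> borel_measurable borel" and C: "C \<ge> 0"
    and max: "\<And>r. r > 0 \<Longrightarrow> (\<integral>\<^sup>+s. ennreal (norm (v s)) * indicator (cball x r) s \<partial>lborel) \<le> ennreal (C * r)"
    and z: "Im z > 0" "\<bar>Re z - x\<bar> < a * Im z"
  shows "Im z * norm (LINT s|lborel. v s / complex_of_real ((norm (complex_of_real s - z))\<^sup>2)) \<le> (2 + a)\<^sup>2 * (2 * C)"
proof -
  define N where "N = density lborel (\<lambda>s. ennreal (norm (v s)))"
  have sf: "sigma_finite_measure N"
    unfolding N_def by (subst sigma_finite_measure.sigma_finite_iff_density_finite[OF lborel.sigma_finite_measure_axioms]) auto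
  have growth: "emeasure N {s \<in> space N. \<bar>s - x\<bar> \<le> r} \<le> ennreal (C * r)" for r
  proof -
    have "{s \<in> space N. \<bar>s - x\<bar> \<le> r} = cball x r" by (auto simp: N_def dist_real_def)
    then have e: "emeasure N {s \<in> space N. \<bar>s - x\<bar> \<le> r} = (\<integral>\<^sup>+s. ennreal (norm (v s)) * indicator (cball x r) s \<partial>lborel)"
      unfolding N_def by (subst emeasure_density) auto
    consider "r > 0" | "r = 0" | "r < 0" by linarith
    then show ?thesis
    proof cases
      case 1 then show ?thesis using max e by simp
    next
      case 2
      have "(\<integral>\<^sup>+s. ennreal (norm (v s)) * indicator {x} s \<partial>lborel) = 0"
      proof (subst nn_integral_0_iff_AE)
        show "AE s in lborel. ennreal (norm (v s)) * indicator {x} s = 0"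
          using AE_lborel_singleton[of x] by eventually_elim simp
      qed measurable
      then show ?thesis using e 2 by simp
    next
      case 3 then show ?thesis using e by (simp add: cball_empty)
    qed
  qed
  have a: "2 + a > 0" using z by (smt (verit) mult_nonpos_nonneg)
  have "ennreal (norm (LINT s|lborel. v s / complex_of_real ((norm (complex_of_real s - z))\<^sup>2)))
    \<le> (\<integral>\<^sup>+s. ennreal (norm (v s / complex_of_real ((norm (complex_of_real s - z))\<^sup>2))) \<partial>lborel)"
  \<comment> \<open>For a non-integrable integrand the integral is 0 by convention, so the bound
    holds in either case.\<close>
  proof (cases "integrable lborel (\<lambda>s. v s / complex_of_real ((norm (complex_of_real s - z))\<^sup>2))")
    case True then show ?thesis by (rule integral_norm_bound_ennreal)
  qed (simp add: not_integrable_integral_eq)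
  also have "\<dots> \<le> (\<integral>\<^sup>+s. ennreal ((2 + a)\<^sup>2 / Im z) * (ennreal (norm (v s)) * ennreal (Im z / (\<bar>s - x\<bar> + Im z)\<^sup>2)) \<partial>lborel)"
  proof (rule nn_integral_mono)
    fix s
    have n: "norm (complex_of_real s - z) > 0" using norm_of_real_minus_le[OF z(1), of s] z by linarith
    have d: "\<bar>s - x\<bar> + Im z > 0" using z by linarith
    have "(\<bar>s - x\<bar> + Im z)\<^sup>2 \<le> ((2 + a) * norm (complex_of_real s - z))\<^sup>2"
      using cone_kernel_le[OF z] d by (intro power_mono) auto
    then have "1 / (norm (complex_of_real s - z))\<^sup>2 \<le> (2 + a)\<^sup>2 / (\<bar>s - x\<bar> + Im z)\<^sup>2"
      using n d by (simp add: divide_simps power_mult_distrib)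
    then have "norm (v s) * (1 / (norm (complex_of_real s - z))\<^sup>2) \<le> norm (v s) * ((2 + a)\<^sup>2 / (\<bar>s - x\<bar> + Im z)\<^sup>2)"
      by (rule mult_left_mono) simp
    also have "\<dots> = (2 + a)\<^sup>2 / Im z * (norm (v s) * (Im z / (\<bar>s - x\<bar> + Im z)\<^sup>2))"
      using z by simp
    finally have "norm (v s / complex_of_real ((norm (complex_of_real s - z))\<^sup>2)) \<le> (2 + a)\<^sup>2 / Im z * (norm (v s) * (Im z / (\<bar>s - x\<bar> + Im z)\<^sup>2))"
      by (simp add: norm_divide norm_power)
    then have "ennreal (norm (v s / complex_of_real ((norm (complex_of_real s - z))\<^sup>2))) \<le> ennreal ((2 + a)\<^sup>2 / Im z * (norm (v s) * (Im z / (\<bar>s - x\<bar> + Im z)\<^sup>2)))"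
      by (rule ennreal_leI)
    also have "\<dots> = ennreal ((2 + a)\<^sup>2 / Im z) * (ennreal (norm (v s)) * ennreal (Im z / (\<bar>s - x\<bar> + Im z)\<^sup>2))"
      using z d by (subst ennreal_mult, simp, simp, subst ennreal_mult) auto
    finally show "ennreal (norm (v s / complex_of_real ((norm (complex_of_real s - z))\<^sup>2))) \<le> \<dots>" .
  qed
  also have "\<dots> = ennreal ((2 + a)\<^sup>2 / Im z) * (\<integral>\<^sup>+s. ennreal (norm (v s)) * ennreal (Im z / (\<bar>s - x\<bar> + Im z)\<^sup>2) \<partial>lborel)"
    by (rule nn_integral_cmult) measurable
  also have "(\<integral>\<^sup>+s. ennreal (norm (v s)) * ennreal (Im z / (\<bar>s - x\<bar> + Im z)\<^sup>2) \<partial>lborel) = (\<integral>\<^sup>+s. ennreal (Im z / (\<bar>s - x\<bar> + Im z)\<^sup>2) \<partial>N)"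
    unfolding N_def by (subst nn_integral_density) auto
  also have "ennreal ((2 + a)\<^sup>2 / Im z) * \<dots> \<le> ennreal ((2 + a)\<^sup>2 / Im z) * ennreal (2 * C)"
    by (intro mult_left_mono linear_growth_poisson_kernel[OF sf _ _ growth C z(1)]) (auto simp: N_def)
  also have "\<dots> = ennreal ((2 + a)\<^sup>2 / Im z * (2 * C))" using z C by (simp add: ennreal_mult[symmetric])
  finally have "norm (LINT s|lborel. v s / complex_of_real ((norm (complex_of_real s - z))\<^sup>2)) \<le> (2 + a)\<^sup>2 / Im z * (2 * C)"
    using z C by (subst (asm) ennreal_le_iff) auto
  then have "Im z * norm (LINT s|lborel. v s / complex_of_real ((norm (complex_of_real s - z))\<^sup>2)) \<le> Im z * ((2 + a)\<^sup>2 / Im z * (2 * C))"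
    using z by (intro mult_left_mono) auto
  then show ?thesis using z by simp
qed

lemma has_nontangential_limit_unique:
  assumes l: "has_nontangential_limit f x l" and l': "has_nontangential_limit f x l'"
  shows "l = l'"
proof -
  let ?S = "{z \<in> upper_half_plane. \<bar>Re z - x\<bar> < 1 * Im z}"
  have "complex_of_real x islimpt ?S"
    unfolding islimpt_approachable
  proof (intro allI impI)
    fix e :: real assume e: "e > 0"
    then have "Complex x (e / 2) \<in> ?S" "Complex x (e / 2) \<noteq> complex_of_real x"
      by (auto simp: upper_half_plane_def complex_eq_iff)
    moreover have "dist (Complex x (e / 2)) (complex_of_real x) < e"
    proof -
      have "Complex x (e / 2) - complex_of_real x = Complex 0 (e / 2)" by (simp add: complex_eq_iff)
      then show ?thesis using e by (simp add: dist_norm complex_norm)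
    qed
    ultimately show "\<exists>x'\<in>?S. x' \<noteq> complex_of_real x \<and> dist x' (complex_of_real x) < e" by blast
  qed
  then have "\<not> trivial_limit (at (complex_of_real x) within ?S)" by (simp add: trivial_limit_within)
  moreover have "(f \<longlongrightarrow> l) (at (complex_of_real x) within ?S)" "(f \<longlongrightarrow> l') (at (complex_of_real x) within ?S)"
    using l l' zero_less_one unfolding has_nontangential_limit_def by blast+
  ultimately show ?thesis by (rule tendsto_unique)
qed

lemma boundary_value_eqI: "has_nontangential_limit f x l \<Longrightarrow> boundary_value f x = l"
  unfolding boundary_value_def using has_nontangential_limit_unique by (metis the_equality)

text \<open>The weak type inequality is applied to \<open>|v|^2\<close>, the integrable quantity,
  while the bound on cones asks for \<open>|v|\<close>. Cauchy-Schwarz on a ball of length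
  \<open>2 * r\<close> connects the two.\<close>

lemma cball_mean_le:
  fixes v :: "real \<Rightarrow> complex"
  assumes [measurable]: "v \<in> borel_measurable borel" and c: "c \<ge> 0" and r: "r > 0"
    and sq: "(\<integral>\<^sup>+s. ennreal ((norm (v s))\<^sup>2) * indicator (cball x r) s \<partial>lborel) \<le> ennreal (c * r)"
  shows "(\<integral>\<^sup>+s. ennreal (norm (v s)) * indicator (cball x r) s \<partial>lborel) \<le> ennreal (sqrt (2 * c) * r)"
proof (rule ennreal_power2_le_imp_le)
  let ?v = "\<lambda>s. ennreal (norm (v s)) * indicator (cball x r) s"
  have [measurable]: "cball x r \<in> sets borel" by simp
  have "(\<integral>\<^sup>+s. ?v s \<partial>lborel)\<^sup>2 = (\<integral>\<^sup>+s. ?v s * indicator (cball x r) s \<partial>lborel)\<^sup>2"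
    by (intro arg_cong[where f="\<lambda>t. t\<^sup>2"] nn_integral_cong) (simp split: split_indicator)
  also have "\<dots> \<le> (\<integral>\<^sup>+s. (?v s)\<^sup>2 \<partial>lborel) * (\<integral>\<^sup>+s. (indicator (cball x r) s)\<^sup>2 \<partial>lborel)"
    by (rule Cauchy_Schwarz_nn_integral) measurable
  also have "(\<integral>\<^sup>+s. (?v s)\<^sup>2 \<partial>lborel) = (\<integral>\<^sup>+s. ennreal ((norm (v s))\<^sup>2) * indicator (cball x r) s \<partial>lborel)"
    by (intro nn_integral_cong) (simp add: ennreal_power split: split_indicator)
  also have "(\<integral>\<^sup>+s. (indicator (cball x r) s :: ennreal)\<^sup>2 \<partial>lborel) = (\<integral>\<^sup>+s. indicator (cball x r) s \<partial>lborel)"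
    by (intro nn_integral_cong) (simp split: split_indicator)
  also have "\<dots> = ennreal (2 * r)"
    using r by (simp add: cball_eq_atLeastAtMost)
  also have "(\<integral>\<^sup>+s. ennreal ((norm (v s))\<^sup>2) * indicator (cball x r) s \<partial>lborel) * ennreal (2 * r) \<le> ennreal (c * r) * ennreal (2 * r)"
    by (intro mult_right_mono sq) simp
  also have "\<dots> = ennreal ((sqrt (2 * c) * r)\<^sup>2)"
    using c r by (simp add: ennreal_mult[symmetric] power_mult_distrib) (simp add: power2_eq_square mult_ac)
  finally show "(\<integral>\<^sup>+s. ?v s \<partial>lborel)\<^sup>2 \<le> ennreal ((sqrt (2 * c) * r)\<^sup>2)" .
qed (use c r in simp)

text \<open>\<open>f z - f (z + \<i> \<epsilon>)\<close> is the Poisson integral of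
  \<open>v = u - f (_ + \<i> \<epsilon>)\<close>, which is small in \<open>L\<^sup>2\<close>. Each
  \<eta> has its own source: off \<open>U\<close> the maximal function controls this difference on
  the whole cone, continuity at height \<epsilon> controls the translate, and off \<open>V\<close>
  the value \<open>v x\<close> itself is small. Both exceptional sets shrink with the norm of
  \<open>v\<close>.\<close>

lemma hardy2_cone_oscillation_null:
  fixes f :: "complex \<Rightarrow> complex"
  assumes f: "f \<in> hardy2" and u: "L2_boundary f u" and a: "a > 0" and \<eta>: "\<eta> > 0"
  defines "wedge \<equiv> \<lambda>x. {z \<in> upper_half_plane. \<bar>Re z - x\<bar> < a * Im z}"
  shows "\<exists>N\<in>null_sets lborel.
    {x. \<not> (\<forall>\<^sub>F z in at (complex_of_real x) within wedge x. norm (f z - u x) \<le> 3 * \<eta>)} \<subseteq> N"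
proof (rule null_set_of_small_covers)
  fix e :: real assume e: "e > 0"
  have um[measurable]: "u \<in> borel_measurable borel" and ufin: "L2sq lborel u < \<infinity>"
    using u by (simp_all add: L2_boundary_def)
  \<comment> \<open>Solves \<open>(2 + a)^2 * (2 * sqrt (2 * c)) = pi * \<eta>\<close>: the left
    side is the bound on cones, and pi comes from the normalisation of the Poisson integral.\<close>
  define c where "c = (pi * \<eta> / (2 * (2 + a)\<^sup>2))\<^sup>2 / 2"
  have a2: "(2 + a)\<^sup>2 > 0" using a by simp
  have c: "c > 0" using \<eta> a2 by (simp add: c_def)
  have sqrtc: "(2 + a)\<^sup>2 * (2 * sqrt (2 * c)) = pi * \<eta>"
  proof -
    have "sqrt (2 * c) = pi * \<eta> / (2 * (2 + a)\<^sup>2)" using \<eta> a2 by (simp add: c_def)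
    then show ?thesis using a2 by simp
  qed
  \<comment> \<open>Chosen so that the measure bounds \<open>10 * d / c\<close> for \<open>U\<close>
    and \<open>d / \<eta>^2\<close> for \<open>V\<close> add up to \<open>e\<close>.\<close>
  define d where "d = e / (10 / c + 1 / \<eta>\<^sup>2)"
  have den: "10 / c + 1 / \<eta>\<^sup>2 > 0" using c \<eta> by (intro add_pos_pos) auto
  have d: "d > 0" using e den by (simp add: d_def)
  have de: "10 * d / c + d / \<eta>\<^sup>2 = e"
  proof -
    have "10 * d / c + d / \<eta>\<^sup>2 = d * (10 / c + 1 / \<eta>\<^sup>2)" by (simp add: algebra_simps)
    then show ?thesis using den by (simp add: d_def)
  qed
  have "\<forall>\<^sub>F n in sequentially. L2sq lborel (\<lambda>x. f (Complex x (1 / real (Suc n))) - u x) < ennreal d"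
    using L2_boundary_sequence[OF u] d by (intro order_tendstoD(2)) auto
  then obtain n where n: "L2sq lborel (\<lambda>x. f (Complex x (1 / real (Suc n))) - u x) < ennreal d"
    by (auto simp: eventually_sequentially)
  define \<epsilon> where "\<epsilon> = 1 / real (Suc n)"
  have \<epsilon>: "\<epsilon> > 0" by (simp add: \<epsilon>_def)
  have fm[measurable]: "(\<lambda>x. f (Complex x \<epsilon>)) \<in> borel_measurable borel" by (rule hardy2_measurable_line[OF f \<epsilon>])
  define v where "v s = u s - f (Complex s \<epsilon>)" for s
  have vm[measurable]: "v \<in> borel_measurable borel" unfolding v_def by measurable
  have vd: "(\<integral>\<^sup>+s. ennreal ((norm (v s))\<^sup>2) \<partial>lborel) \<le> ennreal d"
    using n unfolding L2sq_def v_def \<epsilon>_def by (simp add: norm_minus_commute)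
  obtain U where U: "U \<in> sets borel" "emeasure lborel U \<le> ennreal (10 * d / c)"
    "\<And>x r. x \<notin> U \<Longrightarrow> r > 0 \<Longrightarrow> (\<integral>\<^sup>+s. ennreal ((norm (v s))\<^sup>2) * indicator (cball x r) s \<partial>lborel) \<le> ennreal (c * r)"
    using maximal_function_weak_type[of "\<lambda>s. ennreal ((norm (v s))\<^sup>2)" c d] c d vd by auto
  define V where "V = {x. \<eta> < norm (v x)}"
  have V[measurable]: "V \<in> sets borel" unfolding V_def by measurable
  have "emeasure lborel V \<le> ennreal (d / \<eta>\<^sup>2)"
  proof -
    have "emeasure lborel V = (\<integral>\<^sup>+x. indicator V x \<partial>lborel)" by simp
    also have "\<dots> \<le> (\<integral>\<^sup>+x. ennreal (1 / \<eta>\<^sup>2) * ennreal ((norm (v x))\<^sup>2) \<partial>lborel)"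
    proof (rule nn_integral_mono)
      fix x
      show "indicator V x \<le> ennreal (1 / \<eta>\<^sup>2) * ennreal ((norm (v x))\<^sup>2)"
      proof (cases "x \<in> V")
        case True
        then have "\<eta>\<^sup>2 \<le> (norm (v x))\<^sup>2" using \<eta> by (intro power_mono) (auto simp: V_def)
        then have "1 \<le> 1 / \<eta>\<^sup>2 * (norm (v x))\<^sup>2" using \<eta> by simp
        then have "ennreal 1 \<le> ennreal (1 / \<eta>\<^sup>2 * (norm (v x))\<^sup>2)" by (rule ennreal_leI)
        also have "\<dots> = ennreal (1 / \<eta>\<^sup>2) * ennreal ((norm (v x))\<^sup>2)" by (rule ennreal_mult) auto
        finally show ?thesis using True by simp
      qed simp
    qed
    also have "\<dots> = ennreal (1 / \<eta>\<^sup>2) * (\<integral>\<^sup>+x. ennreal ((norm (v x))\<^sup>2) \<partial>lborel)"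
      by (rule nn_integral_cmult) measurable
    also have "\<dots> \<le> ennreal (1 / \<eta>\<^sup>2) * ennreal d" by (intro mult_left_mono vd) simp
    also have "\<dots> = ennreal (d / \<eta>\<^sup>2)" using d by (simp add: ennreal_mult[symmetric])
    finally show ?thesis .
  qed
  then have "emeasure lborel (U \<union> V) \<le> ennreal (10 * d / c) + ennreal (d / \<eta>\<^sup>2)"
    using emeasure_subadditive[of U lborel V] U V by (auto intro: order_trans add_mono)
  also have "\<dots> = ennreal e" using c d by (subst ennreal_plus[symmetric]) (auto simp: de)
  finally have small: "emeasure lborel (U \<union> V) \<le> ennreal e" .
  have good: "\<forall>\<^sub>F z in at (complex_of_real x) within wedge x. norm (f z - u x) \<le> 3 * \<eta>"
    if x: "x \<notin> U \<union> V" for x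
  proof -
    have max: "(\<integral>\<^sup>+s. ennreal (norm (v s)) * indicator (cball x r) s \<partial>lborel) \<le> ennreal (sqrt (2 * c) * r)" if "r > 0" for r
      using that x c by (intro cball_mean_le U(3)) auto
    have osc: "norm (f z - f (z + \<i> * complex_of_real \<epsilon>)) \<le> \<eta>" if z: "z \<in> wedge x" for z
    proof -
      have z': "Im z > 0" "\<bar>Re z - x\<bar> < a * Im z" using z by (auto simp: wedge_def upper_half_plane_def)
      let ?P = "\<lambda>s. 1 / complex_of_real ((norm (complex_of_real s - z))\<^sup>2)"
      have i: "integrable lborel (\<lambda>s. u s * ?P s)" "integrable lborel (\<lambda>s. f (Complex s \<epsilon>) * ?P s)"
        by (intro L2sq_mult_integrable poisson_kernel_L2sq[OF z'(1)] ufin hardy2_L2sq_finite[OF f \<epsilon>]; measurable)+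
      have "(LINT s|lborel. v s / complex_of_real ((norm (complex_of_real s - z))\<^sup>2))
         = (LINT s|lborel. u s * ?P s) - (LINT s|lborel. f (Complex s \<epsilon>) * ?P s)"
        by (subst Bochner_Integration.integral_diff[OF i, symmetric]) (simp add: v_def diff_divide_distrib)
      also have "\<dots> = pi / Im z * (f z - f (z + \<i> * complex_of_real \<epsilon>))"
        using L2_boundary_poisson[OF f u z'(1)] hardy2_poisson[OF f \<epsilon> z'(1)] by (simp add: right_diff_distrib)
      finally have e1: "(LINT s|lborel. v s / complex_of_real ((norm (complex_of_real s - z))\<^sup>2)) = pi / Im z * (f z - f (z + \<i> * complex_of_real \<epsilon>))" .
      have "Im z * norm (LINT s|lborel. v s / complex_of_real ((norm (complex_of_real s - z))\<^sup>2)) \<le> (2 + a)\<^sup>2 * (2 * sqrt (2 * c))"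
        using c by (intro poisson_integral_cone_bound[OF vm _ max z']) auto
      then have "pi * norm (f z - f (z + \<i> * complex_of_real \<epsilon>)) \<le> pi * \<eta>"
        unfolding e1 sqrtc using z'(1) by (simp add: norm_mult norm_divide)
      then show ?thesis by (simp add: mult_le_cancel_left)
    qed
    have "isCont f (Complex x \<epsilon>)" by (rule hardy2_isCont[OF f]) (simp add: \<epsilon>)
    moreover have "((\<lambda>z. z + \<i> * complex_of_real \<epsilon>) \<longlongrightarrow> Complex x \<epsilon>) (at (complex_of_real x) within wedge x)"
    proof -
      have "((\<lambda>z. z + \<i> * complex_of_real \<epsilon>) \<longlongrightarrow> complex_of_real x + \<i> * complex_of_real \<epsilon>) (at (complex_of_real x) within wedge x)"
        by (intro tendsto_intros)
      moreover have "complex_of_real x + \<i> * complex_of_real \<epsilon> = Complex x \<epsilon>" by (simp add: complex_eq_iff)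
      ultimately show ?thesis by simp
    qed
    ultimately have "((\<lambda>z. f (z + \<i> * complex_of_real \<epsilon>)) \<longlongrightarrow> f (Complex x \<epsilon>)) (at (complex_of_real x) within wedge x)"
      by (rule isCont_tendsto_compose)
    then have "\<forall>\<^sub>F z in at (complex_of_real x) within wedge x. dist (f (z + \<i> * complex_of_real \<epsilon>)) (f (Complex x \<epsilon>)) < \<eta>"
      using \<eta> by (rule tendstoD)
    moreover have "\<forall>\<^sub>F z in at (complex_of_real x) within wedge x. z \<in> wedge x"
      by (simp add: eventually_at_filter)
    ultimately show ?thesis
    proof eventually_elim
      case (elim z)
      have "norm (v x) \<le> \<eta>" using x by (simp add: V_def)
      then have 3: "norm (f (Complex x \<epsilon>) - u x) \<le> \<eta>" by (simp add: v_def norm_minus_commute)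
      have 2: "norm (f (z + \<i> * complex_of_real \<epsilon>) - f (Complex x \<epsilon>)) \<le> \<eta>"
        using elim(1) by (simp add: dist_norm)
      have 1: "norm (f z - f (z + \<i> * complex_of_real \<epsilon>)) \<le> \<eta>" by (rule osc[OF elim(2)])
      have "norm ((f z - f (z + \<i> * complex_of_real \<epsilon>)) + (f (z + \<i> * complex_of_real \<epsilon>) - f (Complex x \<epsilon>)) + (f (Complex x \<epsilon>) - u x)) \<le> \<eta> + \<eta> + \<eta>"
        by (intro norm_triangle_mono 1 2 3)
      then show ?case by simp
    qed
  qed
  show "\<exists>W\<in>sets lborel. {x. \<not> (\<forall>\<^sub>F z in at (complex_of_real x) within wedge x. norm (f z - u x) \<le> 3 * \<eta>)} \<subseteq> W \<and> emeasure lborel W \<le> ennreal e"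
  proof (intro bexI[of _ "U \<union> V"] conjI small subsetI)
    fix x assume "x \<in> {x. \<not> (\<forall>\<^sub>F z in at (complex_of_real x) within wedge x. norm (f z - u x) \<le> 3 * \<eta>)}"
    then show "x \<in> U \<union> V" using good[of x] by blast
  qed (use U V in auto)
qed

text \<open>Cones grow with the aperture, so integer apertures and tolerances
  \<open>1 / (m + 1)\<close> suffice. The exceptional null sets are then countably many, which
  yields one null set for all apertures.\<close>

theorem hardy2_nontangential_limit:
  fixes f :: "complex \<Rightarrow> complex"
  assumes f: "f \<in> hardy2" and u: "L2_boundary f u"
  shows "AE x in lborel. has_nontangential_limit f x (u x)"
proof -
  let ?cone = "\<lambda>a x. {z \<in> upper_half_plane. \<bar>Re z - x\<bar> < a * Im z}"
  let ?Q = "\<lambda>a \<eta> x. \<forall>\<^sub>F z in at (complex_of_real x) within ?cone a x. norm (f z - u x) \<le> 3 * \<eta>"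
  have "AE x in lborel. ?Q (real (Suc k)) (1 / real (Suc m)) x" for k m
  proof -
    obtain N where N: "N \<in> null_sets lborel" "{x. \<not> ?Q (real (Suc k)) (1 / real (Suc m)) x} \<subseteq> N"
      using hardy2_cone_oscillation_null[OF f u, of "real (Suc k)" "1 / real (Suc m)"] by auto
    show ?thesis by (rule AE_I'[OF N(1)]) (use N(2) in auto)
  qed
  then have "AE x in lborel. \<forall>k m. ?Q (real (Suc k)) (1 / real (Suc m)) x"
    by (simp add: AE_all_countable)
  then show ?thesis
  proof eventually_elim
    fix x assume Q: "\<forall>k m. ?Q (real (Suc k)) (1 / real (Suc m)) x"
    show "has_nontangential_limit f x (u x)"
      unfolding has_nontangential_limit_def
    proof (intro allI impI tendstoI)
      fix a e :: real assume a: "a > 0" and e: "e > 0"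
      obtain k where k: "a < real k" using reals_Archimedean2 by blast
      obtain m where m: "inverse (real (Suc m)) < e / 3" using reals_Archimedean[of "e / 3"] e by auto
      have sub: "?cone a x \<subseteq> ?cone (real (Suc k)) x"
      proof
        fix z assume z: "z \<in> ?cone a x"
        then have "a * Im z \<le> real (Suc k) * Im z"
          using k by (intro mult_right_mono) (auto simp: upper_half_plane_def)
        then show "z \<in> ?cone (real (Suc k)) x" using z by auto
      qed
      have "\<forall>\<^sub>F z in at (complex_of_real x) within ?cone a x. norm (f z - u x) \<le> 3 * (1 / real (Suc m))"
        by (rule filter_leD[OF at_le[OF sub]]) (use Q in blast)
      then show "\<forall>\<^sub>F z in at (complex_of_real x) within ?cone a x. dist (f z) (u x) < e"
        by eventually_elim (use m in \<open>simp add: dist_norm inverse_eq_divide\<close>)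
    qed
  qed
qed

corollary hardy2_boundary_value_AE:
  fixes f :: "complex \<Rightarrow> complex"
  assumes "f \<in> hardy2" "L2_boundary f u"
  shows "AE x in lborel. boundary_value f x = u x"
  using hardy2_nontangential_limit[OF assms] by eventually_elim (rule boundary_value_eqI)

section \<open>Measures on the positive half-line\<close>

lemma
  assumes M: "positive_borel_measure_Rplus M"
  shows space_Rplus: "space M = {0<..}"
    and sets_Rplus: "A \<in> sets borel \<Longrightarrow> A \<subseteq> {0<..} \<Longrightarrow> A \<in> sets M"
    and sigma_finite_Rplus: "sigma_finite_measure M"
proof -
  have sets: "sets M = sets (restrict_space borel {0<..})"
    and fin: "\<And>K. compact K \<Longrightarrow> K \<subseteq> {0<..} \<Longrightarrow> emeasure M K < \<infinity>"
    using M by (auto simp: positive_borel_measure_Rplus_def)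
  show space: "space M = {0<..}" using sets_eq_imp_space_eq[OF sets] by (simp add: space_restrict_space)
  have in_sets: "A \<in> sets M" if "A \<in> sets borel" "A \<subseteq> {0<..}" for A
    unfolding sets sets_restrict_space using that by (auto intro!: image_eqI[of _ _ A])
  show "A \<in> sets M" if "A \<in> sets borel" "A \<subseteq> {0<..}" using in_sets that .
  let ?K = "\<lambda>n. {1 / real (Suc n)..real (Suc n)}"
  have pos: "0 < 1 / real (Suc n)" for n by simp
  have K: "?K n \<subseteq> {0<..}" for n
  proof
    fix x assume "x \<in> ?K n"
    then have "1 / real (Suc n) \<le> x" by (simp only: atLeastAtMost_iff)
    with pos[of n] have "0 < x" by (rule less_le_trans)
    then show "x \<in> {0<..}" by simp
  qed
  show "sigma_finite_measure M"
  proof (standard, intro exI[of _ "range ?K"] conjI ballI)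
    show "range ?K \<subseteq> sets M" using in_sets K by auto
    show "\<Union> (range ?K) = space M"
    proof (intro equalityI subsetI)
      fix x assume "x \<in> space M"
      then have x: "x > 0" by (simp add: space)
      obtain n where n: "max x (1 / x) < real n" using reals_Archimedean2 by blast
      then have n': "x \<le> real (Suc n)" "1 / x \<le> real (Suc n)" by auto
      then have "1 / real (Suc n) \<le> x" using x by (simp add: field_simps del: of_nat_Suc)
      then show "x \<in> \<Union> (range ?K)" using n' by (auto simp del: of_nat_Suc)
    next
      fix x assume "x \<in> \<Union> (range ?K)"
      then obtain n where "x \<in> ?K n" by blast
      then have "x \<in> {0<..}" by (rule subsetD[OF K])
      then show "x \<in> space M" by (simp add: space)
    qed
    show "emeasure M a \<noteq> \<infinity>" if "a \<in> range ?K" for a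
      using that fin[of a] K by (auto simp del: of_nat_Suc)
  qed simp
qed

lemma borel_measurable_Rplus:
  fixes f :: "real \<Rightarrow> 'b :: topological_space"
  assumes M: "positive_borel_measure_Rplus M" and f: "continuous_on {0<..} f"
  shows "f \<in> borel_measurable M"
proof -
  have sets: "sets M = sets (restrict_space borel {0<..})"
    using M by (auto simp: positive_borel_measure_Rplus_def)
  show ?thesis using borel_measurable_continuous_on_restrict[OF f] measurable_cong_sets[OF sets refl] by blast
qed

lemma measurable_density_Rplus:
  assumes "positive_borel_measure_Rplus M"
  shows "(\<lambda>t. ennreal (1 / (1 + t\<^sup>2))) \<in> borel_measurable M"
proof (rule measurable_compose[OF _ measurable_ennreal], rule borel_measurable_Rplus[OF assms])
  have "1 + t\<^sup>2 \<noteq> 0" for t :: real using zero_le_power2[of t] by linarith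
  then show "continuous_on {0<..} (\<lambda>t::real. 1 / (1 + t\<^sup>2))" by (intro continuous_intros) auto
qed

lemma hardy2_measurable_ray:
  fixes f :: "complex \<Rightarrow> complex"
  assumes M: "positive_borel_measure_Rplus M" and f: "f \<in> hardy2"
  shows "(\<lambda>t. f (\<i> * complex_of_real t)) \<in> borel_measurable M"
proof (rule borel_measurable_Rplus[OF M])
  show "continuous_on {0<..} (\<lambda>t. f (\<i> * complex_of_real t))"
    by (rule continuous_on_compose2[OF holomorphic_on_imp_continuous_on[OF hardy2_holomorphic[OF f]]])
      (auto intro!: continuous_intros simp: upper_half_plane_iff)
qed

text \<open>The two one-sided estimates on \<open>\<rho>\<close> combine into one scale-invariant condition on \<open>\<mu>\<close>,
  namely \<open>\<mu>((0,s]) \<le> C s\<close> for all \<open>s\<close>.\<close>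

lemma linear_growth_of_density_bounds:
  fixes \<mu> \<rho> :: "real measure"
  assumes M: "positive_borel_measure_Rplus \<mu>" and \<rho>: "\<rho> = density \<mu> (\<lambda>t. ennreal (1 / (1 + t\<^sup>2)))"
    and \<beta>: "\<beta> > 0" and \<gamma>: "\<gamma> > 0"
    and bnd: "\<And>e. e > 0 \<Longrightarrow> emeasure \<rho> {0<..e} \<le> ennreal (\<beta> * e)" "\<And>t. t > 0 \<Longrightarrow> emeasure \<rho> {t..} \<le> ennreal (\<gamma> / t)"
  shows "\<exists>C\<ge>0. \<forall>s. emeasure \<mu> {t\<in>space \<mu>. t \<le> s} \<le> ennreal (C * s)"
proof -
  note dm = measurable_density_Rplus[OF M]
  \<comment> \<open>On \<open>(0, b]\<close> the density of \<rho> is at least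
    \<open>1 / (1 + b^2)\<close>, so bounds for \<rho> turn into bounds for \<mu>.\<close>
  have conv: "emeasure \<mu> A \<le> ennreal (1 + b\<^sup>2) * emeasure \<rho> A" if A: "A \<in> sets \<mu>" "A \<subseteq> {0<..b}" for A b
  proof -
    have "emeasure \<mu> A = (\<integral>\<^sup>+t. indicator A t \<partial>\<mu>)" using A by simp
    also have "\<dots> \<le> (\<integral>\<^sup>+t. ennreal (1 + b\<^sup>2) * (ennreal (1 / (1 + t\<^sup>2)) * indicator A t) \<partial>\<mu>)"
    proof (rule nn_integral_mono)
      fix t
      show "indicator A t \<le> ennreal (1 + b\<^sup>2) * (ennreal (1 / (1 + t\<^sup>2)) * indicator A t)"
      proof (cases "t \<in> A")
        case True
        then have t: "0 < t" "t \<le> b" using A by auto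
        have "t\<^sup>2 \<le> b\<^sup>2" using t by (intro power_mono) auto
        then have "1 \<le> (1 + b\<^sup>2) * (1 / (1 + t\<^sup>2))"
          by (simp add: divide_simps) (smt (verit) zero_le_power2)
        then have "ennreal 1 \<le> ennreal ((1 + b\<^sup>2) * (1 / (1 + t\<^sup>2)))" by (rule ennreal_leI)
        also have "\<dots> = ennreal (1 + b\<^sup>2) * ennreal (1 / (1 + t\<^sup>2))" by (rule ennreal_mult) auto
        finally show ?thesis using True by simp
      qed simp
    qed
    also have "\<dots> = ennreal (1 + b\<^sup>2) * (\<integral>\<^sup>+t. ennreal (1 / (1 + t\<^sup>2)) * indicator A t \<partial>\<mu>)"
      by (intro nn_integral_cmult borel_measurable_times_ennreal dm borel_measurable_indicator A(1))
    also have "\<dots> = ennreal (1 + b\<^sup>2) * emeasure \<rho> A"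
      unfolding \<rho> by (simp only: emeasure_density[OF dm A(1)])
    finally show ?thesis .
  qed
  \<comment> \<open>\<open>2 * \<beta>\<close> serves scales up to 1, where
    \<open>1 + s^2 \<le> 2\<close>. On a block \<open>[s, 2 s]\<close> with \<open>s \<ge> 1\<close>
    the factor \<open>1 + (2 * s)^2 \<le> 5 * s^2\<close> meets \<open>\<gamma> / s\<close>, giving
    \<open>5 * \<gamma> * s\<close>; since this is at most \<open>K * s\<close>, the dyadic
    induction doubles the bound at each step.\<close>
  define K where "K = 2 * \<beta> + 5 * \<gamma>"
  have K: "K > 0" using \<beta> \<gamma> by (simp add: K_def)
  have small: "emeasure \<mu> {0<..s} \<le> ennreal (K * s)" if s: "0 < s" "s \<le> 1" for s
  proof -
    have "emeasure \<mu> {0<..s} \<le> ennreal (1 + s\<^sup>2) * emeasure \<rho> {0<..s}"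
      by (rule conv) (auto intro!: sets_Rplus[OF M])
    also have "\<dots> \<le> ennreal (1 + s\<^sup>2) * ennreal (\<beta> * s)" by (intro mult_left_mono bnd s) simp
    also have "\<dots> = ennreal ((1 + s\<^sup>2) * (\<beta> * s))"
      by (rule ennreal_mult[symmetric]) (use \<beta> s in auto)
    also have "\<dots> \<le> ennreal (K * s)"
    proof (rule ennreal_leI)
      have "s\<^sup>2 \<le> 1" using s by (simp add: power_le_one)
      then have "(1 + s\<^sup>2) * (\<beta> * s) \<le> 2 * (\<beta> * s)" using \<beta> s by (intro mult_right_mono) auto
      also have "\<dots> \<le> K * s" using \<gamma> s by (simp add: K_def distrib_right)
      finally show "(1 + s\<^sup>2) * (\<beta> * s) \<le> K * s" .
    qed
    finally show ?thesis .
  qed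
  have dyadic: "emeasure \<mu> {0<..2 ^ n} \<le> ennreal (K * 2 ^ n)" for n :: nat
  proof (induction n)
    case 0 then show ?case using small[of 1] by simp
  next
    case (Suc n)
    define s :: real where "s = 2 ^ n"
    have s: "s \<ge> 1" by (simp add: s_def)
    have sM: "{0<..s} \<in> sets \<mu>" "{s..2 * s} \<in> sets \<mu>" using s by (auto intro!: sets_Rplus[OF M])
    have "{0<..2 * s} = {0<..s} \<union> {s..2 * s}" using s by auto
    then have "emeasure \<mu> {0<..2 * s} \<le> emeasure \<mu> {0<..s} + emeasure \<mu> {s..2 * s}"
      using emeasure_subadditive[OF sM] by simp
    also have "\<dots> \<le> ennreal (K * s) + ennreal (5 * \<gamma> * s)"
    proof (rule add_mono)
      show "emeasure \<mu> {0<..s} \<le> ennreal (K * s)" using Suc by (simp add: s_def)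
      have "emeasure \<mu> {s..2 * s} \<le> ennreal (1 + (2 * s)\<^sup>2) * emeasure \<rho> {s..2 * s}"
        using s by (intro conv sM) auto
      also have "\<dots> \<le> ennreal (1 + (2 * s)\<^sup>2) * emeasure \<rho> {s..}"
        unfolding \<rho> using s by (intro mult_left_mono emeasure_mono) (auto intro!: sets_Rplus[OF M])
      also have "\<dots> \<le> ennreal (1 + (2 * s)\<^sup>2) * ennreal (\<gamma> / s)"
        using s by (intro mult_left_mono bnd) auto
      also have "\<dots> = ennreal ((1 + (2 * s)\<^sup>2) * (\<gamma> / s))"
        by (rule ennreal_mult[symmetric]) (use \<gamma> s in auto)
      also have "\<dots> \<le> ennreal (5 * s\<^sup>2 * (\<gamma> / s))"
      proof (intro ennreal_leI mult_right_mono)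
        have "1 \<le> s\<^sup>2" using s by simp
        then show "1 + (2 * s)\<^sup>2 \<le> 5 * s\<^sup>2" by (simp add: power_mult_distrib)
      qed (use \<gamma> s in auto)
      also have "5 * s\<^sup>2 * (\<gamma> / s) = 5 * \<gamma> * s" using s by (simp add: power2_eq_square)
      finally show "emeasure \<mu> {s..2 * s} \<le> ennreal (5 * \<gamma> * s)" .
    qed
    also have "\<dots> = ennreal (K * s + 5 * \<gamma> * s)" using K \<gamma> s by simp
    also have "\<dots> \<le> ennreal (K * (2 * s))"
      using \<beta> s by (intro ennreal_leI) (simp add: K_def algebra_simps)
    finally show ?case by (simp add: s_def)
  qed
  have "emeasure \<mu> {t\<in>space \<mu>. t \<le> s} \<le> ennreal (2 * K * s)" for s
  proof -
    have eq: "{t\<in>space \<mu>. t \<le> s} = {0<..s}" by (auto simp: space_Rplus[OF M])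
    consider "s \<le> 0" | "0 < s" "s \<le> 1" | "1 < s" by linarith
    then show ?thesis
    proof cases
      case 1 then show ?thesis unfolding eq by simp
    next
      case 2
      then show ?thesis unfolding eq using K by (intro order_trans[OF small] ennreal_leI mult_right_mono) auto
    next
      case 3
      \<comment> \<open>The first power of 2 above \<open>s\<close> is at most \<open>2 * s\<close>,
        which accounts for the final factor 2.\<close>
      define m where "m = (LEAST n. s \<le> 2 ^ n)"
      have ex: "\<exists>n. s \<le> 2 ^ n" using real_arch_pow[of 2 s] by (auto intro: less_imp_le)
      have m: "s \<le> 2 ^ m" unfolding m_def by (rule LeastI_ex[OF ex])
      have "m \<noteq> 0" using m 3 by (intro notI) simp
      then obtain k where k: "m = Suc k" by (cases m) auto
      have "\<not> s \<le> 2 ^ k" using not_less_Least[of k "\<lambda>n. s \<le> 2 ^ n"] k by (simp add: m_def)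
      then have "(2::real) ^ m \<le> 2 * s" by (simp add: k)
      have "emeasure \<mu> {0<..s} \<le> emeasure \<mu> {0<..2 ^ m}"
        using m by (intro emeasure_mono) (auto intro!: sets_Rplus[OF M])
      also have "\<dots> \<le> ennreal (K * 2 ^ m)" by (rule dyadic)
      also have "\<dots> \<le> ennreal (K * (2 * s))"
        using \<open>2 ^ m \<le> 2 * s\<close> K by (intro ennreal_leI mult_left_mono) auto
      finally show ?thesis unfolding eq by (simp add: mult_ac)
    qed
  qed
  then show ?thesis using K by (intro exI[of _ "2 * K"]) auto
qed

lemma bigo_id_at_0_obtain:
  assumes "bigo_id_at_0 \<phi>"
  obtains C x0 where "C \<ge> 0" "x0 > 0" "\<And>x. 0 < x \<Longrightarrow> x < x0 \<Longrightarrow> \<phi> x \<le> ennreal (C * x)"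
proof -
  obtain C where "\<forall>\<^sub>F x in at_right 0. \<phi> x \<le> ennreal (C * x)" using assms by (auto simp: bigo_id_at_0_def)
  then obtain x0 where x0: "x0 > 0" "\<And>x. 0 < x \<Longrightarrow> x < x0 \<Longrightarrow> \<phi> x \<le> ennreal (C * x)"
    by (auto simp: eventually_at_right_field)
  show ?thesis
  proof (rule that[of "max C 0" x0])
    fix x assume x: "0 < x" "x < x0"
    have "\<phi> x \<le> ennreal (C * x)" by (rule x0(2)[OF x])
    also have "\<dots> \<le> ennreal (max C 0 * x)" using x by (intro ennreal_leI mult_right_mono) auto
    finally show "\<phi> x \<le> ennreal (max C 0 * x)" .
  qed (use x0 in auto)
qed

text \<open>The two \<open>O\<close> conditions speak about small \<open>x\<close> only. They bound
  the mass of both ends, and the compact piece in between is finite, so the total mass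
  \<open>R\<close> is finite; at the remaining scales \<open>R\<close> itself is at most a constant
  times \<open>e\<close> or \<open>1 / t\<close>.\<close>

lemma density_global_bounds:
  fixes \<mu> \<rho> :: "real measure"
  assumes M: "positive_borel_measure_Rplus \<mu>" and \<rho>: "\<rho> = density \<mu> (\<lambda>t. ennreal (1 / (1 + t\<^sup>2)))"
    and b: "bigo_id_at_0 (\<lambda>x. emeasure \<rho> {0<..<x})" "bigo_id_at_0 (\<lambda>x. emeasure \<rho> {inverse x<..})"
  shows "emeasure \<rho> {0<..} < \<infinity>"
    and "\<exists>\<beta>>0. \<exists>\<gamma>>0. \<forall>e>0. \<forall>t>0. emeasure \<rho> {0<..e} \<le> ennreal (\<beta> * e) \<and> emeasure \<rho> {t..} \<le> ennreal (\<gamma> / t)"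
proof -
  have sets: "A \<in> sets borel \<Longrightarrow> A \<subseteq> {0<..} \<Longrightarrow> A \<in> sets \<rho>" for A
    unfolding \<rho> using sets_Rplus[OF M] by simp
  note dm = measurable_density_Rplus[OF M]
  obtain C1 x1 where 1: "C1 \<ge> 0" "x1 > 0" "\<And>x. 0 < x \<Longrightarrow> x < x1 \<Longrightarrow> emeasure \<rho> {0<..<x} \<le> ennreal (C1 * x)"
    using bigo_id_at_0_obtain[OF b(1)] by blast
  obtain C2 x2 where 2: "C2 \<ge> 0" "x2 > 0" "\<And>x. 0 < x \<Longrightarrow> x < x2 \<Longrightarrow> emeasure \<rho> {inverse x<..} \<le> ennreal (C2 * x)"
    using bigo_id_at_0_obtain[OF b(2)] by blast
  define p where "p = x1 / 2"
  define q where "q = x2 / 2"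
  have pq: "0 < p" "p < x1" "0 < q" "q < x2" using 1 2 by (auto simp: p_def q_def)
  \<comment> \<open>The density is at most 1 and \<mu> is finite on compact subsets of the open
    half-line.\<close>
  have mid: "emeasure \<rho> {p..inverse q} < \<infinity>"
  proof -
    have s: "{p..inverse q} \<in> sets \<mu>" using pq by (auto intro!: sets_Rplus[OF M])
    have "emeasure \<rho> {p..inverse q} = (\<integral>\<^sup>+t. ennreal (1 / (1 + t\<^sup>2)) * indicator {p..inverse q} t \<partial>\<mu>)"
      unfolding \<rho> by (simp only: emeasure_density[OF dm s])
    also have "\<dots> \<le> (\<integral>\<^sup>+t. indicator {p..inverse q} t \<partial>\<mu>)"
      by (intro nn_integral_mono) (auto split: split_indicator simp: ennreal_le_1 divide_le_eq_1 add_pos_nonneg)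
    also have "\<dots> = emeasure \<mu> {p..inverse q}" using s by simp
    also have "\<dots> < \<infinity>"
    proof -
      have "{p..inverse q} \<subseteq> {0<..}" using pq by auto
      then show ?thesis using M compact_Icc unfolding positive_borel_measure_Rplus_def by blast
    qed
    finally show ?thesis .
  qed
  have "emeasure \<rho> {0<..} \<le> emeasure \<rho> (({0<..<p} \<union> {p..inverse q}) \<union> {inverse q<..})"
    using pq by (intro emeasure_mono sets) (auto simp: not_le not_less)
  also have "\<dots> \<le> emeasure \<rho> ({0<..<p} \<union> {p..inverse q}) + emeasure \<rho> {inverse q<..}"
    using pq by (intro emeasure_subadditive sets) (auto intro: less_trans)
  also have "\<dots> \<le> (emeasure \<rho> {0<..<p} + emeasure \<rho> {p..inverse q}) + emeasure \<rho> {inverse q<..}"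
    using pq by (intro add_right_mono emeasure_subadditive sets) auto
  also have "\<dots> < \<infinity>"
    using 1(3)[OF pq(1,2)] 2(3)[OF pq(3,4)] mid by (auto intro: le_less_trans)
  finally show fin: "emeasure \<rho> {0<..} < \<infinity>" .
  define R where "R = enn2real (emeasure \<rho> {0<..})"
  have R: "emeasure \<rho> {0<..} = ennreal R" "R \<ge> 0" using fin by (simp_all add: R_def)
  have R_le: "emeasure \<rho> A \<le> ennreal R" if "A \<subseteq> {0<..}" for A
    unfolding R(1)[symmetric] by (rule emeasure_mono) (use that in \<open>auto intro: sets\<close>)
  \<comment> \<open>\<open>2 * C1\<close> comes from enlarging \<open>(0, e]\<close> to the open
    interval \<open>(0, 2 e)\<close>, \<open>R * (2 / x1)\<close> covers the scales with
    \<open>2 * e \<ge> x1\<close>, and 1 ensures positivity. \<gamma> is built in the same way with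
    \<open>2 / t\<close> in place of \<open>2 * e\<close>.\<close>
  define \<beta> where "\<beta> = 2 * C1 + R * (2 / x1) + 1"
  define \<gamma> where "\<gamma> = 2 * C2 + R * (2 / x2) + 1"
  have pos: "\<beta> > 0" "\<gamma> > 0" using 1 2 R by (auto simp: \<beta>_def \<gamma>_def intro!: add_nonneg_pos)
  have B: "emeasure \<rho> {0<..e} \<le> ennreal (\<beta> * e)" if e: "e > 0" for e
  proof (cases "2 * e < x1")
    case True
    have "emeasure \<rho> {0<..e} \<le> emeasure \<rho> {0<..<2 * e}" using e by (intro emeasure_mono sets) auto
    also have "\<dots> \<le> ennreal (C1 * (2 * e))" using True e by (intro 1) auto
    also have "\<dots> \<le> ennreal (\<beta> * e)"
      using e 1 R by (intro ennreal_leI) (simp add: \<beta>_def distrib_right)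
    finally show ?thesis .
  next
    case False
    have "emeasure \<rho> {0<..e} \<le> ennreal R" by (rule R_le) auto
    also have "\<dots> \<le> ennreal (\<beta> * e)"
    proof (rule ennreal_leI)
      have "1 \<le> 2 / x1 * e" using False 1 by (simp add: field_simps)
      then have "R * 1 \<le> R * (2 / x1 * e)" using R by (intro mult_left_mono) auto
      also have "\<dots> \<le> R * (2 / x1 * e) + (2 * C1 * e + e)" using e 1 by simp
      also have "\<dots> = \<beta> * e" by (simp add: \<beta>_def algebra_simps)
      finally show "R \<le> \<beta> * e" by simp
    qed
    finally show ?thesis .
  qed
  have G: "emeasure \<rho> {t..} \<le> ennreal (\<gamma> / t)" if t: "t > 0" for t
  proof (cases "2 / t < x2")
    case True
    have "emeasure \<rho> {t..} \<le> emeasure \<rho> {inverse (2 / t)<..}" using t by (intro emeasure_mono sets) auto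
    also have "\<dots> \<le> ennreal (C2 * (2 / t))" using True t by (intro 2) auto
    also have "\<dots> \<le> ennreal (\<gamma> / t)"
      using t 2 R by (intro ennreal_leI) (simp add: \<gamma>_def divide_right_mono)
    finally show ?thesis .
  next
    case False
    have "emeasure \<rho> {t..} \<le> ennreal R" by (rule R_le) (use t in auto)
    also have "\<dots> \<le> ennreal (\<gamma> / t)"
    proof (rule ennreal_leI)
      have "1 \<le> 2 / x2 / t" using False 2 t by (simp add: field_simps)
      then have "R * 1 \<le> R * (2 / x2 / t)" using R by (intro mult_left_mono) auto
      also have "\<dots> = R * (2 / x2) / t" by simp
      also have "\<dots> \<le> \<gamma> / t" using t 2 by (intro divide_right_mono) (auto simp: \<gamma>_def)
      finally show "R \<le> \<gamma> / t" by simp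
    qed
    finally show ?thesis .
  qed
  show "\<exists>\<beta>>0. \<exists>\<gamma>>0. \<forall>e>0. \<forall>t>0. emeasure \<rho> {0<..e} \<le> ennreal (\<beta> * e) \<and> emeasure \<rho> {t..} \<le> ennreal (\<gamma> / t)"
    using pos B G by blast
qed

section \<open>Borel representatives and the Hardy norm\<close>

lemma lebesgue_measurable_AE_eq:
  fixes F G :: "real \<Rightarrow> complex"
  assumes "G \<in> borel_measurable borel" "AE x in lborel. F x = G x"
  shows "F \<in> borel_measurable lebesgue"
proof (rule borel_measurable_AE)
  show "G \<in> borel_measurable lebesgue" using assms(1) by (simp add: measurable_completion)
  show "AE x in lebesgue. G x = F x" by (rule AE_completion) (use assms(2) in \<open>auto elim: eventually_mono\<close>)
qed

text \<open>\<open>boundary_value f\<close> is known only to agree almost everywhere with a Borel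
  function, so its integrals are formed over \<open>lebesgue\<close>. This moves them to
  \<open>lborel\<close>, where Fubini and product measurability are available for the
  representative.\<close>

lemma lebesgue_integral_AE_eq:
  fixes F G :: "real \<Rightarrow> complex"
  assumes G: "G \<in> borel_measurable borel" and FG: "AE x in lborel. F x = G x"
  shows "(LINT x|lebesgue. F x) = (LINT x|lborel. G x)"
proof -
  have "(LINT x|lebesgue. F x) = (LINT x|lebesgue. G x)"
    using lebesgue_measurable_AE_eq[OF assms] G
    by (intro integral_cong_AE AE_completion FG) (auto simp: measurable_completion)
  also have "\<dots> = (LINT x|lborel. G x)" using G by (intro integral_completion) simp
  finally show ?thesis .
qed

lemma AE_lborel_reflect:
  assumes "AE x::real in lborel. P x"
  shows "AE x in lborel. P (- x)"
proof -
  obtain N where N0: "{x \<in> space lborel. \<not> P x} \<subseteq> N" "emeasure lborel N = 0" "N \<in> sets lborel"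
    by (rule AE_E[OF assms])
  then have N: "{x. \<not> P x} \<subseteq> N" "N \<in> null_sets lborel" by auto
  have "N \<in> sets borel" using N0 by simp
  have "emeasure lborel {x. - x \<in> N} = emeasure (distr lborel borel uminus) N"
    by (subst emeasure_distr) (use \<open>N \<in> sets borel\<close> in \<open>auto simp: vimage_def\<close>)
  also have "\<dots> = 0" using N0 by (simp add: lborel_distr_uminus)
  finally have "emeasure lborel {x. - x \<in> N} = 0" .
  moreover have "{x. - x \<in> N} \<in> sets borel"
  proof -
    have "(\<lambda>x::real. - x) -` N \<inter> space borel \<in> sets borel"
      by (rule measurable_sets[OF _ \<open>N \<in> sets borel\<close>]) simp
    then show ?thesis by (simp add: vimage_def)
  qed
  ultimately have "{x. - x \<in> N} \<in> null_sets lborel" by (intro null_setsI) auto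
  then show ?thesis by (rule AE_I') (use N in auto)
qed

lemma hardy_norm_L2sq:
  fixes f :: "complex \<Rightarrow> complex"
  assumes f: "f \<in> hardy2" and u: "L2_boundary f u"
  shows "ennreal ((hardy_norm f)\<^sup>2) = L2sq lborel u"
proof -
  have um[measurable]: "u \<in> borel_measurable borel" and uf: "L2sq lborel u < \<infinity>" using u by (auto simp: L2_boundary_def)
  have AE: "AE x in lborel. boundary_value f x = u x" by (rule hardy2_boundary_value_AE[OF f u])
  have bm: "boundary_value f \<in> borel_measurable lebesgue"
    by (rule lebesgue_measurable_AE_eq[OF um AE])
  have "(LINT x|lebesgue. (norm (boundary_value f x))\<^sup>2) = (LINT x|lebesgue. (norm (u x))\<^sup>2)"
    using AE_completion[OF AE] bm by (intro integral_cong_AE) (auto simp: measurable_completion elim: eventually_mono)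
  also have "\<dots> = (LINT x|lborel. (norm (u x))\<^sup>2)" by (intro integral_completion) simp
  also have "\<dots> = enn2real (L2sq lborel u)"
    unfolding L2sq_def by (intro integral_eq_nn_integral) auto
  finally have "(hardy_norm f)\<^sup>2 = enn2real (L2sq lborel u)" by (simp add: hardy_norm_def)
  then show ?thesis using uf by simp
qed

section \<open>Schur estimates between the line and the ray\<close>

lemma sum_abs_le_norm:
  "\<bar>s\<bar> + \<bar>t\<bar> \<le> 2 * norm (complex_of_real s + \<i> * complex_of_real t)"
  using abs_Re_le_cmod[of "complex_of_real s + \<i> * complex_of_real t"]
    abs_Im_le_cmod[of "complex_of_real s + \<i> * complex_of_real t"] by simp

lemma lborel_linear_growth:
  "emeasure lborel {x \<in> space lborel. \<bar>x\<bar> \<le> s} \<le> ennreal (2 * s)"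
proof -
  have "{x \<in> space lborel. \<bar>x\<bar> \<le> s} = {-s..s}" by (auto simp: abs_le_iff)
  then show ?thesis by (cases "0 \<le> s") auto
qed

text \<open>Schur test with the weights \<open>|s|\<^sup>-\<^sup>1\<^sup>/\<^sup>2\<close> and \<open>t\<^sup>-\<^sup>1\<^sup>/\<^sup>2\<close>; the constants are not sharp.\<close>

lemma
  fixes \<mu> :: "real measure"
  assumes M: "positive_borel_measure_Rplus \<mu>" and C: "C \<ge> 0"
    and growth: "\<And>s. emeasure \<mu> {t\<in>space \<mu>. t \<le> s} \<le> ennreal (C * s)"
  shows schur_line_to_ray: "u \<in> borel_measurable borel \<Longrightarrow> (\<And>s. u s \<ge> 0) \<Longrightarrow>
      (\<integral>\<^sup>+t. (\<integral>\<^sup>+s. ennreal (1 / (\<bar>s\<bar> + t) * u s) \<partial>lborel)\<^sup>2 \<partial>\<mu>) \<le> ennreal (45 * C * pi\<^sup>2) * (\<integral>\<^sup>+s. ennreal ((u s)\<^sup>2) \<partial>lborel)"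
    and schur_ray_to_line: "v \<in> borel_measurable \<mu> \<Longrightarrow> (\<And>t. v t \<ge> 0) \<Longrightarrow>
      (\<integral>\<^sup>+s. (\<integral>\<^sup>+t. ennreal (1 / (\<bar>s\<bar> + t) * v t) \<partial>\<mu>)\<^sup>2 \<partial>lborel) \<le> ennreal (45 * C * pi\<^sup>2) * (\<integral>\<^sup>+t. ennreal ((v t)\<^sup>2) \<partial>\<mu>)"
proof -
  have sf: "sigma_finite_measure \<mu>" by (rule sigma_finite_Rplus[OF M])
  have space: "space \<mu> = {0<..}" by (rule space_Rplus[OF M])
  have id: "(\<lambda>t. t) \<in> borel_measurable \<mu>" by (rule borel_measurable_Rplus[OF M]) (intro continuous_intros)
  \<comment> \<open>\<open>schur_test\<close> requires kernel and weights to be nonnegative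
    everywhere, so both are cut off at negative \<open>t\<close>, where \<mu> has no points.\<close>
  define K where "K s t = (if t \<ge> 0 then 1 / (\<bar>s\<bar> + t) else 0)" for s t :: real
  define w where "w t = (if t \<ge> 0 then 1 / sqrt t else 0)" for t :: real
  have K0: "K s t \<ge> 0" for s t by (simp add: K_def)
  have w0: "w t \<ge> 0" for t by (simp add: w_def)
  have [measurable]: "w \<in> borel_measurable borel" unfolding w_def by measurable
  have wm: "w \<in> borel_measurable \<mu>" by (rule measurable_compose[OF id]) measurable
  have wabs[measurable]: "(\<lambda>s. w \<bar>s\<bar>) \<in> borel_measurable lborel" by measurable
  have K: "(\<lambda>(s, t). K s t) \<in> borel_measurable (borel \<Otimes>\<^sub>M borel)"
    unfolding K_def by measurable
  have "(\<lambda>p. (fst p, snd p)) \<in> lborel \<Otimes>\<^sub>M \<mu> \<rightarrow>\<^sub>M borel \<Otimes>\<^sub>M borel"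
    by (intro measurable_Pair measurable_compose[OF measurable_snd id]) simp
  from measurable_compose[OF this K] have K1: "(\<lambda>(s, t). K s t) \<in> borel_measurable (lborel \<Otimes>\<^sub>M \<mu>)"
    by (simp add: case_prod_beta)
  have "(\<lambda>p. (snd p, fst p)) \<in> \<mu> \<Otimes>\<^sub>M lborel \<rightarrow>\<^sub>M borel \<Otimes>\<^sub>M borel"
    by (intro measurable_Pair measurable_compose[OF measurable_fst id]) simp
  from measurable_compose[OF this K] have K2: "(\<lambda>(t, s). K s t) \<in> borel_measurable (\<mu> \<Otimes>\<^sub>M lborel)"
    by (simp add: case_prod_beta)
  have A: "(\<integral>\<^sup>+s. ennreal (K s t * w \<bar>s\<bar>) \<partial>lborel) \<le> ennreal (3 * pi * w t)" if t: "t > 0" for t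
  proof -
    have "(\<integral>\<^sup>+s. ennreal (K s t * w \<bar>s\<bar>) \<partial>lborel) = (\<integral>\<^sup>+s. ennreal (1 / (sqrt \<bar>s\<bar> * (\<bar>s\<bar> + t))) \<partial>lborel)"
      using t by (simp add: K_def w_def mult.commute)
    also have "\<dots> \<le> ennreal (3 / 2 * pi * 2 / sqrt t)"
      by (rule linear_growth_schur_kernel[OF lborel.sigma_finite_measure_axioms _ _ lborel_linear_growth _ t]) auto
    finally show ?thesis using t by (simp add: w_def)
  qed
  have B: "(\<integral>\<^sup>+t. ennreal (K s t * w t) \<partial>\<mu>) \<le> ennreal (3 / 2 * pi * C * w \<bar>s\<bar>)" if s: "s \<noteq> 0" for s
  proof -
    have "(\<integral>\<^sup>+t. ennreal (K s t * w t) \<partial>\<mu>) = (\<integral>\<^sup>+t. ennreal (1 / (sqrt t * (t + \<bar>s\<bar>))) \<partial>\<mu>)"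
      by (intro nn_integral_cong) (auto simp: K_def w_def space mult.commute add.commute)
    also have "\<dots> \<le> ennreal (3 / 2 * pi * C / sqrt \<bar>s\<bar>)"
      by (rule linear_growth_schur_kernel[OF sf id _ growth C]) (use s in \<open>auto simp: space\<close>)
    finally show ?thesis by (simp add: w_def)
  qed
  have A': "AE t in \<mu>. (\<integral>\<^sup>+s. ennreal (K s t * w \<bar>s\<bar>) \<partial>lborel) \<le> ennreal (3 * pi * w t)"
    by (rule AE_I2) (use A in \<open>auto simp: space\<close>)
  have B': "AE s in lborel. (\<integral>\<^sup>+t. ennreal (K s t * w t) \<partial>\<mu>) \<le> ennreal (3 / 2 * pi * C * w \<bar>s\<bar>)"
    using AE_lborel_singleton[of 0] by eventually_elim (rule B)
  have w1: "AE t in \<mu>. w t > 0" by (rule AE_I2) (simp add: space w_def)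
  have w2: "AE s in lborel. w \<bar>s\<bar> > 0"
    using AE_lborel_singleton[of 0] by eventually_elim (simp add: w_def)
  \<comment> \<open>The Schur constants are \<open>3 * pi\<close>, from the growth constant 2 of
    Lebesgue measure, and \<open>3 / 2 * pi * C\<close>. Their product is
    \<open>9 / 2 * C * pi^2\<close>, rounded up generously.\<close>
  have const: "3 * pi * (3 / 2 * pi * C) \<le> 45 * C * pi\<^sup>2" using C by (simp add: power2_eq_square)
  have const': "3 / 2 * pi * C * (3 * pi) \<le> 45 * C * pi\<^sup>2" using C by (simp add: power2_eq_square)
  {
    assume u: "u \<in> borel_measurable borel" "\<And>s. u s \<ge> 0"
    have "(\<integral>\<^sup>+t. (\<integral>\<^sup>+s. ennreal (1 / (\<bar>s\<bar> + t) * u s) \<partial>lborel)\<^sup>2 \<partial>\<mu>) = (\<integral>\<^sup>+t. (\<integral>\<^sup>+s. ennreal (K s t * u s) \<partial>lborel)\<^sup>2 \<partial>\<mu>)"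
      by (intro nn_integral_cong) (simp add: K_def space)
    also have "\<dots> \<le> ennreal (3 * pi * (3 / 2 * pi * C)) * (\<integral>\<^sup>+s. ennreal ((u s)\<^sup>2) \<partial>lborel)"
      using schur_test[OF sf lborel.sigma_finite_measure_axioms K2 _ wm wabs K0 w0 w0 u(2) w2 _ A' _ B'] u(1) C by simp
    also have "\<dots> \<le> ennreal (45 * C * pi\<^sup>2) * (\<integral>\<^sup>+s. ennreal ((u s)\<^sup>2) \<partial>lborel)"
      by (intro mult_right_mono ennreal_leI const) simp
    finally show "(\<integral>\<^sup>+t. (\<integral>\<^sup>+s. ennreal (1 / (\<bar>s\<bar> + t) * u s) \<partial>lborel)\<^sup>2 \<partial>\<mu>) \<le> ennreal (45 * C * pi\<^sup>2) * (\<integral>\<^sup>+s. ennreal ((u s)\<^sup>2) \<partial>lborel)" .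
  }
  {
    assume v: "v \<in> borel_measurable \<mu>" "\<And>t. v t \<ge> 0"
    have "(\<integral>\<^sup>+s. (\<integral>\<^sup>+t. ennreal (1 / (\<bar>s\<bar> + t) * v t) \<partial>\<mu>)\<^sup>2 \<partial>lborel) = (\<integral>\<^sup>+s. (\<integral>\<^sup>+t. ennreal (K s t * v t) \<partial>\<mu>)\<^sup>2 \<partial>lborel)"
      by (intro nn_integral_cong arg_cong[where f="\<lambda>x. x\<^sup>2"]) (simp add: K_def space)
    also have "\<dots> \<le> ennreal (3 / 2 * pi * C * (3 * pi)) * (\<integral>\<^sup>+t. ennreal ((v t)\<^sup>2) \<partial>\<mu>)"
      using schur_test[OF lborel.sigma_finite_measure_axioms sf K1 v(1) wabs wm K0 w0 w0 v(2) w1 _ B' _ A'] C by simp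
    also have "\<dots> \<le> ennreal (45 * C * pi\<^sup>2) * (\<integral>\<^sup>+t. ennreal ((v t)\<^sup>2) \<partial>\<mu>)"
      by (intro mult_right_mono ennreal_leI const') simp
    finally show "(\<integral>\<^sup>+s. (\<integral>\<^sup>+t. ennreal (1 / (\<bar>s\<bar> + t) * v t) \<partial>\<mu>)\<^sup>2 \<partial>lborel) \<le> ennreal (45 * C * pi\<^sup>2) * (\<integral>\<^sup>+t. ennreal ((v t)\<^sup>2) \<partial>\<mu>)" .
  }
qed

text \<open>Since \<open>|s| + t \<le> 2 * |s - \<i> t|\<close>, Cauchy's formula bounds
  \<open>2 * pi * |f (\<i> t)|\<close> by twice the integral of \<open>|u s| / (|s| + t)\<close>.
  The remaining factor pi is discarded, and \<open>schur_line_to_ray\<close> finishes.\<close>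

theorem carleson_embedding_ray:
  fixes \<mu> :: "real measure" and f :: "complex \<Rightarrow> complex"
  assumes M: "positive_borel_measure_Rplus \<mu>" and C: "C \<ge> 0"
    and growth: "\<And>s. emeasure \<mu> {t\<in>space \<mu>. t \<le> s} \<le> ennreal (C * s)"
    and f: "f \<in> hardy2"
  shows "(\<integral>\<^sup>+t. ennreal ((norm (f (\<i> * complex_of_real t)))\<^sup>2) \<partial>\<mu>) \<le> ennreal (45 * C * pi\<^sup>2 * (hardy_norm f)\<^sup>2)"
proof -
  obtain u where u: "L2_boundary f u" using hardy2_L2_boundary_exists[OF f] by blast
  have um[measurable]: "u \<in> borel_measurable borel" using u by (simp add: L2_boundary_def)
  have "(\<integral>\<^sup>+t. ennreal ((norm (f (\<i> * complex_of_real t)))\<^sup>2) \<partial>\<mu>)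
     \<le> (\<integral>\<^sup>+t. (\<integral>\<^sup>+s. ennreal (1 / (\<bar>s\<bar> + t) * norm (u s)) \<partial>lborel)\<^sup>2 \<partial>\<mu>)"
  proof (rule nn_integral_mono)
    fix t assume "t \<in> space \<mu>"
    then have t: "t > 0" by (simp add: space_Rplus[OF M])
    define z where "z = \<i> * complex_of_real t"
    have z: "Im z > 0" using t by (simp add: z_def)
    have "ennreal (2 * pi * norm (f z)) = ennreal (norm (LINT s|lborel. u s / (complex_of_real s - z)))"
      unfolding L2_boundary_cauchy[OF f u z] by (simp add: norm_mult)
    also have "\<dots> \<le> (\<integral>\<^sup>+s. ennreal (norm (u s / (complex_of_real s - z))) \<partial>lborel)"
    proof (cases "integrable lborel (\<lambda>s. u s / (complex_of_real s - z))")
      case True then show ?thesis by (rule integral_norm_bound_ennreal)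
    qed (simp add: not_integrable_integral_eq)
    also have "\<dots> \<le> (\<integral>\<^sup>+s. ennreal 2 * ennreal (1 / (\<bar>s\<bar> + t) * norm (u s)) \<partial>lborel)"
    proof (rule nn_integral_mono)
      fix s
      have "\<bar>s\<bar> + t \<le> 2 * norm (complex_of_real s - z)"
        using sum_abs_le_norm[of s "- t"] t by (simp add: z_def)
      then have "1 / norm (complex_of_real s - z) \<le> 2 * (1 / (\<bar>s\<bar> + t))"
      proof -
        assume *: "\<bar>s\<bar> + t \<le> 2 * norm (complex_of_real s - z)"
        have "0 < \<bar>s\<bar> + t" using t by linarith
        with * have "1 / (2 * norm (complex_of_real s - z)) \<le> 1 / (\<bar>s\<bar> + t)"
          by (intro divide_left_mono mult_pos_pos) auto
        then show ?thesis by simp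
      qed
      then have "norm (u s) * (1 / norm (complex_of_real s - z)) \<le> norm (u s) * (2 * (1 / (\<bar>s\<bar> + t)))"
        by (rule mult_left_mono) simp
      then have "norm (u s / (complex_of_real s - z)) \<le> 2 * (1 / (\<bar>s\<bar> + t) * norm (u s))"
        by (simp add: norm_divide mult_ac)
      then have "ennreal (norm (u s / (complex_of_real s - z))) \<le> ennreal (2 * (1 / (\<bar>s\<bar> + t) * norm (u s)))" by (rule ennreal_leI)
      also have "\<dots> = ennreal 2 * ennreal (1 / (\<bar>s\<bar> + t) * norm (u s))" using t by (intro ennreal_mult) auto
      finally show "ennreal (norm (u s / (complex_of_real s - z))) \<le> ennreal 2 * ennreal (1 / (\<bar>s\<bar> + t) * norm (u s))" .
    qed
    also have "\<dots> = ennreal 2 * (\<integral>\<^sup>+s. ennreal (1 / (\<bar>s\<bar> + t) * norm (u s)) \<partial>lborel)"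
      by (rule nn_integral_cmult) measurable
    finally have "ennreal 2 * ennreal (pi * norm (f z)) \<le> ennreal 2 * (\<integral>\<^sup>+s. ennreal (1 / (\<bar>s\<bar> + t) * norm (u s)) \<partial>lborel)"
    proof -
      assume *: "ennreal (2 * pi * norm (f z)) \<le> ennreal 2 * (\<integral>\<^sup>+s. ennreal (1 / (\<bar>s\<bar> + t) * norm (u s)) \<partial>lborel)"
      have "ennreal 2 * ennreal (pi * norm (f z)) = ennreal (2 * (pi * norm (f z)))"
        by (rule ennreal_mult[symmetric]) auto
      with * show ?thesis by (simp only: mult.assoc)
    qed
    then have "ennreal (pi * norm (f z)) \<le> (\<integral>\<^sup>+s. ennreal (1 / (\<bar>s\<bar> + t) * norm (u s)) \<partial>lborel)"
      by (subst (asm) ennreal_mult_le_mult_iff) auto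
    moreover have "ennreal (norm (f z)) \<le> ennreal (pi * norm (f z))"
      using pi_gt3 by (intro ennreal_leI) (simp add: mult_le_cancel_right1)
    ultimately have "ennreal (norm (f z)) \<le> (\<integral>\<^sup>+s. ennreal (1 / (\<bar>s\<bar> + t) * norm (u s)) \<partial>lborel)" by (rule order_trans[rotated])
    then have "(ennreal (norm (f z)))\<^sup>2 \<le> (\<integral>\<^sup>+s. ennreal (1 / (\<bar>s\<bar> + t) * norm (u s)) \<partial>lborel)\<^sup>2" by (rule power_mono) simp
    then show "ennreal ((norm (f (\<i> * complex_of_real t)))\<^sup>2) \<le> (\<integral>\<^sup>+s. ennreal (1 / (\<bar>s\<bar> + t) * norm (u s)) \<partial>lborel)\<^sup>2"
      by (simp add: z_def ennreal_power)
  qed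
  also have "\<dots> \<le> ennreal (45 * C * pi\<^sup>2) * (\<integral>\<^sup>+s. ennreal ((norm (u s))\<^sup>2) \<partial>lborel)"
    by (rule schur_line_to_ray[OF M C growth]) auto
  also have "(\<integral>\<^sup>+s. ennreal ((norm (u s))\<^sup>2) \<partial>lborel) = ennreal ((hardy_norm f)\<^sup>2)"
    using hardy_norm_L2sq[OF f u] by (simp add: L2sq_def)
  also have "ennreal (45 * C * pi\<^sup>2) * \<dots> = ennreal (45 * C * pi\<^sup>2 * (hardy_norm f)\<^sup>2)"
    using C by (intro ennreal_mult[symmetric]) auto
  finally show ?thesis .
qed

text \<open>Up to a constant, \<open>k\<close> is the reproducing kernel of the Hardy space at
  \<open>\<i> x\<close>, hence the natural test function for mass at scale \<open>x\<close>. It is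
  holomorphic across the real line, so its boundary values are plain values.\<close>

lemma hardy2_reciprocal:
  assumes x: "x > 0"
  defines "k \<equiv> \<lambda>z. 1 / (z + \<i> * complex_of_real x)"
  shows "k \<in> hardy2" and "ennreal ((hardy_norm k)\<^sup>2) = ennreal (pi / x)"
proof -
  have ne: "z + \<i> * complex_of_real x \<noteq> 0" if "Im z \<ge> 0" for z
    using that x by (auto simp: complex_eq_iff)
  have k: "k (Complex s y) = 1 / (complex_of_real s - Complex 0 (- (y + x)))" for s y
  proof -
    have "Complex s y + \<i> * complex_of_real x = complex_of_real s - Complex 0 (- (y + x))"
      by (simp add: complex_eq_iff)
    then show ?thesis by (simp add: k_def)
  qed
  have L2: "L2sq lborel (\<lambda>s. k (Complex s y)) = ennreal (pi / (y + x))" if "y \<ge> 0" for y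
    unfolding k using that x by (subst L2sq_cauchy_kernel) auto
  show "k \<in> hardy2"
  proof (rule hardy2I)
    show "k holomorphic_on upper_half_plane" unfolding k_def
      by (intro holomorphic_intros) (use ne in \<open>auto simp: upper_half_plane_iff intro: less_imp_le\<close>)
    show "L2sq lborel (\<lambda>s. k (Complex s y)) \<le> ennreal (pi / x)" if "y > 0" for y
      using L2[of y] that x by (simp add: ennreal_leI frac_le)
  qed simp
  have bv: "boundary_value k s = k (complex_of_real s)" for s
  proof (rule boundary_value_eqI)
    have "isCont k (complex_of_real s)" unfolding k_def by (intro continuous_intros) (use ne[of "complex_of_real s"] in simp)
    then show "has_nontangential_limit k s (k (complex_of_real s))"
      unfolding has_nontangential_limit_def isCont_def by (auto intro: tendsto_within_subset)
  qed
  have m: "(\<lambda>s. (norm (k (complex_of_real s)))\<^sup>2) \<in> borel_measurable borel"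
    unfolding k_def by measurable
  have "(LINT s|lebesgue. (norm (boundary_value k s))\<^sup>2) = (LINT s|lborel. (norm (k (complex_of_real s)))\<^sup>2)"
    unfolding bv using m by (intro integral_completion) simp
  also have "\<dots> = enn2real (L2sq lborel (\<lambda>s. k (Complex s 0)))"
    unfolding L2sq_def using m by (subst integral_eq_nn_integral) (auto simp: Complex_eq)
  also have "\<dots> = pi / x" using L2[of 0] x by simp
  finally show "ennreal ((hardy_norm k)\<^sup>2) = ennreal (pi / x)" using x by (simp add: hardy_norm_def)
qed

text \<open>The test function satisfies \<open>|k (\<i> t)|^2 = 1 / (t + x)^2\<close>. On
  \<open>(0, x)\<close> this is at least \<open>1 / (2 x)^2\<close>; on
  \<open>(y, \<infinity>)\<close> with \<open>y = 1 / x\<close> and \<i> \<open>y\<close> as the new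
  base point, \<open>(t + y)^2 \<le> 4 * (1 + t^2)\<close> compares it with the density of \<rho>.
  In both cases the norm \<open>pi / x\<close> or \<open>pi / y\<close> yields order
  \<open>x\<close>.\<close>

lemma bigo_of_carleson:
  fixes \<mu> \<rho> :: "real measure"
  assumes M: "positive_borel_measure_Rplus \<mu>" and \<rho>: "\<rho> = density \<mu> (\<lambda>t. ennreal (1 / (1 + t\<^sup>2)))"
    and a: "\<And>f. f \<in> hardy2 \<Longrightarrow> (\<integral>\<^sup>+ t. ennreal ((norm (f (\<i> * complex_of_real t)))\<^sup>2) \<partial>\<mu>) \<le> ennreal (\<alpha> * (hardy_norm f)\<^sup>2)"
  shows "bigo_id_at_0 (\<lambda>x. emeasure \<rho> {0<..<x})" "bigo_id_at_0 (\<lambda>x. emeasure \<rho> {inverse x<..})"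
proof -
  note dm = measurable_density_Rplus[OF M]
  \<comment> \<open>\<alpha> may be negative, and then \<open>ennreal\<close> truncates the right
    side to 0; products split only for nonnegative factors.\<close>
  define \<alpha>' where "\<alpha>' = max \<alpha> 0"
  have "\<alpha>' \<ge> 0" by (simp add: \<alpha>'_def)
  have km: "(\<lambda>t. ennreal (1 / (t + x)\<^sup>2)) \<in> borel_measurable \<mu>" if "x > 0" for x
    by (rule measurable_compose[OF _ measurable_ennreal], rule borel_measurable_Rplus[OF M])
      (use that in \<open>auto intro!: continuous_intros\<close>)
  have kernel: "(\<integral>\<^sup>+t. ennreal (1 / (t + x)\<^sup>2) \<partial>\<mu>) \<le> ennreal (\<alpha>' * (pi / x))" if x: "x > 0" for x
  proof -
    let ?k = "\<lambda>z. 1 / (z + \<i> * complex_of_real x)"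
    have "(norm (?k (\<i> * complex_of_real t)))\<^sup>2 = 1 / (t + x)\<^sup>2" for t
    proof -
      have "\<i> * complex_of_real t + \<i> * complex_of_real x = \<i> * complex_of_real (t + x)" by (simp add: distrib_left)
      then show ?thesis by (simp only: norm_divide norm_mult norm_ii norm_of_real) (simp add: power_divide)
    qed
    then have "(\<integral>\<^sup>+t. ennreal (1 / (t + x)\<^sup>2) \<partial>\<mu>) = (\<integral>\<^sup>+ t. ennreal ((norm (?k (\<i> * complex_of_real t)))\<^sup>2) \<partial>\<mu>)" by simp
    also have "\<dots> \<le> ennreal (\<alpha> * (hardy_norm ?k)\<^sup>2)" by (rule a[OF hardy2_reciprocal(1)[OF x]])
    also have "\<dots> \<le> ennreal (\<alpha>' * (hardy_norm ?k)\<^sup>2)" by (intro ennreal_leI mult_right_mono) (auto simp: \<alpha>'_def)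
    also have "\<dots> = ennreal \<alpha>' * ennreal ((hardy_norm ?k)\<^sup>2)" using \<open>\<alpha>' \<ge> 0\<close> by (intro ennreal_mult) auto
    also have "\<dots> = ennreal (\<alpha>' * (pi / x))"
      unfolding hardy2_reciprocal(2)[OF x] using \<open>\<alpha>' \<ge> 0\<close> x by (intro ennreal_mult[symmetric]) auto
    finally show ?thesis .
  qed
  have bound: "emeasure \<rho> A \<le> ennreal (c * (\<alpha>' * (pi / x)))"
    if A: "A \<in> sets \<mu>" and x: "x > 0" and c: "c \<ge> 0" and le: "\<And>t. t \<in> A \<Longrightarrow> 1 / (1 + t\<^sup>2) \<le> c * (1 / (t + x)\<^sup>2)" for A x c
  proof -
    have "emeasure \<rho> A = (\<integral>\<^sup>+t. ennreal (1 / (1 + t\<^sup>2)) * indicator A t \<partial>\<mu>)"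
      unfolding \<rho> by (rule emeasure_density[OF dm A])
    also have "\<dots> \<le> (\<integral>\<^sup>+t. ennreal c * ennreal (1 / (t + x)\<^sup>2) \<partial>\<mu>)"
    proof (rule nn_integral_mono)
      fix t
      show "ennreal (1 / (1 + t\<^sup>2)) * indicator A t \<le> ennreal c * ennreal (1 / (t + x)\<^sup>2)"
      proof (cases "t \<in> A")
        case True
        have "ennreal (1 / (1 + t\<^sup>2)) \<le> ennreal (c * (1 / (t + x)\<^sup>2))" by (rule ennreal_leI) (rule le[OF True])
        also have "\<dots> = ennreal c * ennreal (1 / (t + x)\<^sup>2)" using c by (rule ennreal_mult) simp
        finally show ?thesis using True by simp
      qed simp
    qed
    also have "\<dots> = ennreal c * (\<integral>\<^sup>+t. ennreal (1 / (t + x)\<^sup>2) \<partial>\<mu>)" by (rule nn_integral_cmult[OF km[OF x]])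
    also have "\<dots> \<le> ennreal c * ennreal (\<alpha>' * (pi / x))" by (intro mult_left_mono kernel x) simp
    also have "\<dots> = ennreal (c * (\<alpha>' * (pi / x)))" using c \<open>\<alpha>' \<ge> 0\<close> x by (intro ennreal_mult[symmetric]) auto
    finally show ?thesis .
  qed
  have "emeasure \<rho> {0<..<x} \<le> ennreal (4 * \<alpha>' * pi * x)" if x: "x > 0" for x
  proof -
    have "emeasure \<rho> {0<..<x} \<le> ennreal ((2 * x)\<^sup>2 * (\<alpha>' * (pi / x)))"
    proof (rule bound[OF _ x])
      fix t assume t: "t \<in> {0<..<x}"
      have "(t + x)\<^sup>2 \<le> (2 * x)\<^sup>2" using t by (intro power_mono) auto
      then have "1 \<le> (2 * x)\<^sup>2 * (1 / (t + x)\<^sup>2)" using t by simp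
      moreover have "1 / (1 + t\<^sup>2) \<le> 1" by (simp add: divide_le_eq_1 add_pos_nonneg)
      ultimately show "1 / (1 + t\<^sup>2) \<le> (2 * x)\<^sup>2 * (1 / (t + x)\<^sup>2)" by linarith
    qed (auto intro!: sets_Rplus[OF M])
    also have "(2 * x)\<^sup>2 * (\<alpha>' * (pi / x)) = 4 * \<alpha>' * pi * x" using x by (simp add: power2_eq_square)
    finally show ?thesis .
  qed
  then show "bigo_id_at_0 (\<lambda>x. emeasure \<rho> {0<..<x})"
    unfolding bigo_id_at_0_def by (intro exI[of _ "4 * \<alpha>' * pi"]) (auto simp: eventually_at_right_field intro!: exI[of _ 1])
  have "emeasure \<rho> {inverse x<..} \<le> ennreal (4 * \<alpha>' * pi * x)" if x: "x > 0" for x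
  proof -
    define y where "y = inverse x"
    have y: "y > 0" using x by (simp add: y_def)
    have "emeasure \<rho> {y<..} \<le> ennreal (4 * (\<alpha>' * (pi / y)))"
    proof (rule bound[OF _ y])
      fix t assume t: "t \<in> {y<..}"
      then have t0: "t > 0" using y by simp
      have "(t + y)\<^sup>2 \<le> (2 * t)\<^sup>2" using t y by (intro power_mono) auto
      also have "\<dots> \<le> 4 * (1 + t\<^sup>2)" by (simp add: power_mult_distrib)
      finally have le: "(t + y)\<^sup>2 \<le> 4 * (1 + t\<^sup>2)" .
      have p: "(t + y)\<^sup>2 > 0" using t0 y by simp
      have p': "1 + t\<^sup>2 > 0" by (simp add: add_pos_nonneg)
      show "1 / (1 + t\<^sup>2) \<le> 4 * (1 / (t + y)\<^sup>2)" using le p p' by (simp add: divide_simps)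
    qed (use y in \<open>auto intro!: sets_Rplus[OF M]\<close>)
    also have "4 * (\<alpha>' * (pi / y)) = 4 * \<alpha>' * pi * x" by (simp add: y_def divide_inverse)
    finally show ?thesis by (simp add: y_def)
  qed
  then show "bigo_id_at_0 (\<lambda>x. emeasure \<rho> {inverse x<..})"
    unfolding bigo_id_at_0_def by (intro exI[of _ "4 * \<alpha>' * pi"]) (auto simp: eventually_at_right_field intro!: exI[of _ 1])
qed

section \<open>The Hankel operator of a Carleson measure\<close>

text \<open>The growth condition is fixed instead of (a) or (b) because it is the form in which both
  kernel estimates consume the measure.\<close>

locale carleson_ray =
  fixes M :: "real measure" and C :: real
  assumes M: "positive_borel_measure_Rplus M" and C: "C \<ge> 0"
    and growth: "\<And>s. emeasure M {t\<in>space M. t \<le> s} \<le> ennreal (C * s)"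
begin

sublocale sigma_finite_measure M by (rule sigma_finite_Rplus[OF M])

sublocale line_ray: pair_sigma_finite lborel M
  by (intro pair_sigma_finite.intro lborel.sigma_finite_measure_axioms sigma_finite_measure_axioms)

lemma space_M: "space M = {0<..}" by (rule space_Rplus[OF M])

lemma ident_measurable: "(\<lambda>t. t) \<in> borel_measurable M"
  by (rule borel_measurable_Rplus[OF M]) (intro continuous_intros)

lemma snd_measurable: "(\<lambda>p. snd p) \<in> borel_measurable (lborel \<Otimes>\<^sub>M M)"
  by (rule measurable_compose[OF measurable_snd ident_measurable])

text \<open>Defined for arbitrary densities \<open>G\<close>, since a difference quotient in
  \<open>z\<close> is again such a transform, with \<open>G t\<close> replaced by
  \<open>- G t / (z + \<i> t)\<close>.\<close>

definition cauchy_transform :: "(real \<Rightarrow> complex) \<Rightarrow> complex \<Rightarrow> complex" where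
  "cauchy_transform G z = (LINT t|M. G t / (z + \<i> * complex_of_real t))"

lemma norm_plus_ray:
  assumes "Im z \<ge> 0" "t > 0"
  shows "\<bar>Re z\<bar> + Im z + t \<le> 2 * norm (z + \<i> * complex_of_real t)"
proof -
  have "complex_of_real (Re z) + \<i> * complex_of_real (Im z + t) = z + \<i> * complex_of_real t"
    by (simp add: complex_eq_iff)
  with sum_abs_le_norm[of "Re z" "Im z + t"] assms show ?thesis by simp
qed

lemma inverse_norm_plus_ray:
  assumes "Im z \<ge> 0" "t > 0" "0 \<le> r" "r \<le> \<bar>Re z\<bar> + Im z"
  shows "1 / norm (z + \<i> * complex_of_real t) \<le> 2 * (1 / (r + t))"
proof -
  have le: "r + t \<le> 2 * norm (z + \<i> * complex_of_real t)" using norm_plus_ray[OF assms(1,2)] assms(4) by simp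
  have "r + t > 0" using assms by linarith
  with le have "1 / (2 * norm (z + \<i> * complex_of_real t)) \<le> 1 / (r + t)"
    by (intro divide_left_mono mult_pos_pos) auto
  then show ?thesis by simp
qed

text \<open>Linear growth puts \<open>1 / (r + t)\<close> into \<open>L\<^sup>2\<close> of the
  measure, by the Poisson kernel estimate with \<open>y = r\<close>; Cauchy-Schwarz does the
  rest.\<close>

lemma majorant_integrable:
  assumes G: "G \<in> borel_measurable M" "L2sq M G < \<infinity>" and r: "r > 0"
  shows "integrable M (\<lambda>t. norm (G t) * (1 / (r + t)))"
proof -
  have m: "(\<lambda>t. complex_of_real (1 / (r + t))) \<in> borel_measurable M"
    by (rule borel_measurable_Rplus[OF M], rule continuous_on_of_real) (use r in \<open>auto intro!: continuous_intros\<close>)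
  have "L2sq M (\<lambda>t. complex_of_real (1 / (r + t))) = (\<integral>\<^sup>+t. ennreal (1 / r) * ennreal (r / (t + r)\<^sup>2) \<partial>M)"
    unfolding L2sq_def
    using r by (intro nn_integral_cong) (simp add: norm_divide power_divide ennreal_mult[symmetric] add.commute del: of_real_add)
  also have "\<dots> = ennreal (1 / r) * (\<integral>\<^sup>+t. ennreal (r / (t + r)\<^sup>2) \<partial>M)"
    by (rule nn_integral_cmult, rule measurable_compose[OF _ measurable_ennreal], rule borel_measurable_Rplus[OF M])
      (use r in \<open>auto intro!: continuous_intros\<close>)
  also have "\<dots> \<le> ennreal (1 / r) * ennreal (2 * C)"
    by (intro mult_left_mono linear_growth_poisson_kernel[OF sigma_finite_measure_axioms ident_measurable _ growth C r])
      (auto simp: space_M)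
  also have "\<dots> < \<infinity>" by (simp add: ennreal_mult_less_top)
  finally have "integrable M (\<lambda>t. G t * complex_of_real (1 / (r + t)))"
    by (intro L2sq_mult_integrable G m)
  then have "integrable M (\<lambda>t. norm (G t * complex_of_real (1 / (r + t))))" by simp
  moreover have "norm (G t * complex_of_real (1 / (r + t))) = norm (G t) * (1 / (r + t))" if "t \<in> space M" for t
    using that r by (simp add: norm_mult norm_divide space_M del: of_real_add)
  ultimately show ?thesis by (simp cong: Bochner_Integration.integrable_cong)
qed

lemma cauchy_integrand_measurable:
  assumes "G \<in> borel_measurable M"
  shows "(\<lambda>t. G t / (z + \<i> * complex_of_real t)) \<in> borel_measurable M"
proof -
  have "(\<lambda>t. z + \<i> * complex_of_real t) \<in> borel_measurable M"
    by (rule borel_measurable_Rplus[OF M]) (intro continuous_intros)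
  then show ?thesis using assms by (rule borel_measurable_divide[rotated])
qed

lemma cauchy_transform_integrable:
  assumes G: "G \<in> borel_measurable M" "L2sq M G < \<infinity>" and z: "Im z \<ge> 0" "z \<noteq> 0"
  shows "integrable M (\<lambda>t. G t / (z + \<i> * complex_of_real t))"
proof (rule Bochner_Integration.integrable_bound)
  let ?r = "\<bar>Re z\<bar> + Im z"
  have r: "?r > 0" using z by (auto simp: complex_eq_iff)
  show "integrable M (\<lambda>t. 2 * (norm (G t) * (1 / (?r + t))))"
    by (intro integrable_mult_right majorant_integrable G r)
  show "AE t in M. norm (G t / (z + \<i> * complex_of_real t)) \<le> norm (2 * (norm (G t) * (1 / (?r + t))))"
  proof (rule AE_I2)
    fix t assume "t \<in> space M"
    then have t: "t > 0" by (simp add: space_M)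
    have "norm (G t) * (1 / norm (z + \<i> * complex_of_real t)) \<le> norm (G t) * (2 * (1 / (?r + t)))"
      using r by (intro mult_left_mono inverse_norm_plus_ray z t) auto
    then show "norm (G t / (z + \<i> * complex_of_real t)) \<le> norm (2 * (norm (G t) * (1 / (?r + t))))"
      using r t by (simp add: norm_divide abs_of_pos mult.commute)
  qed
qed (rule cauchy_integrand_measurable[OF G(1)])

lemma near_boundary_sum:
  assumes "norm (w - z) \<le> (\<bar>Re z\<bar> + Im z) / 4"
  shows "(\<bar>Re z\<bar> + Im z) / 2 \<le> \<bar>Re w\<bar> + Im w"
  using assms abs_Re_le_cmod[of "w - z"] abs_Im_le_cmod[of "w - z"] by auto

lemma plus_ray_nonzero: "Im z \<ge> 0 \<Longrightarrow> t > 0 \<Longrightarrow> z + \<i> * complex_of_real t \<noteq> 0"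
  by (auto simp: complex_eq_iff)

text \<open>Valid up to the real line: the distance that matters is \<open>|Re z| + Im z\<close>,
  which vanishes only at the origin. Of the two denominators in the difference, one keeps the
  integrable majorant and the other is bounded by a constant.\<close>

lemma cauchy_transform_lipschitz:
  assumes G: "G \<in> borel_measurable M" "L2sq M G < \<infinity>" and z: "Im z \<ge> 0" "z \<noteq> 0"
  shows "\<exists>K. \<forall>w. Im w \<ge> 0 \<longrightarrow> norm (w - z) \<le> (\<bar>Re z\<bar> + Im z) / 4 \<longrightarrow>
    norm (cauchy_transform G w - cauchy_transform G z) \<le> K * norm (w - z)"
proof (intro exI allI impI)
  let ?r = "\<bar>Re z\<bar> + Im z"
  have r: "?r > 0" using z by (auto simp: complex_eq_iff)
  fix w assume w: "Im w \<ge> 0" "norm (w - z) \<le> ?r / 4"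
  have s: "?r / 2 \<le> \<bar>Re w\<bar> + Im w" by (rule near_boundary_sum[OF w(2)])
  have w0: "w \<noteq> 0" using s r by auto
  have "norm (cauchy_transform G w - cauchy_transform G z) =
      norm (LINT t|M. G t / (w + \<i> * complex_of_real t) - G t / (z + \<i> * complex_of_real t))"
    unfolding cauchy_transform_def
    by (subst Bochner_Integration.integral_diff) (auto intro!: cauchy_transform_integrable G z w w0)
  also have "\<dots> \<le> (LINT t|M. (4 / ?r * norm (w - z)) * (norm (G t) * (1 / (?r / 2 + t))))"
  proof (rule Bochner_Integration.integral_norm_bound_integral)
    show "integrable M (\<lambda>t. (4 / ?r * norm (w - z)) * (norm (G t) * (1 / (?r / 2 + t))))"
      using r by (intro integrable_mult_right majorant_integrable G) auto
    show "integrable M (\<lambda>t. G t / (w + \<i> * complex_of_real t) - G t / (z + \<i> * complex_of_real t))"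
      by (intro Bochner_Integration.integrable_diff cauchy_transform_integrable G z w w0)
    fix t assume "t \<in> space M"
    then have t: "t > 0" by (simp add: space_M)
    let ?a = "w + \<i> * complex_of_real t" and ?b = "z + \<i> * complex_of_real t"
    have nz: "?a \<noteq> 0" "?b \<noteq> 0" by (rule plus_ray_nonzero[OF w(1) t], rule plus_ray_nonzero[OF z(1) t])
    have "G t / ?a - G t / ?b = G t * (z - w) / (?a * ?b)"
      using nz by (simp add: field_simps)
    then have eq: "norm (G t / ?a - G t / ?b) = (norm (w - z) * norm (G t)) * (1 / norm ?a * (1 / norm ?b))"
      by (simp add: norm_mult norm_divide norm_minus_commute)
    have b1: "1 / norm ?a \<le> 2 * (1 / (?r / 2 + t))" using r by (intro inverse_norm_plus_ray w t s) auto
    have b2: "1 / norm ?b \<le> 2 * (1 / ?r)"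
    proof -
      have "1 / norm ?b \<le> 2 * (1 / (?r + t))" using r by (intro inverse_norm_plus_ray z t) auto
      also have "\<dots> \<le> 2 * (1 / ?r)" using r t by (intro mult_left_mono divide_left_mono mult_pos_pos) auto
      finally show ?thesis .
    qed
    have "norm (G t / ?a - G t / ?b) \<le> (norm (w - z) * norm (G t)) * (2 * (1 / (?r / 2 + t)) * (2 * (1 / ?r)))"
      unfolding eq using r t by (intro mult_left_mono mult_mono b1 b2) auto
    then show "norm (G t / ?a - G t / ?b) \<le> (4 / ?r * norm (w - z)) * (norm (G t) * (1 / (?r / 2 + t)))"
      by (simp add: mult_ac)
  qed
  also have "\<dots> = (4 / ?r * (LINT t|M. norm (G t) * (1 / (?r / 2 + t)))) * norm (w - z)"
    by (subst integral_mult_right_zero) (simp add: mult_ac)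
  finally show "norm (cauchy_transform G w - cauchy_transform G z) \<le> (4 / ?r * (LINT t|M. norm (G t) * (1 / (?r / 2 + t)))) * norm (w - z)" .
qed

lemma cauchy_transform_tendsto:
  assumes G: "G \<in> borel_measurable M" "L2sq M G < \<infinity>" and z: "Im z \<ge> 0" "z \<noteq> 0"
    and S: "S \<subseteq> {w. Im w \<ge> 0}"
  shows "(cauchy_transform G \<longlongrightarrow> cauchy_transform G z) (at z within S)"
proof -
  obtain K where K: "\<And>w. Im w \<ge> 0 \<Longrightarrow> norm (w - z) \<le> (\<bar>Re z\<bar> + Im z) / 4 \<Longrightarrow>
    norm (cauchy_transform G w - cauchy_transform G z) \<le> K * norm (w - z)"
    using cauchy_transform_lipschitz[OF G z] by blast
  have r: "(\<bar>Re z\<bar> + Im z) / 4 > 0" using z by (auto simp: complex_eq_iff)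
  have "\<forall>\<^sub>F w in at z within S. norm (cauchy_transform G w - cauchy_transform G z) \<le> K * norm (w - z)"
    unfolding eventually_at
    by (intro exI[of _ "(\<bar>Re z\<bar> + Im z) / 4"] conjI r ballI impI K) (use S in \<open>auto simp: dist_norm\<close>)
  moreover have "((\<lambda>w. K * norm (w - z)) \<longlongrightarrow> K * norm (z - z)) (at z within S)"
    by (intro tendsto_intros)
  ultimately have "((\<lambda>w. cauchy_transform G w - cauchy_transform G z) \<longlongrightarrow> 0) (at z within S)"
    by (intro Lim_null_comparison[of "\<lambda>w. cauchy_transform G w - cauchy_transform G z" "\<lambda>w. K * norm (w - z)"]) simp_all
  then show ?thesis by (simp add: LIM_zero_iff)
qed

text \<open>The difference quotient at \<open>z\<close> is exactly the transform of
  \<open>G'\<close>, which is again square integrable because \<open>|z + \<i> t|\<close> is bounded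
  below. Continuity of that transform at \<open>z\<close> is then differentiability, without
  differentiating under the integral.\<close>

lemma cauchy_transform_holomorphic:
  assumes G: "G \<in> borel_measurable M" "L2sq M G < \<infinity>"
  shows "cauchy_transform G holomorphic_on upper_half_plane"
proof -
  have "open upper_half_plane" unfolding upper_half_plane_def by (intro open_Collect_less continuous_intros)
  moreover have "\<exists>D. (cauchy_transform G has_field_derivative D) (at z)" if "z \<in> upper_half_plane" for z
  proof -
    have z: "Im z > 0" using that by (simp add: upper_half_plane_iff)
    then have z': "Im z \<ge> 0" "z \<noteq> 0" by auto
    define G' where "G' t = - G t / (z + \<i> * complex_of_real t)" for t
    have G'm: "G' \<in> borel_measurable M"
      unfolding G'_def by (rule cauchy_integrand_measurable) (use G(1) in simp)
    have "L2sq M G' \<le> L2sq M (\<lambda>t. complex_of_real (2 / Im z) * G t)"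
    proof (rule L2sq_mono_AE, rule AE_I2)
      fix t assume "t \<in> space M"
      then have t: "t > 0" by (simp add: space_M)
      have "1 / norm (z + \<i> * complex_of_real t) \<le> 2 * (1 / (Im z + t))" using z t by (intro inverse_norm_plus_ray) auto
      also have "\<dots> \<le> 2 * (1 / Im z)" using z t by (intro mult_left_mono divide_left_mono mult_pos_pos) auto
      finally have "norm (G t) * (1 / norm (z + \<i> * complex_of_real t)) \<le> norm (G t) * (2 / Im z)"
        by (intro mult_left_mono) auto
      then show "norm (G' t) \<le> norm (complex_of_real (2 / Im z) * G t)"
        using z by (simp add: G'_def norm_divide norm_mult mult.commute)
    qed
    also have "\<dots> < \<infinity>" using G by (subst L2sq_cmult) (auto simp: ennreal_mult_less_top)
    finally have G': "G' \<in> borel_measurable M" "L2sq M G' < \<infinity>" using G'm by auto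
    have quot: "(cauchy_transform G w - cauchy_transform G z) / (w - z) = cauchy_transform G' w"
      if w: "Im w \<ge> 0" "w \<noteq> 0" "w \<noteq> z" for w
    proof -
      have "(cauchy_transform G w - cauchy_transform G z) / (w - z) =
        (LINT t|M. (G t / (w + \<i> * complex_of_real t) - G t / (z + \<i> * complex_of_real t))) / (w - z)"
        unfolding cauchy_transform_def
        by (subst Bochner_Integration.integral_diff) (auto intro!: cauchy_transform_integrable G z' w)
      also have "\<dots> = (LINT t|M. (G t / (w + \<i> * complex_of_real t) - G t / (z + \<i> * complex_of_real t)) / (w - z))"
        by (rule integral_divide_zero[symmetric])
      also have "\<dots> = cauchy_transform G' w"
        unfolding cauchy_transform_def
      proof (rule Bochner_Integration.integral_cong)
        fix t assume "t \<in> space M"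
        then have t: "t > 0" by (simp add: space_M)
        let ?a = "w + \<i> * complex_of_real t" and ?b = "z + \<i> * complex_of_real t"
        have nz: "?a \<noteq> 0" "?b \<noteq> 0" by (rule plus_ray_nonzero[OF w(1) t], rule plus_ray_nonzero[OF z'(1) t])
        have gen: "g * (- d) / (a * b) = d * (- g / b / a)" for g d a b :: complex by (simp add: mult_ac)
        have "G t / ?a - G t / ?b = G t * (z - w) / (?a * ?b)"
          using nz by (simp add: field_simps)
        also have "\<dots> = (w - z) * (- G t / ?b / ?a)" using gen[of "G t" "w - z" ?a ?b] by simp
        finally have "G t / ?a - G t / ?b = (w - z) * (- G t / ?b / ?a)" .
        then show "(G t / ?a - G t / ?b) / (w - z) = G' t / ?a" using w(3) by (simp add: G'_def)
      qed simp
      finally show ?thesis .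
    qed
    have "(cauchy_transform G' \<longlongrightarrow> cauchy_transform G' z) (at z within upper_half_plane)"
      by (rule cauchy_transform_tendsto[OF G' z']) (auto simp: upper_half_plane_iff)
    moreover have "\<forall>\<^sub>F w in at z within upper_half_plane. (cauchy_transform G w - cauchy_transform G z) / (w - z) = cauchy_transform G' w"
      unfolding eventually_at_filter by (intro always_eventually allI impI quot) (auto simp: upper_half_plane_iff)
    ultimately have "((\<lambda>w. (cauchy_transform G w - cauchy_transform G z) / (w - z)) \<longlongrightarrow> cauchy_transform G' z) (at z within upper_half_plane)"
      by (simp cong: tendsto_cong)
    then have "(cauchy_transform G has_field_derivative cauchy_transform G' z) (at z within upper_half_plane)"
      by (simp add: has_field_derivative_iff)
    then show ?thesis using at_within_open[OF that \<open>open upper_half_plane\<close>] by auto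
  qed
  ultimately show ?thesis by (simp add: holomorphic_on_open)
qed

lemma cauchy_transform_abs_le:
  assumes z: "Im z \<ge> 0"
  shows "(\<integral>\<^sup>+t. ennreal (norm (G t / (z + \<i> * complex_of_real t))) \<partial>M) \<le> (\<integral>\<^sup>+t. ennreal (1 / (\<bar>Re z\<bar> + t) * (2 * norm (G t))) \<partial>M)"
proof (rule nn_integral_mono)
  fix t assume "t \<in> space M"
  then have t: "t > 0" by (simp add: space_M)
  have "norm (G t) * (1 / norm (z + \<i> * complex_of_real t)) \<le> norm (G t) * (2 * (1 / (\<bar>Re z\<bar> + t)))"
    using z by (intro mult_left_mono inverse_norm_plus_ray t) auto
  then show "ennreal (norm (G t / (z + \<i> * complex_of_real t))) \<le> ennreal (1 / (\<bar>Re z\<bar> + t) * (2 * norm (G t)))"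
    by (intro ennreal_leI) (simp add: norm_divide mult_ac)
qed

text \<open>The kernel is dominated by \<open>2 / (|x| + t)\<close> whatever the height, so one
  application of \<open>schur_ray_to_line\<close> serves all lines, including the real line
  \<open>y = 0\<close>.\<close>

lemma cauchy_transform_L2sq:
  assumes G: "G \<in> borel_measurable M" and y: "y \<ge> 0"
  shows "L2sq lborel (\<lambda>x. cauchy_transform G (Complex x y)) \<le> ennreal (45 * C * pi\<^sup>2) * (4 * L2sq M G)"
proof -
  have "L2sq lborel (\<lambda>x. cauchy_transform G (Complex x y)) \<le> (\<integral>\<^sup>+x. (\<integral>\<^sup>+t. ennreal (1 / (\<bar>x\<bar> + t) * (2 * norm (G t))) \<partial>M)\<^sup>2 \<partial>lborel)"
    unfolding L2sq_def
  proof (rule nn_integral_mono)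
    fix x
    have "ennreal (norm (cauchy_transform G (Complex x y))) \<le> (\<integral>\<^sup>+t. ennreal (norm (G t / (Complex x y + \<i> * complex_of_real t))) \<partial>M)"
      unfolding cauchy_transform_def
    proof (cases "integrable M (\<lambda>t. G t / (Complex x y + \<i> * complex_of_real t))")
      case True then show "ennreal (norm (LINT t|M. G t / (Complex x y + \<i> * complex_of_real t))) \<le> (\<integral>\<^sup>+t. ennreal (norm (G t / (Complex x y + \<i> * complex_of_real t))) \<partial>M)"
        by (rule integral_norm_bound_ennreal)
    qed (simp add: not_integrable_integral_eq)
    also have "\<dots> \<le> (\<integral>\<^sup>+t. ennreal (1 / (\<bar>x\<bar> + t) * (2 * norm (G t))) \<partial>M)"
      using cauchy_transform_abs_le[of "Complex x y" G] y by simp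
    finally have "(ennreal (norm (cauchy_transform G (Complex x y))))\<^sup>2 \<le> (\<integral>\<^sup>+t. ennreal (1 / (\<bar>x\<bar> + t) * (2 * norm (G t))) \<partial>M)\<^sup>2"
      by (rule power_mono) simp
    then show "ennreal ((norm (cauchy_transform G (Complex x y)))\<^sup>2) \<le> (\<integral>\<^sup>+t. ennreal (1 / (\<bar>x\<bar> + t) * (2 * norm (G t))) \<partial>M)\<^sup>2"
      by (simp add: ennreal_power)
  qed
  also have "\<dots> \<le> ennreal (45 * C * pi\<^sup>2) * (\<integral>\<^sup>+t. ennreal ((2 * norm (G t))\<^sup>2) \<partial>M)"
    by (rule schur_ray_to_line[OF M C growth]) (use G in auto)
  also have "(\<integral>\<^sup>+t. ennreal ((2 * norm (G t))\<^sup>2) \<partial>M) = 4 * L2sq M G"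
    unfolding L2sq_def using G by (subst nn_integral_cmult[symmetric]) (auto simp: power_mult_distrib ennreal_mult)
  finally show ?thesis .
qed

end

lemma L2sq_cnj: "L2sq M (\<lambda>x. cnj (f x)) = L2sq M f"
  by (simp add: L2sq_def)

context carleson_ray
begin

section \<open>Pairings with Hardy functions, by Fubini over line and ray\<close>

lemma line_ray_integrableI:
  assumes "(\<lambda>(x, t). F x t :: complex) \<in> borel_measurable (lborel \<Otimes>\<^sub>M M)"
    and "(\<integral>\<^sup>+x. \<integral>\<^sup>+t. ennreal (norm (F x t)) \<partial>M \<partial>lborel) < \<infinity>"
  shows "integrable (lborel \<Otimes>\<^sub>M M) (\<lambda>(x, t). F x t)"
proof (rule integrableI_bounded[OF assms(1)])
  have "(\<lambda>p. ennreal (norm (case p of (x, t) \<Rightarrow> F x t))) \<in> borel_measurable (lborel \<Otimes>\<^sub>M M)"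
    by (rule measurable_compose[OF measurable_compose[OF assms(1) borel_measurable_norm] measurable_ennreal])
  from nn_integral_fst[OF this] assms(2)
  show "(\<integral>\<^sup>+p. ennreal (norm (case p of (x, t) \<Rightarrow> F x t)) \<partial>(lborel \<Otimes>\<^sub>M M)) < \<infinity>" by simp
qed

lemma cauchy_kernel_measurable:
  assumes "G \<in> borel_measurable M"
  shows "(\<lambda>(x, t). G t / (complex_of_real x + \<i> * complex_of_real t)) \<in> borel_measurable (lborel \<Otimes>\<^sub>M M)"
proof -
  have fstm: "(\<lambda>p. fst p) \<in> borel_measurable (lborel \<Otimes>\<^sub>M M)"
    by (rule measurable_compose[OF measurable_fst]) simp
  have "(\<lambda>p. G (snd p) / (complex_of_real (fst p) + \<i> * complex_of_real (snd p))) \<in> borel_measurable (lborel \<Otimes>\<^sub>M M)"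
    by (intro borel_measurable_divide borel_measurable_add borel_measurable_times borel_measurable_const
        measurable_compose[OF measurable_snd assms] measurable_compose[OF snd_measurable borel_measurable_of_real]
        measurable_compose[OF fstm borel_measurable_of_real])
  then show ?thesis by (simp add: case_prod_beta)
qed

lemma cauchy_transform_measurable:
  assumes "G \<in> borel_measurable M"
  shows "(\<lambda>x. cauchy_transform G (complex_of_real x)) \<in> borel_measurable borel"
  using borel_measurable_lebesgue_integral[OF cauchy_kernel_measurable[OF assms]]
  by (simp add: cauchy_transform_def)

text \<open>After exchanging the integrals, \<open>1 / (x + \<i> t)\<close> is the conjugate of
  \<open>1 / (x - \<i> t)\<close>, so the inner integral is the conjugated Cauchy formula for
  \<open>q\<close> at \<open>\<i> t\<close>; this explains the sign of
  \<open>- 2 * pi * \<i>\<close>.\<close>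

lemma cauchy_transform_pairing:
  fixes q :: "complex \<Rightarrow> complex"
  assumes q: "q \<in> hardy2" "L2_boundary q uq" and G: "G \<in> borel_measurable M" "L2sq M G < \<infinity>"
  shows "(LINT x|lborel. cnj (uq x) * cauchy_transform G (complex_of_real x)) =
    - 2 * pi * \<i> * (LINT t|M. cnj (q (\<i> * complex_of_real t)) * G t)"
proof -
  have um[measurable]: "uq \<in> borel_measurable borel" and uf: "L2sq lborel uq < \<infinity>" using q by (auto simp: L2_boundary_def)
  define F where "F x t = cnj (uq x) * (G t / (complex_of_real x + \<i> * complex_of_real t))" for x t
  have um': "(\<lambda>p. cnj (uq (fst p))) \<in> borel_measurable (lborel \<Otimes>\<^sub>M M)"
    by (rule measurable_compose[OF measurable_fst]) simp
  have Fm: "(\<lambda>(x, t). F x t) \<in> borel_measurable (lborel \<Otimes>\<^sub>M M)"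
    using borel_measurable_times[OF um' cauchy_kernel_measurable[OF G(1)]] by (simp add: F_def case_prod_beta)
  \<comment> \<open>A majorant of the integrated absolute kernel. It is square integrable by the
    Schur estimate, so its product with \<open>|uq|\<close> is integrable and Fubini
    applies.\<close>
  define W where "W x = (\<integral>\<^sup>+t. ennreal (1 / (\<bar>x\<bar> + t) * (2 * norm (G t))) \<partial>M)" for x
  have Wm: "W \<in> borel_measurable lborel"
  proof -
    have abm: "(\<lambda>x::real. \<bar>x\<bar>) \<in> borel_measurable lborel" by measurable
    have f: "(\<lambda>p. \<bar>fst p :: real\<bar>) \<in> borel_measurable (lborel \<Otimes>\<^sub>M M)"
      by (rule measurable_compose[OF measurable_fst abm])
    have "(\<lambda>p. ennreal (1 / (\<bar>fst p\<bar> + snd p) * (2 * norm (G (snd p))))) \<in> borel_measurable (lborel \<Otimes>\<^sub>M M)"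
      by (intro measurable_compose[OF _ measurable_ennreal] borel_measurable_times borel_measurable_divide borel_measurable_add
          borel_measurable_const f snd_measurable measurable_compose[OF measurable_compose[OF measurable_snd G(1)] borel_measurable_norm])
    then have "(\<lambda>(x, t). ennreal (1 / (\<bar>x\<bar> + t) * (2 * norm (G t)))) \<in> borel_measurable (lborel \<Otimes>\<^sub>M M)"
      by (simp add: case_prod_beta)
    from borel_measurable_nn_integral[OF this] show ?thesis unfolding W_def[abs_def] .
  qed
  have W2: "(\<integral>\<^sup>+x. (W x)\<^sup>2 \<partial>lborel) < \<infinity>"
  proof -
    have "(\<integral>\<^sup>+x. (W x)\<^sup>2 \<partial>lborel) \<le> ennreal (45 * C * pi\<^sup>2) * (\<integral>\<^sup>+t. ennreal ((2 * norm (G t))\<^sup>2) \<partial>M)"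
      unfolding W_def by (rule schur_ray_to_line[OF M C growth]) (use G in auto)
    also have "(\<integral>\<^sup>+t. ennreal ((2 * norm (G t))\<^sup>2) \<partial>M) = 4 * L2sq M G"
      unfolding L2sq_def using G by (subst nn_integral_cmult[symmetric]) (auto simp: power_mult_distrib ennreal_mult)
    also have "ennreal (45 * C * pi\<^sup>2) * (4 * L2sq M G) < \<infinity>"
      using G by (simp add: ennreal_mult_less_top)
    finally show ?thesis .
  qed
  have Fint: "integrable (lborel \<Otimes>\<^sub>M M) (\<lambda>(x, t). F x t)"
  proof (rule line_ray_integrableI[OF Fm])
    have "(\<integral>\<^sup>+x. \<integral>\<^sup>+t. ennreal (norm (F x t)) \<partial>M \<partial>lborel) \<le> (\<integral>\<^sup>+x. ennreal (norm (uq x)) * W x \<partial>lborel)"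
    proof (rule nn_integral_mono)
      fix x
      have "(\<integral>\<^sup>+t. ennreal (norm (F x t)) \<partial>M) = (\<integral>\<^sup>+t. ennreal (norm (uq x)) * ennreal (norm (G t / (complex_of_real x + \<i> * complex_of_real t))) \<partial>M)"
        by (intro nn_integral_cong) (simp only: F_def norm_mult complex_mod_cnj ennreal_mult[OF norm_ge_zero norm_ge_zero])
      also have "\<dots> = ennreal (norm (uq x)) * (\<integral>\<^sup>+t. ennreal (norm (G t / (complex_of_real x + \<i> * complex_of_real t))) \<partial>M)"
        by (intro nn_integral_cmult measurable_compose[OF _ measurable_ennreal]
            measurable_compose[OF cauchy_integrand_measurable[OF G(1)] borel_measurable_norm])
      also have "\<dots> \<le> ennreal (norm (uq x)) * W x"
        using cauchy_transform_abs_le[of "complex_of_real x" G] unfolding W_def by (intro mult_left_mono) auto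
      finally show "(\<integral>\<^sup>+t. ennreal (norm (F x t)) \<partial>M) \<le> ennreal (norm (uq x)) * W x" .
    qed
    also have "\<dots> < \<infinity>"
    proof -
      have "(\<integral>\<^sup>+x. ennreal (norm (uq x)) * W x \<partial>lborel)\<^sup>2 \<le> (\<integral>\<^sup>+x. (ennreal (norm (uq x)))\<^sup>2 \<partial>lborel) * (\<integral>\<^sup>+x. (W x)\<^sup>2 \<partial>lborel)"
      by (rule Cauchy_Schwarz_nn_integral) (use Wm in auto)
      also have "\<dots> < \<infinity>"
        using uf W2 by (simp add: L2sq_def ennreal_power ennreal_mult_less_top)
      finally show ?thesis by (simp add: power_less_top_ennreal)
    qed
    finally show "(\<integral>\<^sup>+x. \<integral>\<^sup>+t. ennreal (norm (F x t)) \<partial>M \<partial>lborel) < \<infinity>" .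
  qed
  have "(LINT x|lborel. cnj (uq x) * cauchy_transform G (complex_of_real x)) = (LINT x|lborel. LINT t|M. F x t)"
    unfolding F_def cauchy_transform_def by (simp only: integral_mult_right_zero)
  also have "\<dots> = (LINT t|M. LINT x|lborel. F x t)"
    by (rule line_ray.Fubini_integral[OF Fint, symmetric])
  also have "\<dots> = (LINT t|M. (- 2 * pi * \<i>) * (cnj (q (\<i> * complex_of_real t)) * G t))"
  proof (rule Bochner_Integration.integral_cong)
    fix t assume "t \<in> space M"
    then have t: "t > 0" by (simp add: space_M)
    have z: "Im (\<i> * complex_of_real t) > 0" using t by simp
    have "(LINT x|lborel. F x t) = (LINT x|lborel. G t * cnj (uq x / (complex_of_real x - \<i> * complex_of_real t)))"
      by (intro Bochner_Integration.integral_cong) (simp_all add: F_def)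
    also have "\<dots> = G t * cnj (LINT x|lborel. uq x / (complex_of_real x - \<i> * complex_of_real t))"
      by (simp only: integral_mult_right_zero Bochner_Integration.integral_cnj)
    also have "\<dots> = (- 2 * pi * \<i>) * (cnj (q (\<i> * complex_of_real t)) * G t)"
      unfolding L2_boundary_cauchy[OF q z] by simp
    finally show "(LINT x|lborel. F x t) = (- 2 * pi * \<i>) * (cnj (q (\<i> * complex_of_real t)) * G t)" .
  qed simp
  also have "\<dots> = - 2 * pi * \<i> * (LINT t|M. cnj (q (\<i> * complex_of_real t)) * G t)"
    by (rule integral_mult_right_zero)
  finally show ?thesis .
qed

text \<open>The plain Poisson kernel \<open>t / (s\<^sup>2 + t\<^sup>2)\<close> also represents the point evaluation at \<open>\<i> t\<close>, but its
  \<open>\<mu>\<close>-integral is in general unbounded in \<open>s\<close>.  The factor \<open>2 s / (s + \<i> t)\<close> is the boundary function of a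
  bounded analytic function with value 1 at \<open>\<i> t\<close>, and makes the symbol bounded.\<close>

definition symbol_kernel :: "real \<Rightarrow> real \<Rightarrow> complex" where
  "symbol_kernel s t = complex_of_real (t / pi) *
    (2 * complex_of_real s / (complex_of_real s + \<i> * complex_of_real t) / complex_of_real (s\<^sup>2 + t\<^sup>2))"

text \<open>The reflection undoes that of the Hankel form: after \<open>s \<rightarrow> - s\<close>
  the form has \<open>cnj (uq (- s))\<close>, \<open>ug s\<close> and the symbol at
  \<open>- s\<close>, the arrangement of \<open>L2_boundary_product\<close>.\<close>

definition symbol :: "real \<Rightarrow> complex" where
  "symbol s = (LINT t|M. symbol_kernel (- s) t)"

text \<open>The analytic factor exchanges the roles of \<open>s\<close> and \<open>t\<close>: since
  \<open>t / |s + \<i> t| \<le> 1\<close> and \<open>2 / pi \<le> 1\<close>, the size is at most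
  \<open>|s| / (s^2 + t^2)\<close>. As a function of \<open>t\<close> this is a Poisson kernel of
  width \<open>|s|\<close>, to which linear growth applies uniformly in \<open>s\<close>.\<close>

lemma norm_symbol_kernel:
  assumes t: "t > 0"
  shows "norm (symbol_kernel s t) \<le> 2 * (\<bar>s\<bar> / (t + \<bar>s\<bar>)\<^sup>2)"
proof -
  let ?n = "norm (complex_of_real s + \<i> * complex_of_real t)"
  have n: "t \<le> ?n" using abs_Im_le_cmod[of "complex_of_real s + \<i> * complex_of_real t"] t by simp
  have q: "s\<^sup>2 + t\<^sup>2 > 0" using t by (simp add: add_nonneg_pos)
  have p: "(t + \<bar>s\<bar>)\<^sup>2 > 0" using t by (simp add: add_pos_nonneg)
  have "norm (symbol_kernel s t) = (t / ?n) * (2 / pi) * (\<bar>s\<bar> / (s\<^sup>2 + t\<^sup>2))"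
    using t q by (simp add: symbol_kernel_def norm_mult norm_divide mult_ac del: of_real_add of_real_power)
  also have "\<dots> \<le> 1 * 1 * (\<bar>s\<bar> / (s\<^sup>2 + t\<^sup>2))"
    using t n pi_gt3 by (intro mult_right_mono mult_mono) (auto simp: divide_le_eq)
  also have "\<dots> \<le> 2 * (\<bar>s\<bar> / (t + \<bar>s\<bar>)\<^sup>2)"
  proof -
    have "(t + \<bar>s\<bar>)\<^sup>2 \<le> 2 * (s\<^sup>2 + t\<^sup>2)"
      using sum_squares_bound[of t "\<bar>s\<bar>"] by (simp add: power2_sum)
    then have "\<bar>s\<bar> / (2 * (s\<^sup>2 + t\<^sup>2)) \<le> \<bar>s\<bar> / (t + \<bar>s\<bar>)\<^sup>2"
      using p q by (intro divide_left_mono mult_pos_pos) auto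
    then have "2 * (\<bar>s\<bar> / (2 * (s\<^sup>2 + t\<^sup>2))) \<le> 2 * (\<bar>s\<bar> / (t + \<bar>s\<bar>)\<^sup>2)" by (rule mult_left_mono) simp
    moreover have "2 * (a / (2 * b)) = a / b" for a b :: real by simp
    ultimately show ?thesis by (simp only: mult_1)
  qed
  finally show ?thesis .
qed

lemma symbol_kernel_nn_integral: "(\<integral>\<^sup>+t. ennreal (norm (symbol_kernel s t)) \<partial>M) \<le> ennreal (4 * C)"
proof (cases "s = 0")
  case True
  then show ?thesis by (simp add: symbol_kernel_def)
next
  case False
  have "(\<integral>\<^sup>+t. ennreal (norm (symbol_kernel s t)) \<partial>M) \<le> (\<integral>\<^sup>+t. ennreal 2 * ennreal (\<bar>s\<bar> / (t + \<bar>s\<bar>)\<^sup>2) \<partial>M)"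
  proof (rule nn_integral_mono)
    fix t assume "t \<in> space M"
    then have "ennreal (norm (symbol_kernel s t)) \<le> ennreal (2 * (\<bar>s\<bar> / (t + \<bar>s\<bar>)\<^sup>2))"
      by (intro ennreal_leI norm_symbol_kernel) (simp add: space_M)
    also have "\<dots> = ennreal 2 * ennreal (\<bar>s\<bar> / (t + \<bar>s\<bar>)\<^sup>2)" by (rule ennreal_mult) auto
    finally show "ennreal (norm (symbol_kernel s t)) \<le> ennreal 2 * ennreal (\<bar>s\<bar> / (t + \<bar>s\<bar>)\<^sup>2)" .
  qed
  also have "\<dots> = ennreal 2 * (\<integral>\<^sup>+t. ennreal (\<bar>s\<bar> / (t + \<bar>s\<bar>)\<^sup>2) \<partial>M)"
    by (rule nn_integral_cmult, rule measurable_compose[OF _ measurable_ennreal], rule borel_measurable_Rplus[OF M])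
      (use False in \<open>auto intro!: continuous_intros\<close>)
  also have "\<dots> \<le> ennreal 2 * ennreal (2 * C)"
    by (intro mult_left_mono linear_growth_poisson_kernel[OF sigma_finite_measure_axioms ident_measurable _ growth C])
      (use False in \<open>auto simp: space_M\<close>)
  also have "\<dots> = ennreal (4 * C)" by (subst ennreal_mult[symmetric]) (use C in auto)
  finally show ?thesis .
qed

lemma symbol_kernel_measurable: "(\<lambda>(s, t). symbol_kernel s t) \<in> borel_measurable (lborel \<Otimes>\<^sub>M M)"
proof -
  have K: "(\<lambda>(s, t). symbol_kernel s t) \<in> borel_measurable (borel \<Otimes>\<^sub>M borel)"
    unfolding symbol_kernel_def by measurable
  have "(\<lambda>p. (fst p, snd p)) \<in> lborel \<Otimes>\<^sub>M M \<rightarrow>\<^sub>M borel \<Otimes>\<^sub>M borel"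
    by (intro measurable_Pair snd_measurable) simp
  from measurable_compose[OF this K] show ?thesis by (simp add: case_prod_beta)
qed

lemma symbol_measurable: "symbol \<in> borel_measurable borel"
proof -
  have "(\<lambda>s. LINT t|M. symbol_kernel s t) \<in> borel_measurable borel"
    using borel_measurable_lebesgue_integral[OF symbol_kernel_measurable] by simp
  from measurable_compose[OF borel_measurable_uminus[OF measurable_ident_sets[OF refl]] this]
  show ?thesis by (simp add: symbol_def[abs_def])
qed

lemma norm_symbol_le: "norm (symbol s) \<le> 4 * C"
proof -
  have "ennreal (norm (symbol s)) \<le> (\<integral>\<^sup>+t. ennreal (norm (symbol_kernel (- s) t)) \<partial>M)"
    unfolding symbol_def
  proof (cases "integrable M (symbol_kernel (- s))")
    case True then show "ennreal (norm (LINT t|M. symbol_kernel (- s) t)) \<le> (\<integral>\<^sup>+t. ennreal (norm (symbol_kernel (- s) t)) \<partial>M)"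
      by (rule integral_norm_bound_ennreal)
  qed (simp add: not_integrable_integral_eq)
  also have "\<dots> \<le> ennreal (4 * C)" by (rule symbol_kernel_nn_integral)
  finally show ?thesis using C by simp
qed

text \<open>Fubini reduces the claim to \<open>L2_boundary_product\<close> for each
  \<open>t\<close>, and \<open>t / pi\<close> in the kernel cancels the factor \<open>pi / t\<close>
  there. Absolute integrability holds because the product of the boundary functions is integrable
  and the kernel integrates to at most \<open>4 * C\<close> for every \<open>s\<close>.\<close>

lemma symbol_pairing:
  fixes q g :: "complex \<Rightarrow> complex"
  assumes q: "q \<in> hardy2" "L2_boundary q uq" and g: "g \<in> hardy2" "L2_boundary g ug"
  shows "(LINT s|lborel. cnj (uq s) * (symbol s * ug (- s))) =
    (LINT t|M. cnj (q (\<i> * complex_of_real t)) * g (\<i> * complex_of_real t))"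
proof -
  have um[measurable]: "uq \<in> borel_measurable borel" "ug \<in> borel_measurable borel"
    and uf: "L2sq lborel uq < \<infinity>" "L2sq lborel ug < \<infinity>" using q g by (auto simp: L2_boundary_def)
  define w where "w s = cnj (uq (- s)) * ug s" for s
  have wm: "w \<in> borel_measurable borel" unfolding w_def by measurable
  have wint: "integrable lborel w"
    unfolding w_def
    by (rule L2sq_mult_integrable) (use um uf L2sq_reflect[OF um(1)] in \<open>auto simp: L2sq_cnj\<close>)
  define F where "F s t = w s * symbol_kernel s t" for s t
  have wm': "(\<lambda>p. w (fst p)) \<in> borel_measurable (lborel \<Otimes>\<^sub>M M)"
    by (rule measurable_compose[OF measurable_fst]) (use wm in simp)
  have Fm: "(\<lambda>(s, t). F s t) \<in> borel_measurable (lborel \<Otimes>\<^sub>M M)"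
    using borel_measurable_times[OF wm' symbol_kernel_measurable] by (simp add: F_def case_prod_beta)
  have skm: "symbol_kernel s \<in> borel_measurable M" for s
    using measurable_compose[OF measurable_Pair1' symbol_kernel_measurable, of s] by simp
  have Fint: "integrable (lborel \<Otimes>\<^sub>M M) (\<lambda>(s, t). F s t)"
  proof (rule line_ray_integrableI[OF Fm])
    have "(\<integral>\<^sup>+s. \<integral>\<^sup>+t. ennreal (norm (F s t)) \<partial>M \<partial>lborel) \<le> (\<integral>\<^sup>+s. ennreal (norm (w s)) * ennreal (4 * C) \<partial>lborel)"
    proof (rule nn_integral_mono)
      fix s
      have "(\<integral>\<^sup>+t. ennreal (norm (F s t)) \<partial>M) = (\<integral>\<^sup>+t. ennreal (norm (w s)) * ennreal (norm (symbol_kernel s t)) \<partial>M)"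
        by (simp add: F_def norm_mult ennreal_mult)
      also have "\<dots> = ennreal (norm (w s)) * (\<integral>\<^sup>+t. ennreal (norm (symbol_kernel s t)) \<partial>M)"
        by (intro nn_integral_cmult measurable_compose[OF _ measurable_ennreal] measurable_compose[OF skm borel_measurable_norm])
      also have "\<dots> \<le> ennreal (norm (w s)) * ennreal (4 * C)"
        by (intro mult_left_mono symbol_kernel_nn_integral) simp
      finally show "(\<integral>\<^sup>+t. ennreal (norm (F s t)) \<partial>M) \<le> ennreal (norm (w s)) * ennreal (4 * C)" .
    qed
    also have "\<dots> = (\<integral>\<^sup>+s. ennreal (norm (w s)) \<partial>lborel) * ennreal (4 * C)"
      using wm by (intro nn_integral_multc) simp
    also have "\<dots> < \<infinity>" using wint by (simp add: integrable_iff_bounded ennreal_mult_less_top)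
    finally show "(\<integral>\<^sup>+s. \<integral>\<^sup>+t. ennreal (norm (F s t)) \<partial>M \<partial>lborel) < \<infinity>" .
  qed
  have "(LINT s|lborel. cnj (uq s) * (symbol s * ug (- s))) = (LINT s|lborel. cnj (uq (- s)) * (symbol (- s) * ug s))"
    using lborel_integral_real_affine[of "-1" "\<lambda>s. cnj (uq s) * (symbol s * ug (- s))" 0] by simp
  also have "\<dots> = (LINT s|lborel. w s * (LINT t|M. symbol_kernel s t))"
    by (intro Bochner_Integration.integral_cong) (simp_all add: w_def symbol_def)
  also have "\<dots> = (LINT s|lborel. LINT t|M. F s t)"
    unfolding F_def by (simp only: integral_mult_right_zero)
  also have "\<dots> = (LINT t|M. LINT s|lborel. F s t)"
    by (rule line_ray.Fubini_integral[OF Fint, symmetric])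
  also have "\<dots> = (LINT t|M. cnj (q (\<i> * complex_of_real t)) * g (\<i> * complex_of_real t))"
  proof (rule Bochner_Integration.integral_cong)
    fix t assume "t \<in> space M"
    then have t: "t > 0" by (simp add: space_M)
    have "(LINT s|lborel. F s t) = (LINT s|lborel. complex_of_real (t / pi) * (cnj (uq (- s)) * (ug s *
        (2 * complex_of_real s / (complex_of_real s + \<i> * complex_of_real t) / complex_of_real (s\<^sup>2 + t\<^sup>2)))))"
      by (intro Bochner_Integration.integral_cong) (simp_all only: F_def w_def symbol_kernel_def mult_ac)
    also have "\<dots> = complex_of_real (t / pi) * (pi / t * (cnj (q (\<i> * complex_of_real t)) * g (\<i> * complex_of_real t)))"
      by (simp only: integral_mult_right_zero L2_boundary_product[OF q g t])
    also have "\<dots> = cnj (q (\<i> * complex_of_real t)) * g (\<i> * complex_of_real t)" using t by simp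
    finally show "(LINT s|lborel. F s t) = cnj (q (\<i> * complex_of_real t)) * g (\<i> * complex_of_real t)" .
  qed simp
  finally show ?thesis .
qed

end

section \<open>The operator attached to the measure\<close>

context carleson_ray
begin

text \<open>\<open>\<i> / (2 pi (z + \<i> t))\<close> is the reproducing kernel at
  \<open>\<i> t\<close>. Superposing these kernels with weight \<open>g (\<i> t)\<close> is what the
  Carleson identity forces.\<close>

definition carleson_hankel :: "(complex \<Rightarrow> complex) \<Rightarrow> complex \<Rightarrow> complex" where
  "carleson_hankel g z = \<i> / (2 * pi) * cauchy_transform (\<lambda>t. g (\<i> * complex_of_real t)) z"

lemma ray_restriction:
  fixes g :: "complex \<Rightarrow> complex"
  assumes "g \<in> hardy2"
  shows "(\<lambda>t. g (\<i> * complex_of_real t)) \<in> borel_measurable M"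
    and "L2sq M (\<lambda>t. g (\<i> * complex_of_real t)) < \<infinity>"
proof -
  show "(\<lambda>t. g (\<i> * complex_of_real t)) \<in> borel_measurable M" by (rule hardy2_measurable_ray[OF M assms])
  show "L2sq M (\<lambda>t. g (\<i> * complex_of_real t)) < \<infinity>"
    unfolding L2sq_def by (rule le_less_trans[OF carleson_embedding_ray[OF M C growth assms]]) simp
qed

lemma carleson_hankel_hardy2:
  fixes g :: "complex \<Rightarrow> complex"
  assumes g: "g \<in> hardy2"
  shows "carleson_hankel g \<in> hardy2"
proof (rule hardy2I)
  let ?G = "\<lambda>t. g (\<i> * complex_of_real t)"
  note G = ray_restriction[OF g]
  show hol: "carleson_hankel g holomorphic_on upper_half_plane"
    unfolding carleson_hankel_def[abs_def]
    by (intro holomorphic_on_mult holomorphic_on_const cauchy_transform_holomorphic G)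
  let ?c = "ennreal ((norm (\<i> / complex_of_real (2 * pi)))\<^sup>2) * (ennreal (45 * C * pi\<^sup>2) * (4 * L2sq M ?G))"
  show "?c < \<infinity>" using G(2) by (simp add: ennreal_mult_less_top)
  show "L2sq lborel (\<lambda>x. carleson_hankel g (Complex x y)) \<le> ?c" if y: "y > 0" for y
  proof -
    have "(\<lambda>x. cauchy_transform ?G (Complex x y)) \<in> borel_measurable lborel"
      using borel_measurable_line[OF cauchy_transform_holomorphic[OF G], of y] y by (simp add: upper_half_plane_iff)
    then have "L2sq lborel (\<lambda>x. carleson_hankel g (Complex x y)) =
        ennreal ((norm (\<i> / complex_of_real (2 * pi)))\<^sup>2) * L2sq lborel (\<lambda>x. cauchy_transform ?G (Complex x y))"
      unfolding carleson_hankel_def by (rule L2sq_cmult)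
    also have "\<dots> \<le> ?c" using y by (intro mult_left_mono cauchy_transform_L2sq G(1)) auto
    finally show ?thesis .
  qed
qed

text \<open>The defining integral makes sense at real \<open>x \<noteq> 0\<close> and is the limit
  from inside, so the same formula gives the boundary function outside a null set.\<close>

lemma carleson_hankel_boundary_value:
  fixes g :: "complex \<Rightarrow> complex"
  assumes g: "g \<in> hardy2" and x: "x \<noteq> 0"
  shows "boundary_value (carleson_hankel g) x = carleson_hankel g (complex_of_real x)"
proof (rule boundary_value_eqI)
  show "has_nontangential_limit (carleson_hankel g) x (carleson_hankel g (complex_of_real x))"
    unfolding has_nontangential_limit_def carleson_hankel_def[abs_def]
    by (intro allI impI tendsto_mult tendsto_const cauchy_transform_tendsto ray_restriction g)
      (use x in \<open>auto simp: upper_half_plane_iff\<close>)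
qed

lemma carleson_hankel_line:
  fixes g :: "complex \<Rightarrow> complex"
  assumes g: "g \<in> hardy2"
  shows "(\<lambda>x. carleson_hankel g (complex_of_real x)) \<in> borel_measurable borel"
    and "L2sq lborel (\<lambda>x. carleson_hankel g (complex_of_real x)) < \<infinity>"
    and "AE x in lborel. boundary_value (carleson_hankel g) x = carleson_hankel g (complex_of_real x)"
proof -
  let ?G = "\<lambda>t. g (\<i> * complex_of_real t)"
  note G = ray_restriction[OF g]
  show m: "(\<lambda>x. carleson_hankel g (complex_of_real x)) \<in> borel_measurable borel"
    unfolding carleson_hankel_def
    by (intro borel_measurable_times borel_measurable_const cauchy_transform_measurable G)
  have "L2sq lborel (\<lambda>x. carleson_hankel g (complex_of_real x)) =
      ennreal ((norm (\<i> / complex_of_real (2 * pi)))\<^sup>2) * L2sq lborel (\<lambda>x. cauchy_transform ?G (complex_of_real x))"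
    unfolding carleson_hankel_def by (rule L2sq_cmult) (use cauchy_transform_measurable[OF G(1)] in simp)
  also have "L2sq lborel (\<lambda>x. cauchy_transform ?G (complex_of_real x)) < \<infinity>"
    using cauchy_transform_L2sq[OF G(1), of 0] G(2)
    by (auto simp: Complex_eq ennreal_mult_less_top intro: le_less_trans)
  then have "ennreal ((norm (\<i> / complex_of_real (2 * pi)))\<^sup>2) * L2sq lborel (\<lambda>x. cauchy_transform ?G (complex_of_real x)) < \<infinity>"
    by (simp add: ennreal_mult_less_top)
  finally show "L2sq lborel (\<lambda>x. carleson_hankel g (complex_of_real x)) < \<infinity>" .
  show "AE x in lborel. boundary_value (carleson_hankel g) x = carleson_hankel g (complex_of_real x)"
    using AE_lborel_singleton[of 0] by eventually_elim (rule carleson_hankel_boundary_value[OF g])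
qed

lemma carleson_hankel_pairing:
  fixes q g :: "complex \<Rightarrow> complex"
  assumes q: "q \<in> hardy2" "L2_boundary q uq" and g: "g \<in> hardy2"
  shows "(LINT x|lborel. cnj (uq x) * carleson_hankel g (complex_of_real x)) =
    (LINT t|M. cnj (q (\<i> * complex_of_real t)) * g (\<i> * complex_of_real t))"
proof -
  let ?G = "\<lambda>t. g (\<i> * complex_of_real t)"
  have "(LINT x|lborel. cnj (uq x) * carleson_hankel g (complex_of_real x)) =
      (LINT x|lborel. \<i> / (2 * pi) * (cnj (uq x) * cauchy_transform ?G (complex_of_real x)))"
    unfolding carleson_hankel_def by (simp only: mult_ac)
  also have "\<dots> = \<i> / (2 * pi) * (- 2 * pi * \<i> * (LINT t|M. cnj (q (\<i> * complex_of_real t)) * ?G t))"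
    by (simp only: integral_mult_right_zero cauchy_transform_pairing[OF q ray_restriction[OF g]])
  also have "\<dots> = (LINT t|M. cnj (q (\<i> * complex_of_real t)) * ?G t)"
  proof -
    have "\<i> / (2 * pi) * (- 2 * pi * \<i> * v) = v" for v :: complex by simp
    then show ?thesis .
  qed
  finally show ?thesis .
qed

lemma hardy_inner_carleson_hankel:
  fixes q g :: "complex \<Rightarrow> complex"
  assumes q: "q \<in> hardy2" and g: "g \<in> hardy2"
  shows "hardy_inner q (carleson_hankel g) = (LINT t|M. cnj (q (\<i> * complex_of_real t)) * g (\<i> * complex_of_real t))"
proof -
  obtain uq where uq: "L2_boundary q uq" using hardy2_L2_boundary_exists[OF q] by blast
  have [measurable]: "uq \<in> borel_measurable borel" using uq by (simp add: L2_boundary_def)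
  have "hardy_inner q (carleson_hankel g) = (LINT x|lborel. cnj (uq x) * carleson_hankel g (complex_of_real x))"
    unfolding hardy_inner_def L2_inner_def
  proof (rule lebesgue_integral_AE_eq)
    show "(\<lambda>x. cnj (uq x) * carleson_hankel g (complex_of_real x)) \<in> borel_measurable borel"
      using carleson_hankel_line(1)[OF g] by simp
    show "AE x in lborel. cnj (boundary_value q x) * boundary_value (carleson_hankel g) x = cnj (uq x) * carleson_hankel g (complex_of_real x)"
      using hardy2_boundary_value_AE[OF q uq] carleson_hankel_line(3)[OF g] by eventually_elim simp
  qed
  then show ?thesis using carleson_hankel_pairing[OF q uq g] by simp
qed

text \<open>Against every \<open>q\<close> both \<open>symbol\<close> times the reflected
  \<open>g\<close> and \<open>carleson_hankel g\<close> pair to the same integral over the ray, so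
  their difference is orthogonal to the Hardy space.\<close>

lemma carleson_hankel_projection:
  fixes g :: "complex \<Rightarrow> complex"
  assumes g: "g \<in> hardy2"
  shows "is_hardy_projection (\<lambda>x. symbol x * boundary_value g (- x)) (carleson_hankel g)"
  unfolding is_hardy_projection_def
proof (intro conjI ballI carleson_hankel_hardy2 g)
  fix q :: "complex \<Rightarrow> complex" assume q: "q \<in> hardy2"
  obtain uq where uq: "L2_boundary q uq" using hardy2_L2_boundary_exists[OF q] by blast
  obtain ug where ug: "L2_boundary g ug" using hardy2_L2_boundary_exists[OF g] by blast
  let ?p = "\<lambda>x. carleson_hankel g (complex_of_real x)"
  have um[measurable]: "uq \<in> borel_measurable borel" "ug \<in> borel_measurable borel"
    and uf: "L2sq lborel uq < \<infinity>" "L2sq lborel ug < \<infinity>" using uq ug by (auto simp: L2_boundary_def)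
  note [measurable] = symbol_measurable carleson_hankel_line(1)[OF g]
  have "L2sq lborel (\<lambda>x. symbol x * ug (- x)) \<le> L2sq lborel (\<lambda>x. complex_of_real (4 * C) * ug (- x))"
    by (intro L2sq_mono_AE AE_I2) (use C norm_symbol_le in \<open>auto simp: norm_mult intro!: mult_right_mono\<close>)
  also have "\<dots> = ennreal ((norm (complex_of_real (4 * C)))\<^sup>2) * L2sq lborel ug"
    by (subst L2sq_cmult) (use L2sq_reflect[OF um(2)] in auto)
  also have "\<dots> < \<infinity>" using uf by (simp add: ennreal_mult_less_top)
  finally have sf: "L2sq lborel (\<lambda>x. symbol x * ug (- x)) < \<infinity>" .
  have i: "integrable lborel (\<lambda>x. cnj (uq x) * (symbol x * ug (- x)))" "integrable lborel (\<lambda>x. cnj (uq x) * ?p x)"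
    by (rule L2sq_mult_integrable; (use uf sf carleson_hankel_line(2)[OF g] in \<open>simp add: L2sq_cnj\<close>; fail)?, measurable)+
  have "L2_inner (boundary_value q) (\<lambda>x. symbol x * boundary_value g (- x) - boundary_value (carleson_hankel g) x)
    = (LINT x|lborel. cnj (uq x) * (symbol x * ug (- x)) - cnj (uq x) * ?p x)"
    unfolding L2_inner_def
  proof (rule lebesgue_integral_AE_eq)
    show "(\<lambda>x. cnj (uq x) * (symbol x * ug (- x)) - cnj (uq x) * ?p x) \<in> borel_measurable borel" by measurable
    show "AE x in lborel. cnj (boundary_value q x) * (symbol x * boundary_value g (- x) - boundary_value (carleson_hankel g) x)
       = cnj (uq x) * (symbol x * ug (- x)) - cnj (uq x) * ?p x"
      using hardy2_boundary_value_AE[OF q uq] AE_lborel_reflect[OF hardy2_boundary_value_AE[OF g ug]] carleson_hankel_line(3)[OF g]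
      by eventually_elim (simp add: right_diff_distrib)
  qed
  also have "\<dots> = (LINT x|lborel. cnj (uq x) * (symbol x * ug (- x))) - (LINT x|lborel. cnj (uq x) * ?p x)"
    by (rule Bochner_Integration.integral_diff[OF i])
  also have "\<dots> = 0"
    unfolding symbol_pairing[OF q uq g ug] carleson_hankel_pairing[OF q uq g] by simp
  finally show "L2_inner (boundary_value q) (\<lambda>x. symbol x * boundary_value g (- x) - boundary_value (carleson_hankel g) x) = 0" .
qed

theorem carleson_hankel_positive_hankel_operator:
  "positive_hankel_operator carleson_hankel" "is_carleson_measure M carleson_hankel"
proof -
  have "symbol \<in> Linfty"
    unfolding Linfty_def using symbol_measurable norm_symbol_le by (auto intro!: measurable_completion)
  then have "hankel_operator carleson_hankel"
    unfolding hankel_operator_def using carleson_hankel_projection by blast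
  moreover have "hardy_inner f (carleson_hankel f) \<in> \<real>\<^sub>\<ge>\<^sub>0" if f: "f \<in> hardy2" for f :: "complex \<Rightarrow> complex"
  proof -
    have "hardy_inner f (carleson_hankel f) = (LINT t|M. complex_of_real ((norm (f (\<i> * complex_of_real t)))\<^sup>2))"
      unfolding hardy_inner_carleson_hankel[OF f f]
      by (intro Bochner_Integration.integral_cong refl) (simp only: complex_norm_square mult.commute)
    also have "\<dots> = complex_of_real (LINT t|M. (norm (f (\<i> * complex_of_real t)))\<^sup>2)"
      by (rule integral_complex_of_real)
    also have "\<dots> \<in> \<real>\<^sub>\<ge>\<^sub>0"
      by (subst nonneg_Reals_of_real_iff) (intro integral_nonneg_AE, simp)
    finally show ?thesis .
  qed
  ultimately show "positive_hankel_operator carleson_hankel" by (simp add: positive_hankel_operator_def)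
  show "is_carleson_measure M carleson_hankel"
    unfolding is_carleson_measure_def
  proof (intro ballI conjI hardy_inner_carleson_hankel)
    fix f g :: "complex \<Rightarrow> complex" assume "f \<in> hardy2" "g \<in> hardy2"
    then show "integrable M (\<lambda>t. cnj (f (\<i> * complex_of_real t)) * g (\<i> * complex_of_real t))"
      using L2sq_mult_integrable[OF borel_measurable_cnj[OF ray_restriction(1)] ray_restriction(1), of f g]
        ray_restriction(2)[of f] ray_restriction(2)[of g]
      by (simp add: L2sq_cnj)
  qed
qed

end

text \<open>Testing the orthogonality relation of the projection with \<open>f\<close> itself
  replaces \<open>H f\<close> by \<open>h\<close> times the reflected \<open>f\<close>, and
  Cauchy-Schwarz finishes. As \<open>h\<close> is merely Lebesgue measurable, the integrals stay
  over \<open>lebesgue\<close> while the boundary values are replaced by Borel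
  representatives.\<close>

lemma hankel_form_bound:
  assumes H: "hankel_operator H"
  shows "\<exists>K\<ge>0. \<forall>f\<in>hardy2. norm (hardy_inner f (H f)) \<le> K * (hardy_norm f)\<^sup>2"
proof -
  obtain h where h: "h \<in> Linfty" "\<And>g. g \<in> hardy2 \<Longrightarrow> is_hardy_projection (\<lambda>x. h x * boundary_value g (- x)) (H g)"
    using H by (auto simp: hankel_operator_def)
  obtain K where hm: "h \<in> borel_measurable lebesgue" and K: "AE x in lebesgue. norm (h x) \<le> K"
    using h(1) by (auto simp: Linfty_def)
  define K' where "K' = max K 0"
  have K': "K' \<ge> 0" "AE x in lebesgue. norm (h x) \<le> K'"
    using K by (auto simp: K'_def elim: eventually_mono)
  have "norm (hardy_inner f (H f)) \<le> K' * (hardy_norm f)\<^sup>2" if f: "f \<in> hardy2" for f :: "complex \<Rightarrow> complex"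
  proof -
    have proj: "is_hardy_projection (\<lambda>x. h x * boundary_value f (- x)) (H f)" by (rule h(2)[OF f])
    then have p: "H f \<in> hardy2" by (simp add: is_hardy_projection_def)
    obtain u where u: "L2_boundary f u" using hardy2_L2_boundary_exists[OF f] by blast
    obtain v where v: "L2_boundary (H f) v" using hardy2_L2_boundary_exists[OF p] by blast
    have um: "u \<in> borel_measurable borel" "v \<in> borel_measurable borel"
      and uf: "L2sq lborel u < \<infinity>" "L2sq lborel v < \<infinity>" using u v by (auto simp: L2_boundary_def)
    have leb: "L2sq lebesgue w = L2sq lborel w" for w :: "real \<Rightarrow> complex"
      unfolding L2sq_def by (rule nn_integral_completion)
    have ru: "(\<lambda>x. u (- x)) \<in> borel_measurable borel" using um by simp
    have m: "(\<lambda>x. cnj (u x)) \<in> borel_measurable lebesgue" "v \<in> borel_measurable lebesgue" "(\<lambda>x. u (- x)) \<in> borel_measurable lebesgue"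
      using um ru by (auto intro!: measurable_completion borel_measurable_cnj)
    have hum: "(\<lambda>x. h x * u (- x)) \<in> borel_measurable lebesgue" by (intro borel_measurable_times hm m)
    have "L2sq lebesgue (\<lambda>x. h x * u (- x)) \<le> L2sq lebesgue (\<lambda>x. complex_of_real K' * u (- x))"
    proof (rule L2sq_mono_AE)
      show "AE x in lebesgue. norm (h x * u (- x)) \<le> norm (complex_of_real K' * u (- x))"
        using K'(2) by eventually_elim (use K' in \<open>auto simp: norm_mult intro!: mult_right_mono\<close>)
    qed
    also have "\<dots> = ennreal (K'\<^sup>2) * L2sq lborel u"
      using m(3) L2sq_reflect[OF um(1)] by (subst L2sq_cmult) (auto simp: leb)
    finally have hu: "L2sq lebesgue (\<lambda>x. h x * u (- x)) \<le> ennreal (K'\<^sup>2) * L2sq lborel u" .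
    have hu_fin: "L2sq lebesgue (\<lambda>x. h x * u (- x)) < \<infinity>"
      using uf by (intro le_less_trans[OF hu]) (simp add: ennreal_mult_less_top)
    have cu: "L2sq lebesgue (\<lambda>x. cnj (u x)) = L2sq lborel u" by (simp add: L2sq_cnj leb)
    have i: "integrable lebesgue (\<lambda>x. cnj (u x) * (h x * u (- x)))"
      by (rule L2sq_mult_integrable[OF m(1) hum _ hu_fin]) (use uf in \<open>simp add: cu\<close>)
    have i': "integrable lebesgue (\<lambda>x. cnj (u x) * v x)"
      by (rule L2sq_mult_integrable[OF m(1,2)]) (use uf in \<open>simp_all add: cu leb\<close>)
    have bu: "AE x in lebesgue. boundary_value f x = u x" "AE x in lebesgue. boundary_value f (- x) = u (- x)"
      "AE x in lebesgue. boundary_value (H f) x = v x"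
      by (intro AE_completion hardy2_boundary_value_AE AE_lborel_reflect[OF hardy2_boundary_value_AE] f u p v)+
    have bm: "boundary_value f \<in> borel_measurable lebesgue" "(\<lambda>x. boundary_value f (- x)) \<in> borel_measurable lebesgue"
      "boundary_value (H f) \<in> borel_measurable lebesgue"
      by (rule lebesgue_measurable_AE_eq[OF um(1) hardy2_boundary_value_AE[OF f u]],
        rule lebesgue_measurable_AE_eq[OF ru AE_lborel_reflect[OF hardy2_boundary_value_AE[OF f u]]],
        rule lebesgue_measurable_AE_eq[OF um(2) hardy2_boundary_value_AE[OF p v]])
    have "0 = L2_inner (boundary_value f) (\<lambda>x. h x * boundary_value f (- x) - boundary_value (H f) x)"
      using proj f by (simp add: is_hardy_projection_def)
    also have "\<dots> = (LINT x|lebesgue. cnj (u x) * (h x * u (- x)) - cnj (u x) * v x)"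
      unfolding L2_inner_def
    proof (rule integral_cong_AE)
      show "AE x in lebesgue. cnj (boundary_value f x) * (h x * boundary_value f (- x) - boundary_value (H f) x)
          = cnj (u x) * (h x * u (- x)) - cnj (u x) * v x"
        using bu by eventually_elim (simp add: right_diff_distrib)
    qed (intro borel_measurable_times borel_measurable_diff borel_measurable_cnj bm hm m hum)+
    also have "\<dots> = (LINT x|lebesgue. cnj (u x) * (h x * u (- x))) - (LINT x|lebesgue. cnj (u x) * v x)"
      by (rule Bochner_Integration.integral_diff[OF i i'])
    finally have eq: "(LINT x|lebesgue. cnj (u x) * v x) = (LINT x|lebesgue. cnj (u x) * (h x * u (- x)))" by simp
    have "hardy_inner f (H f) = (LINT x|lebesgue. cnj (u x) * v x)"
      unfolding hardy_inner_def L2_inner_def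
    proof (rule integral_cong_AE)
      show "AE x in lebesgue. cnj (boundary_value f x) * boundary_value (H f) x = cnj (u x) * v x"
        using bu(1,3) by eventually_elim simp
    qed (intro borel_measurable_times borel_measurable_cnj bm m)+
    then have "norm (hardy_inner f (H f)) = norm (LINT x|lebesgue. cnj (u x) * (h x * u (- x)))" by (simp only: eq)
    also have "\<dots> \<le> sqrt (enn2real (L2sq lebesgue (\<lambda>x. cnj (u x)))) * sqrt (enn2real (L2sq lebesgue (\<lambda>x. h x * u (- x))))"
      using uf hu_fin by (intro L2sq_mult_integral_le m hum) (simp_all add: cu)
    also have "\<dots> \<le> sqrt ((hardy_norm f)\<^sup>2) * sqrt (K'\<^sup>2 * (hardy_norm f)\<^sup>2)"
    proof (intro mult_mono real_sqrt_le_mono)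
      show "enn2real (L2sq lebesgue (\<lambda>x. cnj (u x))) \<le> (hardy_norm f)\<^sup>2"
        unfolding cu hardy_norm_L2sq[OF f u, symmetric] by simp
      show "enn2real (L2sq lebesgue (\<lambda>x. h x * u (- x))) \<le> K'\<^sup>2 * (hardy_norm f)\<^sup>2"
        using hu unfolding hardy_norm_L2sq[OF f u, symmetric] by (intro enn2real_leI) (simp_all add: ennreal_mult)
    qed auto
    also have "\<dots> = K' * (hardy_norm f)\<^sup>2"
      using K' by (simp add: real_sqrt_mult power2_eq_square)
    finally show ?thesis .
  qed
  then show ?thesis using K'(1) by blast
qed

text \<open>On the diagonal the Carleson identity expresses the integral of
  \<open>|f (\<i> t)|^2\<close> by the quadratic form of \<open>H\<close>. Integrability, part of
  \<open>is_carleson_measure\<close>, makes the nonnegative integral equal to the Bochner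
  integral.\<close>

lemma carleson_of_hankel:
  assumes H: "hankel_operator H" and cm: "is_carleson_measure \<mu> H"
  shows "\<exists>\<alpha>::real. \<forall>f\<in>hardy2. (\<integral>\<^sup>+ t. ennreal ((norm (f (\<i> * complex_of_real t)))\<^sup>2) \<partial>\<mu>) \<le> ennreal (\<alpha> * (hardy_norm f)\<^sup>2)"
proof -
  obtain K where K: "\<And>f. f \<in> hardy2 \<Longrightarrow> norm (hardy_inner f (H f)) \<le> K * (hardy_norm f)\<^sup>2"
    using hankel_form_bound[OF H] by blast
  have "(\<integral>\<^sup>+ t. ennreal ((norm (f (\<i> * complex_of_real t)))\<^sup>2) \<partial>\<mu>) \<le> ennreal (K * (hardy_norm f)\<^sup>2)"
    if f: "f \<in> hardy2" for f :: "complex \<Rightarrow> complex"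
  proof -
    let ?f = "\<lambda>t. f (\<i> * complex_of_real t)"
    have sq: "cnj (?f t) * ?f t = complex_of_real ((norm (?f t))\<^sup>2)" for t
      by (simp only: complex_norm_square mult.commute)
    have int: "integrable \<mu> (\<lambda>t. complex_of_real ((norm (?f t))\<^sup>2))"
      and inner: "hardy_inner f (H f) = (LINT t|\<mu>. complex_of_real ((norm (?f t))\<^sup>2))"
      using cm f unfolding is_carleson_measure_def sq[symmetric] by blast+
    have int': "integrable \<mu> (\<lambda>t. (norm (?f t))\<^sup>2)"
      using int by (simp only: complex_of_real_integrable_eq)
    have nn: "0 \<le> (LINT t|\<mu>. (norm (?f t))\<^sup>2)" by (intro integral_nonneg_AE) simp
    have "(\<integral>\<^sup>+ t. ennreal ((norm (?f t))\<^sup>2) \<partial>\<mu>) = ennreal (LINT t|\<mu>. (norm (?f t))\<^sup>2)"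
      by (rule nn_integral_eq_integral[OF int']) simp
    also have "(LINT t|\<mu>. (norm (?f t))\<^sup>2) = norm (hardy_inner f (H f))"
      unfolding inner integral_complex_of_real norm_of_real using nn by simp
    also have "ennreal \<dots> \<le> ennreal (K * (hardy_norm f)\<^sup>2)" by (intro ennreal_leI K f)
    finally show ?thesis .
  qed
  then show ?thesis by blast
qed

theorem theorem3p7:
  fixes \<mu> \<rho> :: "real measure"
  assumes "positive_borel_measure_Rplus \<mu>"
    and "\<rho> = density \<mu> (\<lambda>t. ennreal (1 / (1 + t\<^sup>2)))"
  shows
    "((\<exists>\<alpha>::real. \<forall>f\<in>hardy2.
         (\<integral>\<^sup>+ t. ennreal ((norm (f (\<i> * complex_of_real t)))\<^sup>2) \<partial>\<mu>)
           \<le> ennreal (\<alpha> * (hardy_norm f)\<^sup>2))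
      \<longleftrightarrow> (\<exists>H. positive_hankel_operator H \<and> is_carleson_measure \<mu> H))
   \<and> ((\<exists>\<alpha>::real. \<forall>f\<in>hardy2.
         (\<integral>\<^sup>+ t. ennreal ((norm (f (\<i> * complex_of_real t)))\<^sup>2) \<partial>\<mu>)
           \<le> ennreal (\<alpha> * (hardy_norm f)\<^sup>2))
      \<longleftrightarrow> bigo_id_at_0 (\<lambda>x. emeasure \<rho> {0<..<x}) \<and>
          bigo_id_at_0 (\<lambda>x. emeasure \<rho> {inverse x<..}))
   \<and> (bigo_id_at_0 (\<lambda>x. emeasure \<rho> {0<..<x}) \<and>
      bigo_id_at_0 (\<lambda>x. emeasure \<rho> {inverse x<..})
      \<longrightarrow> emeasure \<rho> {0<..} < \<infinity> \<and>
          (\<exists>\<beta>>0. \<exists>\<gamma>>0. \<forall>\<epsilon>>0. \<forall>t>0.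
             emeasure \<rho> {0<..\<epsilon>} \<le> ennreal (\<beta> * \<epsilon>) \<and>
             emeasure \<rho> {t..} \<le> ennreal (\<gamma> / t)))"
    (is "(?a \<longleftrightarrow> ?h) \<and> (?a \<longleftrightarrow> ?b) \<and> (?b \<longrightarrow> ?c)")
proof -
  note M = assms(1) and \<rho> = assms(2)
  \<comment> \<open>The global bounds come first because their constants feed the growth condition,
    from which both (a) and the operator are obtained.\<close>
  have bc: ?c if ?b using density_global_bounds[OF M \<rho>] that by blast
  have growth: "\<exists>C. carleson_ray \<mu> C" if b: ?b
  proof -
    obtain \<beta> \<gamma> where "\<beta> > 0" "\<gamma> > 0" "\<And>e. e > 0 \<Longrightarrow> emeasure \<rho> {0<..e} \<le> ennreal (\<beta> * e)"
      "\<And>t. t > 0 \<Longrightarrow> emeasure \<rho> {t..} \<le> ennreal (\<gamma> / t)"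
      using bc[OF b] zero_less_one by blast
    from linear_growth_of_density_bounds[OF M \<rho> this]
    show ?thesis using M by (auto simp: carleson_ray_def)
  qed
  have ba: ?a if b: ?b
  proof -
    obtain C where "carleson_ray \<mu> C" using growth[OF b] by blast
    then interpret carleson_ray \<mu> C .
    show ?thesis using carleson_embedding_ray[OF M C growth] by blast
  qed
  have ab: ?b if a: ?a
  proof -
    obtain \<alpha> where \<alpha>: "\<And>f. f \<in> hardy2 \<Longrightarrow> (\<integral>\<^sup>+ t. ennreal ((norm (f (\<i> * complex_of_real t)))\<^sup>2) \<partial>\<mu>) \<le> ennreal (\<alpha> * (hardy_norm f)\<^sup>2)"
      using a by blast
    from bigo_of_carleson[OF M \<rho> \<alpha>] show ?thesis by blast
  qed
  have bh: ?h if b: ?b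
  proof -
    obtain C where "carleson_ray \<mu> C" using growth[OF b] by blast
    then interpret carleson_ray \<mu> C .
    show ?thesis using carleson_hankel_positive_hankel_operator by blast
  qed
  have ha: ?a if ?h
    using that carleson_of_hankel unfolding positive_hankel_operator_def by blast
  show ?thesis using ab ba bh ha bc by blast
qed

end
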